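(* Let $\lambda=\Delta(q^{2})/\Delta(q)\in\mathbb{Z}[[q]]$. For every sequence $(a_n)_{n\ge 0}$ in $\mathbb{Q}_2$ with $|a_n|_2\,2^{6n}\to 0$, the $2$-adic modular form $f=\sum_{n\ge0}a_n\lambda^{n}$ lies in the image of the $2$-adic character map $\widehat{F}_S:S_1\to\mathcal{M}_2$; that is, there is $v\in S_1$ with $\widehat F_S(v,q)=f$. In other words, the space $\mathcal{M}_2^{\dagger}(1/2)=\{\sum_{n\ge0}a_n\lambda^n : a_n\in\mathbb{Q}_2,\ |a_n|_2\,2^{6n}\to0\}$ of $2$-adic overconvergent modular forms of level one and weight zero is contained in $\widehat F_S(S_1)$.
   Context: Let $E_k(q)=1-\frac{2k}{B_k}\sum_{n\ge1}\sigma_{k-1}(n)q^n$ ($B_k$ the Bernoulli numbers), $\Delta=(E_4^3-E_6^2)/1728$. The ring $\mathcal{M}_2$ of $2$-adic modular forms (of weight zero, in Serre's sense) is the completion of $\mathbb{Q}_2[E_4,E_6]$ inside $\mathbb{Q}_2[[q]]$ for the sup-norm of coefficients; the series $\sum a_n\lambda^n$ above converges in this norm. Let $S$ be the Heisenberg vertex operator algebra of central charge $1$ over $\mathbb{Q}_2$: as a vector space $S=\mathbb{Q}_2[h(-1),h(-2),\dots]\mathbf 1$, where for $n\ge1$ the mode $h(-n)$ acts by multiplication, $h(n)$ acts as $n\,\partial/\partial h(-n)$, and $h(0)=0$; the (round-bracket) weight of $h(-n_1)\cdots h(-n_r)\mathbf 1$ is $\sum n_i$, giving $S=\bigoplus_{n\ge0}S_{(n)}$.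 The normalized character of $v\in S$ is $F_S(v,q)=q^{-1/24}\eta(q)\sum_{n\ge0}\mathrm{Tr}_{S_{(n)}}o(v)\,q^n$, where $\eta(q)=q^{1/24}\prod_{n\ge1}(1-q^n)$ and $o(v)$ is the zero mode of $v$ (the component of the vertex operator of $v$ preserving the grading); $F_S$ takes values in $\mathbb{Q}_2[E_2,E_4,E_6]$. For a monomial $h^I=\prod_{i\in I}h(i)\mathbf 1$ ($I$ a finite multiset of negative integers) put $|\sum_I a_Ih^I|=\sup_I|a_I|_2$; $S_1$ is the completion of $S$ with respect to this norm (the $2$-adic Heisenberg VOA). The $2$-adic character map $\widehat F_S:S_1\to\mathcal M_2$ is the (continuous, linear) extension of $F_S$ to $S_1$. *)

theory Defs
  imports
    "HOL-Analysis.Analysis"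
    "HOL-Computational_Algebra.Primes"
    "HOL-Computational_Algebra.Formal_Power_Series"
    "HOL-Library.Poly_Mapping"
    "HOL-Library.Groups_Big_Fun"
begin

section \<open>The field of 2-adic numbers\<close>

definition abs2 :: "rat \<Rightarrow> real" where
  "abs2 x = (if x = 0 then 0 else
     2 powi (int (multiplicity 2 (snd (quotient_of x))) - int (multiplicity 2 (fst (quotient_of x)))))"

lemma abs2_Fract:
  assumes "a \<noteq> 0" "b \<noteq> 0"
  shows "abs2 (Fract a b) = 2 powi (int (multiplicity 2 b) - int (multiplicity 2 a))"
proof -
  obtain c d where cd: "quotient_of (Fract a b) = (c, d)" by fastforce
  have d: "d > 0" using cd quotient_of_denom_pos by blast
  have eq: "Fract a b = Fract c d"
    using cd by (metis quotient_of_div Fract_of_int_quotient)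
  have c: "c \<noteq> 0"
    using eq assms d by (auto simp: eq_rat)
  have "a * d = c * b" using eq assms d by (simp add: eq_rat)
  then have "multiplicity 2 (a * d) = multiplicity 2 (c * b)" by simp
  moreover have "prime_elem (2::int)" by simp
  ultimately have "multiplicity 2 a + multiplicity 2 d = multiplicity 2 c + multiplicity 2 b"
    using assms c d by (simp add: prime_elem_multiplicity_mult_distrib)
  then have "int (multiplicity 2 d) - int (multiplicity 2 c)
      = int (multiplicity 2 b) - int (multiplicity 2 a)" by linarith
  moreover have "Fract a b \<noteq> 0" using assms by (simp add: eq_rat Zero_rat_def)
  ultimately show ?thesis by (simp add: abs2_def cd)
qed

lemma abs2_0 [simp]: "abs2 0 = 0" by (simp add: abs2_def)

lemma abs2_eq_0 [simp]: "abs2 x = 0 \<longleftrightarrow> x = 0" by (simp add: abs2_def)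

lemma abs2_nonneg [simp]: "abs2 x \<ge> 0" by (simp add: abs2_def)

lemma abs2_pos [simp]: "abs2 x > 0 \<longleftrightarrow> x \<noteq> 0" by (simp add: abs2_def)

lemma abs2_1 [simp]: "abs2 1 = 1"
  by (simp add: abs2_def)

lemma abs2_mult: "abs2 (x * y) = abs2 x * abs2 y"
proof (cases "x = 0 \<or> y = 0")
  case False
  obtain a b where x: "x = Fract a b" "b > 0" by (cases x)
  obtain c d where y: "y = Fract c d" "d > 0" by (cases y)
  have nz: "a \<noteq> 0" "c \<noteq> 0" using False x y by (auto simp: rat_number_collapse)
  have "abs2 (x * y) = 2 powi (int (multiplicity 2 (b * d)) - int (multiplicity 2 (a * c)))"
    using nz x y by (simp add: abs2_Fract)
  also have "int (multiplicity 2 (b * d)) - int (multiplicity 2 (a * c))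
      = (int (multiplicity 2 b) - int (multiplicity 2 a)) + (int (multiplicity 2 d) - int (multiplicity 2 c))"
    using nz x y by (simp add: prime_elem_multiplicity_mult_distrib)
  also have "2 powi \<dots> = abs2 x * abs2 y"
    using nz x y by (subst power_int_add) (auto simp: abs2_Fract)
  finally show ?thesis .
qed auto

lemma abs2_minus [simp]: "abs2 (- x) = abs2 x"
proof -
  have "abs2 (- 1) * abs2 (- 1) = 1"
    using abs2_mult[of "- 1" "- 1"] by simp
  then have "abs2 (- 1) = 1"
    using abs2_nonneg[of "- 1"] by (auto simp: square_eq_1_iff)
  then show ?thesis using abs2_mult[of "- 1" x] by simp
qed

lemma abs2_minus_commute: "abs2 (x - y) = abs2 (y - x)"
  by (metis abs2_minus minus_diff_eq)

lemma abs2_add_le_max: "abs2 (x + y) \<le> max (abs2 x) (abs2 y)"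
proof (cases "x = 0 \<or> y = 0 \<or> x + y = 0")
  case True
  then show ?thesis by (auto simp: max_def)
next
  case False
  obtain a b where x: "x = Fract a b" "b > 0" by (cases x)
  obtain c d where y: "y = Fract c d" "d > 0" by (cases y)
  have nz: "a \<noteq> 0" "c \<noteq> 0" using False x y by (auto simp: rat_number_collapse)
  have xy: "x + y = Fract (a * d + c * b) (b * d)" using x y by simp
  have nz2: "a * d + c * b \<noteq> 0" using False xy by (auto simp: rat_number_collapse)
  have X: "x = Fract (a * d) (b * d)" and Y: "y = Fract (c * b) (b * d)"
    using x y by (simp_all add: eq_rat)
  define k where "k = min (multiplicity 2 (a * d)) (multiplicity 2 (c * b))"
  have "2 ^ k dvd a * d" "2 ^ k dvd c * b"
    by (auto simp: k_def intro!: multiplicity_dvd')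
  then have "2 ^ k dvd a * d + c * b" by simp
  then have k: "k \<le> multiplicity 2 (a * d + c * b)"
    using nz2 by (intro multiplicity_geI) auto
  have A: "abs2 (x + y) = 2 powi (int (multiplicity 2 (b * d)) - int (multiplicity 2 (a * d + c * b)))"
    unfolding xy using nz2 x y by (intro abs2_Fract) auto
  have B: "abs2 x = 2 powi (int (multiplicity 2 (b * d)) - int (multiplicity 2 (a * d)))"
    unfolding X using nz x y by (intro abs2_Fract) auto
  have C: "abs2 y = 2 powi (int (multiplicity 2 (b * d)) - int (multiplicity 2 (c * b)))"
    unfolding Y using nz x y by (intro abs2_Fract) auto
  show ?thesis
  proof (cases "k = multiplicity 2 (a * d)")
    case True
    then have "abs2 (x + y) \<le> abs2 x"
      unfolding A B using k by (intro power_int_increasing) auto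
    then show ?thesis by simp
  next
    case False
    then have "k = multiplicity 2 (c * b)" by (auto simp: k_def min_def split: if_splits)
    then have "abs2 (x + y) \<le> abs2 y"
      unfolding A C using k by (intro power_int_increasing) auto
    then show ?thesis by simp
  qed
qed

lemma abs2_diff_le_max: "abs2 (x - y) \<le> max (abs2 x) (abs2 y)"
  using abs2_add_le_max[of x "- y"] by simp

lemma abs2_triangle: "abs2 (x + y) \<le> abs2 x + abs2 y"
  using abs2_add_le_max[of x y] abs2_nonneg[of x] abs2_nonneg[of y] by linarith

lemma abs2_triangle_rev: "\<bar>abs2 x - abs2 y\<bar> \<le> abs2 (x - y)"
  using abs2_triangle[of "x - y" y] abs2_triangle[of "y - x" x] abs2_minus_commute[of x y]
  by simp

lemma abs2_inverse: "abs2 (inverse x) = inverse (abs2 x)"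
proof (cases "x = 0")
  case False
  then have "abs2 x * abs2 (inverse x) = 1" by (simp flip: abs2_mult)
  then show ?thesis by (rule inverse_unique[symmetric])
qed auto

definition cauchy2 :: "(nat \<Rightarrow> rat) \<Rightarrow> bool" where
  "cauchy2 X \<longleftrightarrow> (\<forall>e>0. \<exists>k. \<forall>m\<ge>k. \<forall>n\<ge>k. abs2 (X m - X n) < e)"

definition null2 :: "(nat \<Rightarrow> rat) \<Rightarrow> bool" where
  "null2 X \<longleftrightarrow> (\<lambda>n. abs2 (X n)) \<longlonglongrightarrow> 0"

lemma null2_const [simp]: "null2 (\<lambda>n. c) \<longleftrightarrow> c = 0"
  by (simp add: null2_def LIMSEQ_const_iff)

lemma null2_minus: "null2 X \<Longrightarrow> null2 (\<lambda>n. - X n)"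
  by (simp add: null2_def)

lemma null2_add:
  assumes "null2 X" "null2 Y" shows "null2 (\<lambda>n. X n + Y n)"
  unfolding null2_def
proof (rule tendsto_sandwich[OF always_eventually always_eventually])
  show "\<forall>n. 0 \<le> abs2 (X n + Y n)" "\<forall>n. abs2 (X n + Y n) \<le> abs2 (X n) + abs2 (Y n)"
    by (auto simp: abs2_triangle)
  show "(\<lambda>n. abs2 (X n) + abs2 (Y n)) \<longlonglongrightarrow> 0"
    using assms tendsto_add by (fastforce simp: null2_def)
qed auto

lemma null2_diff: "null2 X \<Longrightarrow> null2 Y \<Longrightarrow> null2 (\<lambda>n. X n - Y n)"
  using null2_add[OF _ null2_minus] by fastforce

lemma cauchy2_const [simp]: "cauchy2 (\<lambda>n. c)"
  by (simp add: cauchy2_def)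

lemma cauchy2_minus [simp]: "cauchy2 X \<Longrightarrow> cauchy2 (\<lambda>n. - X n)"
  by (simp add: cauchy2_def abs2_minus_commute)

lemma cauchy2_add [simp]:
  assumes "cauchy2 X" "cauchy2 Y" shows "cauchy2 (\<lambda>n. X n + Y n)"
  unfolding cauchy2_def
proof (intro allI impI)
  fix e :: real assume e: "e > 0"
  obtain i where i: "\<forall>m\<ge>i. \<forall>n\<ge>i. abs2 (X m - X n) < e" using assms e by (auto simp: cauchy2_def)
  obtain j where j: "\<forall>m\<ge>j. \<forall>n\<ge>j. abs2 (Y m - Y n) < e" using assms e by (auto simp: cauchy2_def)
  have "abs2 (X m + Y m - (X n + Y n)) < e" if "m \<ge> max i j" "n \<ge> max i j" for m n
  proof -
    have "abs2 (X m + Y m - (X n + Y n)) \<le> max (abs2 (X m - X n)) (abs2 (Y m - Y n))"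
      using abs2_add_le_max[of "X m - X n" "Y m - Y n"] by (simp add: algebra_simps)
    also have "\<dots> < e" using i j that by simp
    finally show ?thesis .
  qed
  then show "\<exists>k. \<forall>m\<ge>k. \<forall>n\<ge>k. abs2 (X m + Y m - (X n + Y n)) < e" by blast
qed

lemma cauchy2_Cauchy_abs2:
  assumes "cauchy2 X" shows "convergent (\<lambda>n. abs2 (X n))"
proof -
  have "Cauchy (\<lambda>n. abs2 (X n))"
    unfolding Cauchy_def dist_real_def
    using assms abs2_triangle_rev unfolding cauchy2_def by (meson le_less_trans)
  then show ?thesis by (simp add: Cauchy_convergent)
qed

lemma cauchy2_bounded:
  assumes "cauchy2 X" shows "\<exists>B>0. \<forall>n. abs2 (X n) \<le> B"
  using convergent_imp_Bseq[OF cauchy2_Cauchy_abs2[OF assms]] by (auto elim!: BseqE)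

lemma null2_mult_bounded:
  assumes X: "\<And>n. abs2 (X n) \<le> B" and Y: "null2 Y"
  shows "null2 (\<lambda>n. X n * Y n)"
  unfolding null2_def
proof (rule tendsto_sandwich[OF always_eventually always_eventually])
  show "\<forall>n. 0 \<le> abs2 (X n * Y n)" "\<forall>n. abs2 (X n * Y n) \<le> B * abs2 (Y n)"
    by (auto simp: abs2_mult intro!: mult_right_mono X)
  show "(\<lambda>n. B * abs2 (Y n)) \<longlonglongrightarrow> 0"
    using Y tendsto_mult_right_zero by (auto simp: null2_def)
qed auto

lemma cauchy2_mult [simp]:
  assumes "cauchy2 X" "cauchy2 Y" shows "cauchy2 (\<lambda>n. X n * Y n)"
proof -
  obtain A where A: "A > 0" "\<And>n. abs2 (X n) \<le> A" using cauchy2_bounded[OF assms(1)] by blast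
  obtain B where B: "B > 0" "\<And>n. abs2 (Y n) \<le> B" using cauchy2_bounded[OF assms(2)] by blast
  show ?thesis unfolding cauchy2_def
  proof (intro allI impI)
    fix e :: real assume e: "e > 0"
    have "e / B > 0" "e / A > 0" using e A B by auto
    then obtain i j where i: "\<forall>m\<ge>i. \<forall>n\<ge>i. abs2 (X m - X n) < e / B"
      and j: "\<forall>m\<ge>j. \<forall>n\<ge>j. abs2 (Y m - Y n) < e / A"
      using assms unfolding cauchy2_def by metis
    have "abs2 (X m * Y m - X n * Y n) < e" if "m \<ge> max i j" "n \<ge> max i j" for m n
    proof -
      have "X m * Y m - X n * Y n = X m * (Y m - Y n) + (X m - X n) * Y n"
        by (simp add: algebra_simps)
      then have "abs2 (X m * Y m - X n * Y n)
          \<le> max (abs2 (X m) * abs2 (Y m - Y n)) (abs2 (X m - X n) * abs2 (Y n))"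
        using abs2_add_le_max by (metis abs2_mult)
      moreover have "abs2 (X m) * abs2 (Y m - Y n) \<le> A * abs2 (Y m - Y n)"
        by (intro mult_right_mono A) auto
      moreover have "A * abs2 (Y m - Y n) < e"
        using j that A by (simp add: pos_less_divide_eq mult.commute)
      moreover have "abs2 (X m - X n) * abs2 (Y n) \<le> abs2 (X m - X n) * B"
        by (intro mult_left_mono B) auto
      moreover have "abs2 (X m - X n) * B < e"
        using i that B by (simp add: pos_less_divide_eq mult.commute)
      ultimately show ?thesis by linarith
    qed
    then show "\<exists>k. \<forall>m\<ge>k. \<forall>n\<ge>k. abs2 (X m * Y m - X n * Y n) < e" by blast
  qed
qed

lemma cauchy2_not_null:
  assumes "cauchy2 X" "\<not> null2 X"
  shows "\<exists>b>0. \<exists>k. \<forall>n\<ge>k. abs2 (X n) > b"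
proof -
  obtain L where L: "(\<lambda>n. abs2 (X n)) \<longlonglongrightarrow> L"
    using cauchy2_Cauchy_abs2[OF assms(1)] by (auto simp: convergent_def)
  have "L \<ge> 0" using L by (rule LIMSEQ_le_const) auto
  moreover have "L \<noteq> 0" using L assms(2) by (auto simp: null2_def)
  ultimately have "L > 0" by simp
  then have "eventually (\<lambda>n. abs2 (X n) > L / 2) sequentially"
    using order_tendstoD(1)[OF L, of "L / 2"] by simp
  then show ?thesis using \<open>L > 0\<close>
    by (intro exI[of _ "L / 2"]) (auto simp: eventually_sequentially)
qed

lemma cauchy2_inverse [simp]:
  assumes X: "cauchy2 X" "\<not> null2 X" shows "cauchy2 (\<lambda>n. inverse (X n))"
  unfolding cauchy2_def
proof (intro allI impI)
  fix e :: real assume e: "e > 0"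
  obtain b k where b: "b > 0" "\<And>n. n \<ge> k \<Longrightarrow> abs2 (X n) > b" using cauchy2_not_null[OF X] by blast
  have "e * (b * b) > 0" using e b by simp
  then obtain i where i: "\<forall>m\<ge>i. \<forall>n\<ge>i. abs2 (X m - X n) < e * (b * b)"
    using X unfolding cauchy2_def by metis
  have "abs2 (inverse (X m) - inverse (X n)) < e" if "m \<ge> max i k" "n \<ge> max i k" for m n
  proof -
    have bm: "abs2 (X m) > b" and bn: "abs2 (X n) > b" using b that by auto
    then have nz: "X m \<noteq> 0" "X n \<noteq> 0" using b(1) by (auto simp flip: abs2_eq_0)
    have "(inverse (X m) - inverse (X n)) * (X m * X n) = X n - X m"
      using nz by (simp add: divide_simps)
    then have "abs2 (inverse (X m) - inverse (X n)) * (abs2 (X m) * abs2 (X n)) = abs2 (X n - X m)"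
      by (metis abs2_mult)
    also have "\<dots> < e * (b * b)" using i that by simp
    also have "\<dots> \<le> e * (abs2 (X m) * abs2 (X n))"
      using bm bn b e by (intro mult_left_mono mult_mono) auto
    finally show ?thesis using nz by (simp add: mult_less_cancel_right)
  qed
  then show "\<exists>k. \<forall>m\<ge>k. \<forall>n\<ge>k. abs2 (inverse (X m) - inverse (X n)) < e" by blast
qed

lemma null2_diff_inverse:
  assumes X: "cauchy2 X" "\<not> null2 X" and Y: "cauchy2 Y" "\<not> null2 Y"
    and XY: "null2 (\<lambda>n. X n - Y n)"
  shows "null2 (\<lambda>n. inverse (X n) - inverse (Y n))"
proof -
  obtain b k where b: "b > 0" "\<And>n. n \<ge> k \<Longrightarrow> abs2 (X n) > b" using cauchy2_not_null[OF X] by blast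
  obtain c l where c: "c > 0" "\<And>n. n \<ge> l \<Longrightarrow> abs2 (Y n) > c" using cauchy2_not_null[OF Y] by blast
  obtain B where B: "B > 0" "\<And>n. abs2 (inverse (X n) * inverse (Y n)) \<le> B"
    using cauchy2_bounded[OF cauchy2_mult[OF cauchy2_inverse[OF X] cauchy2_inverse[OF Y]]] by blast
  have "null2 (\<lambda>n. inverse (X n) * inverse (Y n) * (- (X n - Y n)))"
    by (intro null2_mult_bounded[OF B(2)] null2_minus XY)
  moreover have "eventually (\<lambda>n. abs2 (inverse (X n) * inverse (Y n) * (- (X n - Y n)))
      = abs2 (inverse (X n) - inverse (Y n))) sequentially"
    using eventually_ge_at_top[of "max k l"]
  proof eventually_elim
    case (elim n)
    then have "abs2 (X n) > b" "abs2 (Y n) > c" using b c by auto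
    then have "X n \<noteq> 0" "Y n \<noteq> 0" using b(1) c(1) by (auto simp flip: abs2_eq_0)
    then have "inverse (X n) * inverse (Y n) * (- (X n - Y n)) = inverse (X n) - inverse (Y n)"
      by (simp add: field_simps)
    then show ?case by (simp only:)
  qed
  ultimately show ?thesis
    unfolding null2_def by (rule Lim_transform_eventually)
qed

definition rel2 :: "(nat \<Rightarrow> rat) \<Rightarrow> (nat \<Rightarrow> rat) \<Rightarrow> bool" where
  "rel2 X Y \<longleftrightarrow> cauchy2 X \<and> cauchy2 Y \<and> null2 (\<lambda>n. X n - Y n)"

lemma part_equivp_rel2: "part_equivp rel2"
proof (rule part_equivpI)
  show "\<exists>X. rel2 X X" by (auto simp: rel2_def intro!: exI[of _ "\<lambda>_. 0"])
  show "symp rel2"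
    by (rule sympI) (auto simp: rel2_def null2_def abs2_minus_commute)
  show "transp rel2"
    by (rule transpI) (auto simp: rel2_def dest: null2_add)
qed

text \<open>\<open>\<rat>\<^sub>2\<close> is the completion of \<open>\<rat>\<close> for \<open>abs2\<close>: Cauchy sequences modulo null sequences.\<close>

quotient_type Q2 = "nat \<Rightarrow> rat" / partial: rel2
  morphisms rep_Q2 mk_Q2
  by (rule part_equivp_rel2)

lemma Q2_cases:
  obtains X where "cauchy2 X" "x = mk_Q2 X"
  using Quotient_rep_reflp[OF Quotient_Q2] Quotient_abs_rep[OF Quotient_Q2]
  by (metis rel2_def)

lemma mk_Q2_eq: "cauchy2 X \<Longrightarrow> cauchy2 Y \<Longrightarrow> mk_Q2 X = mk_Q2 Y \<longleftrightarrow> null2 (\<lambda>n. X n - Y n)"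
  using Quotient_rel[OF Quotient_Q2, of X Y] by (auto simp: rel2_def)

instantiation Q2 :: field
begin

lift_definition zero_Q2 :: Q2 is "\<lambda>n. 0" by (simp add: rel2_def)

lift_definition one_Q2 :: Q2 is "\<lambda>n. 1" by (simp add: rel2_def)

lift_definition plus_Q2 :: "Q2 \<Rightarrow> Q2 \<Rightarrow> Q2" is "\<lambda>X Y n. X n + Y n"
  unfolding rel2_def by (simp only: add_diff_add cauchy2_add null2_add simp_thms)

lift_definition uminus_Q2 :: "Q2 \<Rightarrow> Q2" is "\<lambda>X n. - X n"
  unfolding rel2_def by (simp only: minus_diff_minus cauchy2_minus null2_minus simp_thms)

lift_definition times_Q2 :: "Q2 \<Rightarrow> Q2 \<Rightarrow> Q2" is "\<lambda>X Y n. X n * Y n"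
proof -
  fix X X' Y Y' :: "nat \<Rightarrow> rat"
  assume XY: "rel2 X X'" "rel2 Y Y'"
  obtain A where A: "A > 0" "\<And>n. abs2 (X n) \<le> A" using cauchy2_bounded[of X] XY unfolding rel2_def by blast
  obtain B where B: "B > 0" "\<And>n. abs2 (Y' n) \<le> B" using cauchy2_bounded[of Y'] XY unfolding rel2_def by blast
  have "null2 (\<lambda>n. X n * (Y n - Y' n) + Y' n * (X n - X' n))"
    using XY by (intro null2_add null2_mult_bounded[OF A(2)] null2_mult_bounded[OF B(2)]) (auto simp: rel2_def)
  then show "rel2 (\<lambda>n. X n * Y n) (\<lambda>n. X' n * Y' n)"
    using XY by (simp add: rel2_def algebra_simps)
qed

lift_definition inverse_Q2 :: "Q2 \<Rightarrow> Q2"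
  is "\<lambda>X. if null2 X then (\<lambda>n. 0) else (\<lambda>n. inverse (X n))"
proof -
  fix X Y assume XY: "rel2 X Y"
  have "null2 X \<longleftrightarrow> null2 Y"
    using XY null2_diff[of X "\<lambda>n. X n - Y n"] null2_add[of Y "\<lambda>n. X n - Y n"]
    by (auto simp: rel2_def)
  then show "?thesis X Y" using XY
    by (auto simp: rel2_def intro: null2_diff_inverse)
qed

definition minus_Q2 :: "Q2 \<Rightarrow> Q2 \<Rightarrow> Q2" where "x - y = x + (- y)" for x y :: Q2

definition divide_Q2 :: "Q2 \<Rightarrow> Q2 \<Rightarrow> Q2" where "x div y = x * inverse y" for x y :: Q2

instance
proof
  fix a b c :: Q2
  show "a + b + c = a + (b + c)" by transfer (simp add: rel2_def ac_simps)
  show "a + b = b + a" by transfer (simp add: rel2_def ac_simps)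
  show "0 + a = a" by transfer (simp add: rel2_def)
  show "- a + a = 0" by transfer (simp add: rel2_def)
  show "a - b = a + - b" by (rule minus_Q2_def)
  show "a * b * c = a * (b * c)" by transfer (simp add: rel2_def ac_simps)
  show "a * b = b * a" by transfer (simp add: rel2_def ac_simps)
  show "1 * a = a" by transfer (simp add: rel2_def)
  show "(a + b) * c = a * c + b * c" by transfer (simp add: rel2_def distrib_right)
  show "0 \<noteq> (1::Q2)" by transfer (simp add: rel2_def)
  show "a \<noteq> 0 \<Longrightarrow> inverse a * a = 1"
  proof transfer
    fix X assume X: "rel2 X X" "\<not> rel2 X (\<lambda>n. 0)"
    then have X': "cauchy2 X" "\<not> null2 X" by (auto simp: rel2_def)
    obtain b k where b: "b > 0" "\<And>n. n \<ge> k \<Longrightarrow> abs2 (X n) > b" using cauchy2_not_null[OF X'] by blast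
    have "eventually (\<lambda>n. abs2 (inverse (X n) * X n - 1) = 0) sequentially"
      using eventually_ge_at_top[of k]
    proof eventually_elim
      case (elim n)
      then have "abs2 (X n) > 0" using b by (meson less_trans)
      then show ?case by simp
    qed
    then have "null2 (\<lambda>n. inverse (X n) * X n - 1)"
      unfolding null2_def by (rule tendsto_eventually)
    then show "rel2 (\<lambda>n. (if null2 X then \<lambda>n. 0 else (\<lambda>n. inverse (X n))) n * X n) (\<lambda>n. 1)"
      using X' by (simp add: rel2_def)
  qed
  show "a div b = a * inverse b" by (rule divide_Q2_def)
  show "inverse (0::Q2) = 0" by transfer (simp add: rel2_def)
qed

end

lemma mk_Q2_0: "0 = mk_Q2 (\<lambda>n. 0)" by (simp add: zero_Q2_def)
lemma mk_Q2_1: "1 = mk_Q2 (\<lambda>n. 1)" by (simp add: one_Q2_def)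

lemma mk_Q2_add: "cauchy2 X \<Longrightarrow> cauchy2 Y \<Longrightarrow> mk_Q2 X + mk_Q2 Y = mk_Q2 (\<lambda>n. X n + Y n)"
  by (rule plus_Q2.abs_eq) (simp_all add: rel2_def)

lemma mk_Q2_minus: "cauchy2 X \<Longrightarrow> - mk_Q2 X = mk_Q2 (\<lambda>n. - X n)"
  by (rule uminus_Q2.abs_eq) (simp_all add: rel2_def)

lemma mk_Q2_diff: "cauchy2 X \<Longrightarrow> cauchy2 Y \<Longrightarrow> mk_Q2 X - mk_Q2 Y = mk_Q2 (\<lambda>n. X n - Y n)"
  by (simp add: minus_Q2_def mk_Q2_minus mk_Q2_add)

lemma mk_Q2_mult: "cauchy2 X \<Longrightarrow> cauchy2 Y \<Longrightarrow> mk_Q2 X * mk_Q2 Y = mk_Q2 (\<lambda>n. X n * Y n)"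
  by (rule times_Q2.abs_eq) (simp_all add: rel2_def)

lemma of_nat_Q2: "of_nat k = mk_Q2 (\<lambda>n. of_nat k)"
  by (induction k) (simp_all add: mk_Q2_0 mk_Q2_1 mk_Q2_add)

instance Q2 :: field_char_0
proof
  show "inj (of_nat :: nat \<Rightarrow> Q2)"
    by (rule injI) (simp add: of_nat_Q2 mk_Q2_eq)
qed

lemma of_int_Q2: "of_int k = mk_Q2 (\<lambda>n. of_int k)"
  by (cases k rule: int_diff_cases) (simp add: of_nat_Q2 mk_Q2_diff)

lemma of_rat_Q2: "of_rat r = mk_Q2 (\<lambda>n. r)"
proof -
  obtain a b where r: "r = Fract a b" "b > 0" by (cases r)
  have "r * of_int b = of_int a" using r by (simp add: Fract_of_int_quotient)
  then have "mk_Q2 (\<lambda>n. r) * of_int b = of_int a"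
    by (simp add: of_int_Q2 mk_Q2_mult)
  moreover have "of_int b \<noteq> (0::Q2)" using r by simp
  ultimately show ?thesis using r by (simp add: of_rat_rat field_simps)
qed

text \<open>The 2-adic absolute value. The library constant \<open>norm\<close> is reserved for real normed vector
  spaces.\<close>

lift_definition qabs :: "Q2 \<Rightarrow> real" is "\<lambda>X. lim (\<lambda>n. abs2 (X n))"
proof -
  fix X Y assume XY: "rel2 X Y"
  then obtain L where L: "(\<lambda>n. abs2 (X n)) \<longlonglongrightarrow> L"
    using cauchy2_Cauchy_abs2 by (auto simp: rel2_def convergent_def)
  have "(\<lambda>n. abs2 (Y n) - abs2 (X n)) \<longlonglongrightarrow> 0"
  proof (rule Lim_null_comparison[OF always_eventually])
    show "\<forall>n. norm (abs2 (Y n) - abs2 (X n)) \<le> abs2 (X n - Y n)"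
      using abs2_triangle_rev abs2_minus_commute by (metis real_norm_def)
    show "(\<lambda>n. abs2 (X n - Y n)) \<longlonglongrightarrow> 0" using XY by (simp add: rel2_def null2_def)
  qed
  then have "(\<lambda>n. abs2 (Y n)) \<longlonglongrightarrow> L" using tendsto_add[OF L] by fastforce
  with L show "lim (\<lambda>n. abs2 (X n)) = lim (\<lambda>n. abs2 (Y n))" by (simp add: limI)
qed

lemma qabs_mk:
  assumes "cauchy2 X" shows "(\<lambda>n. abs2 (X n)) \<longlonglongrightarrow> qabs (mk_Q2 X)"
proof -
  have "qabs (mk_Q2 X) = lim (\<lambda>n. abs2 (X n))"
    by (rule qabs.abs_eq) (use assms in \<open>simp add: rel2_def\<close>)
  then show ?thesis using cauchy2_Cauchy_abs2[OF assms] by (simp add: convergent_LIMSEQ_iff)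
qed

lemma qabs_add_le_max: "qabs (x + y) \<le> max (qabs x) (qabs y)" for x y :: Q2
proof -
  obtain X where X: "cauchy2 X" "x = mk_Q2 X" by (rule Q2_cases)
  obtain Y where Y: "cauchy2 Y" "y = mk_Q2 Y" by (rule Q2_cases)
  have "(\<lambda>n. abs2 (X n + Y n)) \<longlonglongrightarrow> qabs (x + y)"
    using qabs_mk[of "\<lambda>n. X n + Y n"] X Y by (simp add: mk_Q2_add)
  moreover have "(\<lambda>n. max (abs2 (X n)) (abs2 (Y n))) \<longlonglongrightarrow> max (qabs x) (qabs y)"
    using qabs_mk X Y by (intro tendsto_max) auto
  ultimately show ?thesis by (rule LIMSEQ_le) (auto simp: abs2_add_le_max)
qed

lemma qabs_eq_0: "qabs x = 0 \<longleftrightarrow> x = 0" for x :: Q2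
proof -
  obtain X where X: "cauchy2 X" "x = mk_Q2 X" by (rule Q2_cases)
  have "qabs x = 0 \<longleftrightarrow> null2 X"
    unfolding null2_def using qabs_mk[OF X(1)] X(2) LIMSEQ_unique by auto
  also have "\<dots> \<longleftrightarrow> x = 0" using X by (simp add: mk_Q2_0 mk_Q2_eq)
  finally show ?thesis .
qed

lemma qabs_nonneg: "qabs x \<ge> 0" for x :: Q2
proof -
  obtain X where X: "cauchy2 X" "x = mk_Q2 X" by (rule Q2_cases)
  show ?thesis using qabs_mk[OF X(1)] unfolding X(2) by (rule LIMSEQ_le_const) auto
qed

lemma qabs_minus: "qabs (- x) = qabs x" for x :: Q2
proof -
  obtain X where X: "cauchy2 X" "x = mk_Q2 X" by (rule Q2_cases)
  show ?thesis
    using qabs_mk[of X] qabs_mk[of "\<lambda>n. - X n"] X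
    by (auto simp: mk_Q2_minus intro: LIMSEQ_unique)
qed

instantiation Q2 :: metric_space
begin

definition dist_Q2 :: "Q2 \<Rightarrow> Q2 \<Rightarrow> real" where "dist x y = qabs (x - y)" for x y :: Q2

definition uniformity_Q2 :: "(Q2 \<times> Q2) filter" where
  "uniformity_Q2 = (INF e\<in>{0 <..}. principal {(x, y). dist x y < e})"

definition open_Q2 :: "Q2 set \<Rightarrow> bool" where
  "open_Q2 U \<longleftrightarrow> (\<forall>x\<in>U. eventually (\<lambda>(x', y). x' = x \<longrightarrow> y \<in> U) uniformity)"

instance
proof
  fix x y z :: Q2
  show "uniformity = (INF e\<in>{0 <..}. principal {(x::Q2, y). dist x y < e})"
    by (rule uniformity_Q2_def)
  show "open U \<longleftrightarrow> (\<forall>x\<in>U. eventually (\<lambda>(x', y). x' = x \<longrightarrow> y \<in> U) uniformity)" for U :: "Q2 set"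
    by (rule open_Q2_def)
  show "dist x y = 0 \<longleftrightarrow> x = y" by (simp add: dist_Q2_def qabs_eq_0)
  have "qabs (x - y) \<le> max (qabs (x - z)) (qabs (z - y))"
    using qabs_add_le_max[of "x - z" "z - y"] by simp
  also have "qabs (z - y) = qabs (y - z)" using qabs_minus[of "z - y"] by simp
  finally show "dist x y \<le> dist x z + dist y z"
    using qabs_nonneg[of "x - z"] qabs_nonneg[of "y - z"] by (simp add: dist_Q2_def max_def split: if_splits)
qed

end

lemma qabs_mult: "qabs (x * y) = qabs x * qabs y" for x y :: Q2
proof -
  obtain X where X: "cauchy2 X" "x = mk_Q2 X" by (rule Q2_cases)
  obtain Y where Y: "cauchy2 Y" "y = mk_Q2 Y" by (rule Q2_cases)
  have "(\<lambda>n. abs2 (X n * Y n)) \<longlonglongrightarrow> qabs (x * y)"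
    using qabs_mk[of "\<lambda>n. X n * Y n"] X Y by (simp add: mk_Q2_mult)
  moreover have "(\<lambda>n. abs2 (X n * Y n)) \<longlonglongrightarrow> qabs x * qabs y"
    unfolding abs2_mult using qabs_mk X Y by (intro tendsto_mult) auto
  ultimately show ?thesis by (rule LIMSEQ_unique)
qed

lemma qabs_of_rat: "qabs (of_rat r :: Q2) = abs2 r"
  using qabs_mk[of "\<lambda>n. r"] by (simp add: of_rat_Q2 LIMSEQ_const_iff)

lemma of_rat_dense_Q2:
  fixes x :: Q2 assumes "e > 0" obtains r where "dist (of_rat r) x < e"
proof -
  obtain X where X: "cauchy2 X" "x = mk_Q2 X" by (rule Q2_cases)
  obtain k where k: "\<forall>m\<ge>k. \<forall>n\<ge>k. abs2 (X m - X n) < e / 2"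
    using X assms unfolding cauchy2_def by (meson half_gt_zero)
  have "(\<lambda>n. abs2 (X k - X n)) \<longlonglongrightarrow> qabs (of_rat (X k) - x)"
    using qabs_mk[of "\<lambda>n. X k - X n"] X
    by (simp add: of_rat_Q2 mk_Q2_diff cauchy2_add[of "\<lambda>_. X k" "\<lambda>n. - X n", simplified])
  then have "qabs (of_rat (X k) - x) \<le> e / 2"
    by (rule LIMSEQ_le_const2) (use k less_imp_le in blast)
  then show ?thesis using that[of "X k"] assms by (simp add: dist_Q2_def)
qed

instance Q2 :: complete_space
proof
  fix S :: "nat \<Rightarrow> Q2" assume S: "Cauchy S"
  have "\<exists>r. dist (of_rat r) (S n) < 1 / real (Suc n)" for n
    using of_rat_dense_Q2[of "1 / real (Suc n)" "S n"] by auto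
  then obtain R where R: "\<And>n. dist (of_rat (R n)) (S n) < 1 / real (Suc n)" by metis
  have lim: "(\<lambda>n. dist (of_rat (R n)) (S n)) \<longlonglongrightarrow> 0"
  proof (rule tendsto_sandwich[OF always_eventually always_eventually tendsto_const])
    show "\<forall>n. 0 \<le> dist (of_rat (R n)) (S n)" by simp
    show "\<forall>n. dist (of_rat (R n)) (S n) \<le> 1 / real (Suc n)"
      using R less_imp_le by blast
    show "(\<lambda>n. 1 / real (Suc n)) \<longlonglongrightarrow> 0"
      by (rule LIMSEQ_Suc[OF lim_1_over_n])
  qed
  have "cauchy2 R" unfolding cauchy2_def
  proof (intro allI impI)
    fix e :: real assume e: "e > 0"
    obtain i where i: "\<forall>m\<ge>i. \<forall>n\<ge>i. dist (S m) (S n) < e / 3"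
      using S e unfolding Cauchy_def by (meson divide_pos_pos zero_less_numeral)
    obtain j where j: "\<forall>n\<ge>j. dist (of_rat (R n)) (S n) < e / 3"
      using order_tendstoD(2)[OF lim, of "e / 3"] e by (auto simp: eventually_sequentially)
    have "abs2 (R m - R n) < e" if "m \<ge> max i j" "n \<ge> max i j" for m n
    proof -
      have "abs2 (R m - R n) = dist (of_rat (R m) :: Q2) (of_rat (R n))"
        by (simp add: dist_Q2_def qabs_of_rat flip: of_rat_diff)
      also have "\<dots> \<le> dist (of_rat (R m)) (S m) + (dist (S m) (S n) + dist (of_rat (R n)) (S n))"
        using dist_triangle[of "of_rat (R m)" "of_rat (R n)" "S m"]
          dist_triangle[of "S m" "of_rat (R n)" "S n"] dist_commute[of "S n" "of_rat (R n)"]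
        by linarith
      also have "\<dots> < e / 3 + (e / 3 + e / 3)"
        using i j that by (intro add_strict_mono) auto
      finally show ?thesis by simp
    qed
    then show "\<exists>k. \<forall>m\<ge>k. \<forall>n\<ge>k. abs2 (R m - R n) < e" by blast
  qed
  have "(\<lambda>n. dist (of_rat (R n)) (mk_Q2 R)) \<longlonglongrightarrow> 0"
  proof (rule LIMSEQ_I)
    fix e :: real assume e: "e > 0"
    obtain k where k: "\<forall>m\<ge>k. \<forall>n\<ge>k. abs2 (R m - R n) < e / 2"
      using \<open>cauchy2 R\<close> e unfolding cauchy2_def by (meson half_gt_zero)
    have "dist (of_rat (R m)) (mk_Q2 R) < e" if "m \<ge> k" for m
    proof -
      have "cauchy2 (\<lambda>n. R m - R n)"
        using cauchy2_add[of "\<lambda>_. R m" "\<lambda>n. - R n"] \<open>cauchy2 R\<close> by simp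
      then have "(\<lambda>n. abs2 (R m - R n)) \<longlonglongrightarrow> qabs (of_rat (R m) - mk_Q2 R)"
        using qabs_mk[of "\<lambda>n. R m - R n"] \<open>cauchy2 R\<close> by (simp add: of_rat_Q2 mk_Q2_diff)
      then have "qabs (of_rat (R m) - mk_Q2 R) \<le> e / 2"
        by (rule LIMSEQ_le_const2) (use k that less_imp_le in blast)
      then show ?thesis using e by (simp add: dist_Q2_def)
    qed
    then show "\<exists>no. \<forall>n\<ge>no. norm (dist (of_rat (R n)) (mk_Q2 R) - 0) < e" by auto
  qed
  from tendsto_add[OF this lim] have sum0:
    "(\<lambda>n. dist (of_rat (R n)) (mk_Q2 R) + dist (of_rat (R n)) (S n)) \<longlonglongrightarrow> 0" by simp
  have "dist (S n) (mk_Q2 R) \<le> dist (of_rat (R n)) (mk_Q2 R) + dist (of_rat (R n)) (S n)" for n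
    using dist_triangle3[of "S n" "mk_Q2 R" "of_rat (R n)"] by simp
  then have "(\<lambda>n. dist (S n) (mk_Q2 R)) \<longlonglongrightarrow> 0"
    by (intro tendsto_sandwich[OF always_eventually always_eventually tendsto_const sum0]) simp_all
  then have "S \<longlonglongrightarrow> mk_Q2 R" by (rule tendsto_dist_iff[THEN iffD2])
  then show "convergent S" by (auto simp: convergent_def)
qed


section \<open>2-adic modular forms\<close>

definition bernoulli :: "nat \<Rightarrow> rat" where
  "bernoulli k = fact k * fps_nth (fps_X / (fps_exp 1 - 1)) k"

definition divisor_sigma :: "nat \<Rightarrow> nat \<Rightarrow> nat" where
  "divisor_sigma k n = (\<Sum>d | d dvd n. d ^ k)"

definition Eisenstein :: "nat \<Rightarrow> Q2 fps" where
  "Eisenstein k = Abs_fps (\<lambda>n. if n = 0 then 1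
     else - of_rat (2 * of_nat k / bernoulli k) * of_nat (divisor_sigma (k - 1) n))"

definition Delta :: "Q2 fps" where
  "Delta = fps_const (1 / 1728) * (Eisenstein 4 ^ 3 - Eisenstein 6 ^ 2)"

definition lambda :: "Q2 fps" where
  "lambda = fps_compose Delta (fps_X ^ 2) / Delta"

text \<open>Convergence for the sup-norm of coefficients.\<close>

definition qlim :: "(nat \<Rightarrow> Q2 fps) \<Rightarrow> Q2 fps \<Rightarrow> bool" where
  "qlim g f \<longleftrightarrow> uniform_limit UNIV (\<lambda>k. fps_nth (g k)) (fps_nth f) sequentially"

definition E4E6_ring :: "Q2 fps set" where
  "E4E6_ring = {\<Sum>i<N. \<Sum>j<N. fps_const (c i j) * Eisenstein 4 ^ i * Eisenstein 6 ^ j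
                 | (c :: nat \<Rightarrow> nat \<Rightarrow> Q2) N. True}"

text \<open>As \<open>\<rat>\<^sub>2\<close> is complete, the completion of \<open>\<rat>\<^sub>2[E\<^sub>4, E\<^sub>6]\<close> inside \<open>\<rat>\<^sub>2[[q]]\<close> is its
  closure under uniform limits of coefficients.\<close>

definition M2 :: "Q2 fps set" where
  "M2 = {f. \<exists>g. range g \<subseteq> E4E6_ring \<and> qlim g f}"

definition M2_dagger :: "Q2 fps set" where
  "M2_dagger = {f. \<exists>a :: nat \<Rightarrow> Q2. (\<lambda>n. qabs (a n) * 2 ^ (6 * n)) \<longlonglongrightarrow> 0 \<and>
                   qlim (\<lambda>N. \<Sum>n<N. fps_const (a n) * lambda ^ n) f}"


section \<open>The Heisenberg vertex operator algebra\<close>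

text \<open>A multiset \<open>I\<close> of positive integers stands for the monomial
  \<open>\<Prod>n\<in>I. h(-n)\<close> applied to the vacuum. Multiplication of finitely supported functions on
  multisets is convolution, so \<open>heis\<close> is the polynomial ring in \<open>h(-1), h(-2), \<dots>\<close>.\<close>

type_synonym heis_vec = "nat multiset \<Rightarrow>\<^sub>0 Q2"

definition monomials :: "nat multiset set" where
  "monomials = {I. 0 \<notin># I}"

definition heis :: "heis_vec set" where
  "heis = {v. Poly_Mapping.keys v \<subseteq> monomials}"

definition heis_scale :: "Q2 \<Rightarrow> heis_vec \<Rightarrow> heis_vec" where
  "heis_scale c v = Poly_Mapping.single {#} c * v"

definition heis_deriv :: "nat \<Rightarrow> heis_vec \<Rightarrow> heis_vec" where
  "heis_deriv n v = (\<Sum>I\<in>Poly_Mapping.keys v.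
     Poly_Mapping.single (I - {#n#}) (of_nat (count I n) * Poly_Mapping.lookup v I))"

definition h_mode :: "int \<Rightarrow> heis_vec \<Rightarrow> heis_vec" where
  "h_mode n v = (if n < 0 then Poly_Mapping.single {#nat (- n)#} 1 * v
            else if n = 0 then 0
            else heis_scale (of_int n) (heis_deriv (nat n) v))"

text \<open>A field \<open>A(z) = \<Sum>m. A m z\<^bsup>-m-1\<^esup>\<close> is represented by its modes \<open>A m\<close>.\<close>

type_synonym heis_field = "int \<Rightarrow> heis_vec \<Rightarrow> heis_vec"

text \<open>The divided derivative \<open>(1/j!) \<partial>\<^sup>j h(z)\<close> of \<open>h(z) = \<Sum>n. h(n) z\<^bsup>-n-1\<^esup>\<close>: the coefficient of
  \<open>z\<^bsup>-m-1\<^esup>\<close> comes from \<open>n = m - j\<close> and carries the factor \<open>-n-1 choose j\<close>.\<close>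

definition h_deriv_field :: "nat \<Rightarrow> heis_field" where
  "h_deriv_field j m v = heis_scale (of_int (int j - m - 1) gchoose j) (h_mode (m - int j) v)"

text \<open>The normally ordered product \<open>:A(z)B(z): = A(z)\<^sub>+ B(z) + B(z) A(z)\<^sub>-\<close>, where
  \<open>A(z)\<^sub>+\<close> collects the modes \<open>A m\<close> with \<open>m < 0\<close> and \<open>A(z)\<^sub>-\<close> those with \<open>m \<ge> 0\<close>.
  For the fields below, only finitely many summands are nonzero on a given vector.\<close>

definition normal_ordered :: "heis_field \<Rightarrow> heis_field \<Rightarrow> heis_field" where
  "normal_ordered A B m v =
     Sum_any (\<lambda>i. if i < 0 then A i (B (m - i - 1) v) else B (m - i - 1) (A i v))"

definition id_field :: heis_field where
  "id_field m v = (if m = -1 then v else 0)"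

text \<open>\<open>Y(h(-n\<^sub>1)\<cdots>h(-n\<^sub>r)\<one>, z) = :\<partial>\<^bsup>(n\<^sub>1-1)\<^esup>h(z) \<cdots> \<partial>\<^bsup>(n\<^sub>r-1)\<^esup>h(z):\<close>, with divided
  derivatives and right-nested normal ordering. The result does not depend on the order of
  the factors, so the factors are taken in increasing order of the \<open>n\<^sub>i\<close>.\<close>

definition vertex_op_monomial :: "nat multiset \<Rightarrow> heis_field" where
  "vertex_op_monomial I =
     foldr (\<lambda>n. normal_ordered (h_deriv_field (n - 1))) (sorted_list_of_multiset I) id_field"

text \<open>For \<open>v\<close> of weight \<open>w\<close>, the mode of \<open>Y(v, z)\<close> that preserves the grading is the one
  of index \<open>w - 1\<close>.\<close>

definition zero_mode :: "heis_vec \<Rightarrow> heis_vec \<Rightarrow> heis_vec" where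
  "zero_mode v u = (\<Sum>I\<in>Poly_Mapping.keys v.
     heis_scale (Poly_Mapping.lookup v I) (vertex_op_monomial I (int (sum_mset I) - 1) u))"

text \<open>Trace of an operator on \<open>S\<^sub>(\<^sub>n\<^sub>)\<close>, computed in the basis of monomials of weight \<open>n\<close>.\<close>

definition graded_trace :: "nat \<Rightarrow> (heis_vec \<Rightarrow> heis_vec) \<Rightarrow> Q2" where
  "graded_trace n T = (\<Sum>J | J \<in> monomials \<and> sum_mset J = n.
     Poly_Mapping.lookup (T (Poly_Mapping.single J 1)) J)"

text \<open>\<open>q\<^bsup>-1/24\<^esup> \<eta>(q) = \<Prod>n\<ge>1. (1 - q\<^sup>n)\<close>; factors with \<open>k > n\<close> do not affect the coefficient
  of \<open>q\<^sup>n\<close>.\<close>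

definition euler_product :: "Q2 fps" where
  "euler_product = Abs_fps (\<lambda>n. fps_nth (\<Prod>k=1..n. 1 - fps_X ^ k) n)"

definition F_S :: "heis_vec \<Rightarrow> Q2 fps" where
  "F_S v = euler_product * Abs_fps (\<lambda>n. graded_trace n (zero_mode v))"


section \<open>The 2-adic Heisenberg vertex operator algebra and its character map\<close>

definition hlim :: "(nat \<Rightarrow> heis_vec) \<Rightarrow> (nat multiset \<Rightarrow> Q2) \<Rightarrow> bool" where
  "hlim s v \<longleftrightarrow> uniform_limit UNIV (\<lambda>k. Poly_Mapping.lookup (s k)) v sequentially"

text \<open>The completion of \<open>heis\<close> for the sup-norm of the coefficients, realised as its closure
  in the space of all families of coefficients.\<close>

definition S1 :: "(nat multiset \<Rightarrow> Q2) set" where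
  "S1 = {v. \<exists>s. range s \<subseteq> heis \<and> hlim s v}"

text \<open>The extension of \<open>F_S\<close> by continuity.\<close>

definition F_S_hat :: "(nat multiset \<Rightarrow> Q2) \<Rightarrow> Q2 fps" where
  "F_S_hat v = (THE f. \<forall>s. range s \<subseteq> heis \<longrightarrow> hlim s v \<longrightarrow> qlim (\<lambda>k. F_S (s k)) f)"

end

theory Submission
  imports Defs
begin

text \<open>
  The trace of a normally ordered product of modes over the Fock space obeys Wick's theorem, so
  \<open>F_S\<close> is a Gaussian functional on the polynomial ring \<open>S\<close>: it is
      determined by the covariances of
  \<open>h(-m)\<close> and \<open>h(-n)\<close>, which are divisor sums. If \<open>u\<close> and
      \<open>v\<close> are the linear states whose
  mode coefficients are \<open>k\<close> and \<open>k\<^sup>2\<close>, then \<open>u\<close> and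
      \<open>v\<close> are orthogonal and
  \<open>F_S (u\<^sup>2\<^sup>a v\<^sup>2\<^sup>b)
      = (2a-1)!! (2b-1)!! p\<^sup>a r\<^sup>b\<close> with \<open>E\<^sub>4
          = 1 - 120 p\<close> and \<open>E\<^sub>6 = 1 - 252 r\<close>. The
  double factorials are odd, that is, 2-adic units. Hence every limit of elements of
  \<open>\<int>\<^sub>2[p, r]\<close> whose successive differences lie in \<open>2\<^sup>k
      \<int>\<^sub>2[p, r]\<close> is a character.

  Now \<open>1728 = 64 \<cdot> 27\<close>, so \<open>y = 64 \<Delta> / E\<^sub>4\<^sup>3
      = (1 - E\<^sub>6\<^sup>2 / E\<^sub>4\<^sup>3) / 27\<close> is such a limit, and so is
  \<open>x = 64 \<lambda>\<close>, the fixed point of the contraction \<open>x = y (1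
      + 4 x)\<^sup>3\<close>. The theorem follows by summing
  \<open>\<Sum> (a\<^sub>n / 64\<^sup>n) x\<^sup>n\<close>. The fixed point equation is the relation
      between \<open>j\<close> and the Hauptmodul of
  level 2. It is deduced from \<open>5 A\<^sup>2 = E\<^sub>4(q) + 4 E\<^sub>4(q\<^sup>2)\<close>,
      where \<open>A = 2 E\<^sub>2(q\<^sup>2) - E\<^sub>2(q)\<close>, and two
  analogous identities in weight 6. They come from Liouville's identity for
  \<open>\<Sum> F(a - b) - F(a + b)\<close> over \<open>a x + b y
      = n\<close>, applied to \<open>F(a) = (\<plusminus>1)\<^sup>a a\<^sup>2\<close> and
  \<open>F(a) = (\<plusminus>1)\<^sup>a a\<^sup>4\<close>.
\<close>

section \<open>Modes on the Heisenberg vertex operator algebra\<close>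

text \<open>The obstacle is to keep preimages bounded: \<open>F_S\<close> does not increase norms,
  but a small series is not known to have a small preimage. Hence everything is computed inside the
  integral polynomials in p and r, where Wick's formula supplies preimages of norm at most 1. Two
  even numbers make this ring large enough. In E_4 = 1 - 120 p the number 120 is even, so 1 / E_4 is
  a 2-adically convergent geometric series; in y (1 + 4 x)^3 the factor 4 makes the cube contract.
  The fixed point equation has a short origin. Put Q = E_4 and D = 4 A^2 - Q. The factorizations of
  Delta(q) and Delta(q^2) in terms of A and Q give x = (Q - A^2) / D, hence (1 + 4 x) D = 3 Q, while
  27 y Q^3 = (Q - A^2) D^2. Eliminating D yields the equation. All modular relations are obtained as
  identities of formal power series in q from finite sums over divisors, without dimensions of
  spaces of modular forms.\<close>

abbreviation coeff_at :: "heis_vec \<Rightarrow> nat multiset \<Rightarrow> Q2"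
    where "coeff_at \<equiv> Poly_Mapping.lookup"

lemma heis_expand: "v = (\<Sum>I\<in>Poly_Mapping.keys v. Poly_Mapping.single I (coeff_at v I))"
    for v :: heis_vec
  by (rule poly_mapping_eqI)
    (simp add: lookup_sum lookup_single when_def if_distrib sum.delta' in_keys_iff cong: if_cong)

lemma lookup_single_mult:
  "coeff_at (Poly_Mapping.single K c * v) J = (if K \<subseteq># J then c * coeff_at v (J - K) else 0)"
proof -
  have "Poly_Mapping.single K c * v
      = (\<Sum>I\<in>Poly_Mapping.keys v. Poly_Mapping.single (K + I) (c * coeff_at v I))"
    by (subst (1) heis_expand[of v]) (simp add: sum_distrib_left mult_single)
  then have "coeff_at (Poly_Mapping.single K c * v) J
      = (\<Sum>I\<in>Poly_Mapping.keys v. if K + I = J then c * coeff_at v I else 0)"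
    by (simp add: lookup_sum lookup_single when_def)
  also have "\<dots> = (\<Sum>I\<in>Poly_Mapping.keys v. if I
      = J - K then (if K \<subseteq># J then c * coeff_at v I else 0) else 0)"
    by (rule sum.cong) (auto simp: subset_mset.add_diff_inverse dest: subset_mset.diff_add)
  also have "\<dots> = (if K \<subseteq># J then c * coeff_at v (J - K) else 0)"
    by (simp add: in_keys_iff)
  finally show ?thesis .
qed

lemma lookup_heis_scale [simp]: "coeff_at (heis_scale c v) J = c * coeff_at v J"
  by (simp add: heis_scale_def lookup_single_mult)

lemma lookup_heis_deriv: "coeff_at (heis_deriv n v) J
    = of_nat (Suc (count J n)) * coeff_at v (add_mset n J)"
proof -
  have "coeff_at (heis_deriv n v) J
      = (\<Sum>I\<in>Poly_Mapping.keys v. if I - {#n#}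
          = J then of_nat (count I n) * coeff_at v I else 0)"
    by (simp add: heis_deriv_def lookup_sum lookup_single when_def)
  also have "\<dots> = (\<Sum>I\<in>Poly_Mapping.keys v. if I
      = add_mset n J then of_nat (count I n) * coeff_at v I else 0)"
  proof (rule sum.cong[OF refl])
    fix I
    show "(if I - {#n#} = J then of_nat (count I n) * coeff_at v I else 0)
        = (if I = add_mset n J then of_nat (count I n) * coeff_at v I else 0)"
      by (cases "n \<in># I") (auto simp: not_in_iff dest!: multi_member_split)
  qed
  also have "\<dots> = of_nat (Suc (count J n)) * coeff_at v (add_mset n J)"
    by (simp add: in_keys_iff)
  finally show ?thesis .
qed

lemma lookup_h_mode_neg:
  assumes "k > 0"
  shows "coeff_at (h_mode (- int k) v) J = (if k \<in># J then coeff_at v (J - {#k#}) else 0)"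
  using assms by (simp add: h_mode_def lookup_single_mult)

lemma lookup_h_mode_pos:
  assumes "k > 0"
  shows "coeff_at (h_mode (int k) v) J = of_nat (k * Suc (count J k)) * coeff_at v (add_mset k J)"
  using assms by (simp add: h_mode_def lookup_heis_deriv algebra_simps)

lemma h_mode_0 [simp]: "h_mode 0 v = 0"
  by (simp add: h_mode_def)

lemma int_nonzero_cases:
  fixes i :: int assumes "i \<noteq> 0"
  obtains k where "k > 0" "i = int k" | k where "k > 0" "i = - int k"
proof (cases i rule: int_cases3)
  case (pos n) then show ?thesis using that(1)[of n] by auto
next
  case (neg n) then show ?thesis using that(2)[of n] by auto
qed (use assms in auto)

definition heis_linear :: "(heis_vec \<Rightarrow> heis_vec) \<Rightarrow> bool" where
  "heis_linear T \<longleftrightarrow> (\<forall>v w. T (v + w) = T v + T w)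
      \<and> (\<forall>c v. T (heis_scale c v) = heis_scale c (T v))"

lemma heis_linear_add: "heis_linear T \<Longrightarrow> T (v + w) = T v + T w"
  and heis_linear_scale: "heis_linear T \<Longrightarrow> T (heis_scale c v) = heis_scale c (T v)"
  by (simp_all add: heis_linear_def)

lemma heis_scale_0 [simp]: "heis_scale 0 v = 0" "heis_scale c 0 = 0"
  by (simp_all add: heis_scale_def)

lemma heis_scale_scale [simp]: "heis_scale c (heis_scale d v) = heis_scale (c * d) v"
  by (rule poly_mapping_eqI) simp

lemma heis_linear_0: "heis_linear T \<Longrightarrow> T 0 = 0"
  using heis_linear_scale[of T 0 0] by simp

lemma heis_linear_sum: "heis_linear T \<Longrightarrow> T (sum f A) = (\<Sum>x\<in>A. T (f x))"
  by (induction A rule: infinite_finite_induct) (auto simp: heis_linear_0 heis_linear_add)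

lemma heis_linear_diff: "heis_linear T \<Longrightarrow> T (v - w) = T v - T w"
  by (metis heis_linear_add add_diff_cancel_right' diff_add_cancel)

lemma heis_linear_h_mode [simp]: "heis_linear (h_mode k)"
proof (cases "k = 0")
  case False
  then show ?thesis
    by (cases rule: int_nonzero_cases; unfold heis_linear_def; intro conjI allI poly_mapping_eqI)
      (simp_all add: lookup_h_mode_neg lookup_h_mode_pos lookup_add algebra_simps)
qed (simp add: heis_linear_def)

lemma heis_linear_heis_scale [simp]: "heis_linear (heis_scale c)"
  by (auto simp: heis_linear_def intro!: poly_mapping_eqI simp: lookup_add algebra_simps)

lemma heis_scale_add: "heis_scale c (v + w) = heis_scale c v + heis_scale c w"
  by (rule heis_linear_add) simp

lemma heis_scale_sum: "heis_scale c (sum f A) = (\<Sum>x\<in>A. heis_scale c (f x))"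
  by (rule heis_linear_sum) simp

text \<open>The Heisenberg relation, checked on coefficients: for opposite indices the central term
  is the difference between the multiplicities \<open>Suc (count J k)\<close> and
  \<open>count J k\<close> produced by the two orders.\<close>

lemma h_mode_commute:
  "h_mode i (h_mode j v) = h_mode j (h_mode i v) + (if i + j = 0 then heis_scale (of_int i) v else 0)"
proof (cases "i = 0 \<or> j = 0")
  case True
  then show ?thesis using heis_linear_0[OF heis_linear_h_mode] by auto
next
  case False
  then have "i \<noteq> 0" "j \<noteq> 0" by auto
  from this(1) show ?thesis
  proof (cases rule: int_nonzero_cases)
    case i: (1 a)
    from \<open>j \<noteq> 0\<close> show ?thesis
    proof (cases rule: int_nonzero_cases)
      case j: (1 b)
      then show ?thesis using i
        by (intro poly_mapping_eqI) (auto simp: lookup_h_mode_pos add_mset_commute)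
    next
      case j: (2 b)
      show ?thesis
      proof (cases "a = b")
        case True
        then show ?thesis using i j
          by (intro poly_mapping_eqI)
            (auto simp: lookup_h_mode_pos lookup_h_mode_neg lookup_add algebra_simps not_in_iff
              dest!: multi_member_split)
      next
        case False
        then show ?thesis using i j
          by (intro poly_mapping_eqI)
            (auto simp: lookup_h_mode_pos lookup_h_mode_neg lookup_add
              dest!: multi_member_split)
      qed
    qed
  next
    case i: (2 a)
    from \<open>j \<noteq> 0\<close> show ?thesis
    proof (cases rule: int_nonzero_cases)
      case j: (1 b)
      show ?thesis
      proof (cases "a = b")
        case True
        then show ?thesis using i j
          by (intro poly_mapping_eqI)
            (auto simp: lookup_h_mode_pos lookup_h_mode_neg lookup_add algebra_simps not_in_iff
              dest!: multi_member_split)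
      next
        case False
        then show ?thesis using i j
          by (intro poly_mapping_eqI)
            (auto simp: lookup_h_mode_pos lookup_h_mode_neg lookup_add
              dest!: multi_member_split)
      qed
    next
      case j: (2 b)
      have "b = a" if "b \<in># {#a#}" using that by auto
      then show ?thesis using i j
        by (intro poly_mapping_eqI)
          (auto simp: lookup_h_mode_neg diff_right_commute in_diff_count dest!: multi_member_split)
    qed
  qed
qed

text \<open>The bound is an integer because lowering the weight below 0 is how vanishing, and thus
  finiteness of the mode sums, is detected.\<close>

definition weight_le :: "int \<Rightarrow> heis_vec \<Rightarrow> bool" where
  "weight_le w v \<longleftrightarrow> (\<forall>I. coeff_at v I \<noteq> 0 \<longrightarrow> int
      (sum_mset I) \<le> w)"

lemma weight_le_neg: "weight_le w v \<Longrightarrow> w < 0 \<Longrightarrow> v = 0"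
  unfolding weight_le_def by (rule poly_mapping_eqI) fastforce

lemma weight_le_mono: "weight_le w v \<Longrightarrow> w \<le> w' \<Longrightarrow> weight_le w' v"
  unfolding weight_le_def by fastforce

lemma weight_le_0 [simp]: "weight_le w 0"
  by (simp add: weight_le_def)

lemma weight_le_add: "weight_le w u \<Longrightarrow> weight_le w v \<Longrightarrow> weight_le w (u
    + v)"
  unfolding weight_le_def lookup_add by (metis add.right_neutral add.left_neutral)

lemma weight_le_scale: "weight_le w v \<Longrightarrow> weight_le w (heis_scale c v)"
  by (simp add: weight_le_def)

lemma weight_le_sum: "(\<And>x. x \<in> A \<Longrightarrow> weight_le w (f x))
    \<Longrightarrow> weight_le w (sum f A)"
  by (induction A rule: infinite_finite_induct) (auto simp: weight_le_add)

lemma weight_le_h_mode: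
  assumes "weight_le w v" shows "weight_le (w - k) (h_mode k v)"
proof (cases "k = 0")
  case False
  then show ?thesis
  proof (cases rule: int_nonzero_cases)
    case (1 n)
    then show ?thesis using assms unfolding weight_le_def
      by (fastforce simp: lookup_h_mode_pos)
  next
    case (2 n)
    have "int (sum_mset I) \<le> w + int n" if "n \<in># I" "coeff_at v (I - {#n#}) \<noteq> 0" for I
      using that assms unfolding weight_le_def by (fastforce dest!: multi_member_split)
    then show ?thesis using 2 unfolding weight_le_def
      by (auto simp: lookup_h_mode_neg split: if_splits)
  qed
qed simp

lemma weight_le_exists: "\<exists>w\<ge>0. weight_le w v"
proof -
  have "weight_le (\<Sum>I\<in>Poly_Mapping.keys v. int (sum_mset I)) v"
    unfolding weight_le_def
  proof (intro allI impI)
    fix I assume "coeff_at v I \<noteq> 0"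
    then show "int (sum_mset I) \<le> (\<Sum>I\<in>Poly_Mapping.keys v. int (sum_mset I))"
      by (intro member_le_sum) (auto simp: in_keys_iff simp del: of_nat_sum_mset)
  qed
  moreover have "(\<Sum>I\<in>Poly_Mapping.keys v. int (sum_mset I)) \<ge> 0"
    by (rule sum_nonneg) (rule of_nat_0_le_iff)
  ultimately show ?thesis by blast
qed

text \<open>\<open>wick_op [c\<^sub>1, \<dots>, c\<^sub>r] s\<close> stands
    for the sum of \<open>c\<^sub>1(k\<^sub>1) \<cdots> c\<^sub>r(k\<^sub>r) :h(k\<^sub>1) \<cdots>
        h(k\<^sub>r):\<close> over all
  \<open>k\<^sub>1 + \<cdots> + k\<^sub>r
      = s\<close>. On a given vector only finitely many summands are nonzero, because
  \<open>h(k)\<close> lowers the weight by \<open>k\<close>.\<close>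

fun wick_op :: "(int \<Rightarrow> Q2) list \<Rightarrow> int \<Rightarrow> heis_vec \<Rightarrow>
    heis_vec" where
  "wick_op [] s v = (if s = 0 then v else 0)"
| "wick_op (c # cs) s v = Sum_any (\<lambda>i. heis_scale (c i)
     (if i < 0 then h_mode i (wick_op cs (s - i) v) else wick_op cs (s - i) (h_mode i v)))"

text \<open>The three claims need one induction: linearity and the weight bound for a longer list
  are read off from the finite form of the sum, and that form relies on the weight bound for the
  shorter list. The range \<open>L\<close> is free, so that several vectors can share one
  range.\<close>

lemma wick_op_props:
  "heis_linear (wick_op cs s)
      \<and> (\<forall>w v. weight_le w v \<longrightarrow> weight_le (w - s) (wick_op cs s v))
   \<and> (\<forall>c cs' w v L. cs = c # cs' \<longrightarrow> weight_le w v \<longrightarrow> w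
       \<le> L \<longrightarrow> w - s \<le> L \<longrightarrow>
        wick_op cs s v = (\<Sum>i=-L..L. heis_scale (c i)
          (if i < 0 then h_mode i (wick_op cs' (s - i) v) else wick_op cs' (s - i) (h_mode i v))))"
proof (induction cs arbitrary: s)
  case Nil
  then show ?case by (auto simp: heis_linear_def)
next
  case (Cons c cs)
  have lin: "heis_linear (wick_op cs s)" for s using Cons by blast
  have weight_le: "weight_le (w - s) (wick_op cs s v)" if "weight_le w v" for w s v using Cons that
      by blast
  define X where "X = (\<lambda>s v i. heis_scale (c i)
     (if i < 0 then h_mode i (wick_op cs (s - i) v) else wick_op cs (s - i) (h_mode i v)))"
  have eq: "wick_op (c # cs) s v = Sum_any (X s v)" for s v
    by (simp add: X_def)
  have fin: "Sum_any (X s v) = (\<Sum>i=-L..L. X s v i)" if "weight_le w v" "w \<le> L" "w - s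
      \<le> L" for w v L s
  proof (rule Sum_any.expand_superset)
    \<comment> \<open>A large positive mode annihilates \<open>v\<close>; for a very negative one
      the remaining factors would have to lower the weight below 0. Since \<open>L\<close> may be
      negative, each case allows both signs of \<open>i\<close>.\<close>
    show "{a. X s v a \<noteq> 0} \<subseteq> {- L..L}"
    proof
      fix i assume i: "i \<in> {a. X s v a \<noteq> 0}"
      show "i \<in> {- L..L}"
      proof (rule ccontr)
        assume "i \<notin> {-L..L}"
        then consider "i > L" | "i < -L" by fastforce
        then have "X s v i = 0"
        proof cases
          case 1
          then have "h_mode i v = 0"
            using weight_le_neg[OF weight_le_h_mode[OF that(1), of i]] that by simp
          then show ?thesis
            using 1 weight_le_neg[OF weight_le[OF that(1), of "s - i"]] that heis_linear_0[OF lin]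
                heis_linear_0[OF heis_linear_h_mode]
            by (simp add: X_def)
        next
          case 2
          then have "wick_op cs (s - i) v = 0"
            using weight_le_neg[OF weight_le[OF that(1), of "s - i"]] that by simp
          moreover have "h_mode i v = 0" if "i \<ge> 0"
            using weight_le_neg[OF weight_le_h_mode[OF \<open>weight_le w v\<close>, of i]] \<open>w
                \<le> L\<close> 2 that by simp
          ultimately show ?thesis
            using heis_linear_0[OF heis_linear_h_mode] heis_linear_0[OF lin] by (simp add: X_def)
        qed
        then show False using i by simp
      qed
    qed
  qed simp
  have Xadd: "X s (v + w) i = X s v i + X s w i" for s v w i
    by (simp add: X_def heis_linear_add[OF lin] heis_linear_add[OF heis_linear_h_mode] heis_scale_add)
  have Xscale: "X s (heis_scale d v) i = heis_scale d (X s v i)" for s d v i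
    by (simp add: X_def heis_linear_scale[OF lin] heis_linear_scale[OF heis_linear_h_mode] mult.commute)
  have "heis_linear (wick_op (c # cs) s)"
    unfolding heis_linear_def
  proof (intro conjI allI)
    fix v w :: heis_vec
    obtain a b where ab: "weight_le a v" "weight_le b w" using weight_le_exists by metis
    define L where "L = \<bar>a\<bar> + \<bar>b\<bar> + \<bar>s\<bar>"
    have m: "weight_le (max a b) v" "weight_le (max a b) w" "max a b \<le> L" "max a b - s \<le> L"
      using ab by (auto simp: L_def intro: weight_le_mono)
    show "wick_op (c # cs) s (v + w) = wick_op (c # cs) s v + wick_op (c # cs) s w"
      unfolding eq fin[OF m(1) m(3,4)] fin[OF m(2) m(3,4)] fin[OF weight_le_add[OF m(1,2)] m(3,4)]
      by (simp add: Xadd sum.distrib)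
  next
    fix d v
    obtain a where a: "weight_le a v" using weight_le_exists by metis
    define L where "L = \<bar>a\<bar> + \<bar>s\<bar>"
    have m: "weight_le a v" "a \<le> L" "a - s \<le> L" using a by (auto simp: L_def)
    show "wick_op (c # cs) s (heis_scale d v) = heis_scale d (wick_op (c # cs) s v)"
      unfolding eq fin[OF m] fin[OF weight_le_scale[OF m(1)] m(2,3)]
      by (simp add: Xscale heis_scale_sum)
  qed
  moreover have "weight_le (w - s) (wick_op (c # cs) s v)" if "weight_le w v" for w v
  proof -
    have m: "w \<le> \<bar>w\<bar> + \<bar>s\<bar>" "w - s \<le> \<bar>w\<bar> + \<bar>s\<bar>" by auto
    show ?thesis
      unfolding eq fin[OF that m]
    proof (rule weight_le_sum)
      fix i
      show "weight_le (w - s) (X s v i)"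
        using weight_le_h_mode[OF weight_le[OF that, of "s - i"], of i] weight_le[OF
            weight_le_h_mode[OF that, of i], of "s - i"]
        by (auto simp: X_def intro!: weight_le_scale)
    qed
  qed
  ultimately show ?case using fin unfolding eq by (auto simp: X_def)
qed

lemma heis_linear_wick_op [simp]: "heis_linear (wick_op cs s)"
  and wick_op_Cons: "weight_le w v \<Longrightarrow> w \<le> L \<Longrightarrow> w - s
      \<le> L \<Longrightarrow>
        wick_op (c # cs) s v = (\<Sum>i=-L..L. heis_scale (c i)
          (if i < 0 then h_mode i (wick_op cs (s - i) v) else wick_op cs (s - i) (h_mode i v)))"
  using wick_op_props by blast+

declare wick_op.simps(2) [simp del]

definition del_nth :: "nat \<Rightarrow> 'a list \<Rightarrow> 'a list" where
  "del_nth j xs = take j xs @ drop (Suc j) xs"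

lemma del_nth_Cons [simp]: "del_nth 0 (x # xs) = xs" "del_nth (Suc j) (x # xs) = x # del_nth j xs"
  by (simp_all add: del_nth_def)

text \<open>Moving \<open>h_mode k\<close> through the product leaves one central term per factor,
  from the mode \<open>- k\<close> of that factor. Removing this mode changes the total index from
  \<open>s\<close> to \<open>s + k\<close>.\<close>

lemma wick_op_h_mode:
  assumes "k \<noteq> 0"
  shows "wick_op cs s (h_mode k v) = h_mode k (wick_op cs s v)
    - (\<Sum>j<length cs. heis_scale (of_int k * (cs ! j) (- k)) (wick_op (del_nth j cs) (s + k) v))"
proof (induction cs arbitrary: s v)
  case Nil
  then show ?case by (simp add: heis_linear_0[OF heis_linear_h_mode])
next
  case (Cons c cs)
  obtain w where w: "weight_le w v" using weight_le_exists by metis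
  define L where "L = \<bar>w\<bar> + \<bar>s\<bar> + 2 * \<bar>k\<bar>"
  have L: "w \<le> L" "w - s \<le> L" "w - k \<le> L" "w - k - s \<le> L" "w - (s + k)
      \<le> L" "- k \<in> {-L..L}"
    by (auto simp: L_def)
  define X where "X = (\<lambda>cs s v i. heis_scale (c i)
     (if i < 0 then h_mode i (wick_op cs (s - i) v) else wick_op cs (s - i) (h_mode i v)))"
  have e: "wick_op (c # cs) s v = (\<Sum>i=-L..L. X cs s v i)"
    "wick_op (c # cs) s (h_mode k v) = (\<Sum>i=-L..L. X cs s (h_mode k v) i)"
    "\<And>cs. wick_op (c # cs) (s + k) v = (\<Sum>i=-L..L. X cs (s + k) v i)" for cs
    using wick_op_Cons[OF w, of L] wick_op_Cons[OF weight_le_h_mode[OF w, of k], of L] L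
    by (simp_all add: X_def)
  \<comment> \<open>The last term is the contraction with the new factor \<open>c\<close> itself; it
    occurs for the single index \<open>- k\<close>, which lies in the range by the choice of
    \<open>L\<close>.\<close>
  have X: "X cs s (h_mode k v) i = h_mode k (X cs s v i)
      - (\<Sum>j<length cs. heis_scale (of_int k * (cs ! j) (- k)) (X (del_nth j cs) (s + k) v i))
      - (if i = - k then heis_scale (of_int k * c (-k)) (wick_op cs (s + k) v) else 0)" for i
  proof (cases "i < 0")
    case True
    have "h_mode i (wick_op cs (s - i) (h_mode k v)) = h_mode i (h_mode k (wick_op cs (s - i) v))
       - (\<Sum>j<length cs. heis_scale (of_int k * (cs ! j) (- k)) (h_mode i (wick_op (del_nth j
           cs) (s + k - i) v)))"
      by (simp add: Cons heis_linear_diff[OF heis_linear_h_mode] heis_linear_sum[OF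
          heis_linear_h_mode] heis_linear_scale[OF heis_linear_h_mode]
          algebra_simps)
    moreover have "h_mode i (h_mode k (wick_op cs (s - i) v))
        = h_mode k (h_mode i (wick_op cs (s - i) v))
       - (if i = - k then heis_scale (of_int k) (wick_op cs (s + k) v) else 0)"
      by (subst h_mode_commute) (auto intro!: poly_mapping_eqI simp: lookup_minus lookup_add)
    ultimately show ?thesis using True
      by (simp add: X_def heis_linear_diff[OF heis_linear_heis_scale] heis_scale_sum
          heis_linear_scale[OF heis_linear_h_mode] mult_ac)
  next
    case False
    have "wick_op cs (s - i) (h_mode i (h_mode k v)) = wick_op cs (s - i) (h_mode k (h_mode i v))
       - (if i = - k then heis_scale (of_int k) (wick_op cs (s + k) v) else 0)"
      by (subst h_mode_commute, subst heis_linear_add[OF heis_linear_wick_op])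
        (auto intro!: poly_mapping_eqI simp: lookup_minus lookup_add heis_linear_scale[OF
            heis_linear_wick_op]
          heis_linear_0[OF heis_linear_wick_op])
    moreover have "wick_op cs (s - i) (h_mode k (h_mode i v))
        = h_mode k (wick_op cs (s - i) (h_mode i v))
       - (\<Sum>j<length cs. heis_scale (of_int k * (cs ! j) (- k)) (wick_op (del_nth j cs) (s
           + k - i) (h_mode i v)))"
      by (simp add: Cons algebra_simps)
    ultimately show ?thesis using False
      by (simp add: X_def heis_linear_diff[OF heis_linear_heis_scale] heis_scale_sum
          heis_linear_scale[OF heis_linear_h_mode] mult_ac)
  qed
  have "(\<Sum>i=-L..L. \<Sum>j<length cs. heis_scale (of_int k * (cs ! j) (- k)) (X (del_nth j cs)
      (s + k) v i))
      = (\<Sum>j<length cs. heis_scale (of_int k * (cs ! j) (- k)) (wick_op (c # del_nth j cs) (s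
          + k) v))"
    by (subst sum.swap) (simp add: e heis_scale_sum)
  moreover have "(\<Sum>i=-L..L. if i = - k then heis_scale (of_int k * c (-k)) (wick_op cs (s
      + k) v) else 0)
      = heis_scale (of_int k * c (-k)) (wick_op cs (s + k) v)"
    using L by (subst sum.delta) auto
  ultimately show ?case
    unfolding e(2)
    by (simp add: X sum_subtractf sum.lessThan_Suc_shift e(1) heis_linear_sum[OF heis_linear_h_mode]
        del: sum.lessThan_Suc)
qed

text \<open>The coefficient of \<open>h(k)\<close> in the divided derivative \<open>(1/(n-1)!)
    \<partial>\<^sup>n\<^sup>-\<^sup>1 h(z)\<close>. It vanishes for
  \<open>-n < k < 0\<close>, so splitting the modes of that field
      by their index, as \<open>normal_ordered\<close> does,
  is the same as splitting them by the sign of \<open>k\<close>.\<close>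

definition mode_coeff :: "nat \<Rightarrow> int \<Rightarrow> Q2" where
  "mode_coeff n k = of_int (- k - 1) gchoose (n - 1)"

lemma vertex_op_foldr:
  assumes "0 \<notin> set ns"
  shows "foldr (\<lambda>n. normal_ordered (h_deriv_field (n - 1))) ns id_field m v
    = wick_op (map mode_coeff ns) (m + 1 - int (sum_list ns)) v"
  using assms
proof (induction ns arbitrary: m v)
  case Nil
  then show ?case by (auto simp: id_field_def)
next
  case (Cons n ns)
  define j where "j = n - 1"
  have n: "n = Suc j" using Cons.prems by (auto simp: j_def)
  define B where "B = foldr (\<lambda>n. normal_ordered (h_deriv_field (n - 1))) ns id_field"
  have B: "B m v = wick_op (map mode_coeff ns) (m + 1 - int (sum_list ns)) v" for m v
    using Cons by (simp add: B_def)
  have Blin: "heis_linear (B m)" for m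
    using heis_linear_wick_op by (simp add: heis_linear_def B)
  define s where "s = m + 1 - int (sum_list (n # ns))"
  define Y where "Y = (\<lambda>i. if i < 0 then h_deriv_field j i (B (m - i - 1) v)
    else B (m - i - 1) (h_deriv_field j i v))"
  have "foldr (\<lambda>n. normal_ordered (h_deriv_field (n - 1))) (n # ns) id_field m v = Sum_any Y"
    by (simp only: foldr.simps comp_def normal_ordered_def Y_def B_def j_def)
  also have "\<dots> = Sum_any (\<lambda>i. heis_scale (mode_coeff n i)
     (if i < 0 then h_mode i (wick_op (map mode_coeff ns) (s - i) v)
      else wick_op (map mode_coeff ns) (s - i) (h_mode i v)))"
  \<comment> \<open>The mode \<open>i + int j\<close> of the divided derivative contains
    \<open>h_mode i\<close>, so the shift passes from indices of the field to indices of
    \<open>h\<close>.\<close>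
  proof (rule Sum_any.reindex_cong[of "\<lambda>i. i + int j"])
    show "bij (\<lambda>i. i + int j)"
      by (rule o_bij[of "\<lambda>i. i - int j"]) (simp_all add: fun_eq_iff)
    show "Y \<circ> (\<lambda>i. i + int j) = (\<lambda>i. heis_scale (mode_coeff n i)
     (if i < 0 then h_mode i (wick_op (map mode_coeff ns) (s - i) v)
      else wick_op (map mode_coeff ns) (s - i) (h_mode i v)))"
    proof
      fix i
      have hd: "h_deriv_field j (i + int j) v = heis_scale (mode_coeff n i) (h_mode i v)" for v
        by (simp add: h_deriv_field_def mode_coeff_def n)
      have Bi: "B (m - (i + int j) - 1) v = wick_op (map mode_coeff ns) (s - i) v" for v
        unfolding B by (rule arg_cong[of _ _ "\<lambda>t. wick_op _ t v"]) (simp add: s_def n)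
      consider "i \<ge> 0" | "i + int j < 0" | "i < 0" "i + int j \<ge> 0" by linarith
      then show "(Y \<circ> (\<lambda>i. i + int j)) i = heis_scale (mode_coeff n i)
     (if i < 0 then h_mode i (wick_op (map mode_coeff ns) (s - i) v)
      else wick_op (map mode_coeff ns) (s - i) (h_mode i v))"
      proof cases
        case 1
        then show ?thesis by (simp add: Y_def hd Bi heis_linear_scale)
      next
        case 2
        then show ?thesis by (simp add: Y_def hd Bi)
      next
        case 3
        define t where "t = nat (- i - 1)"
        have t: "- i - 1 = int t" "t < j" using 3 by (auto simp: t_def)
        have "mode_coeff n i = of_int (int t) gchoose j"
          unfolding mode_coeff_def t(1) by (simp add: n)
        then have "mode_coeff n i = 0"
          using t by (simp flip: binomial_gbinomial)
        then show ?thesis using 3 by (simp add: Y_def hd Bi heis_linear_0)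
      qed
    qed
  qed
  also have "\<dots> = wick_op (map mode_coeff (n # ns)) s v"
    by (simp add: wick_op.simps)
  finally show ?case by (simp add: s_def)
qed

text \<open>At the zero mode the weight shift cancels, so only products whose mode indices add up to
  0 remain.\<close>

lemma vertex_op_monomial_eq:
  assumes "I \<in> monomials"
  shows "vertex_op_monomial I (int (sum_mset I) - 1) v
    = wick_op (map mode_coeff (sorted_list_of_multiset I)) 0 v"
proof -
  have "0 \<notin> set (sorted_list_of_multiset I)" using assms by (simp add: monomials_def)
  moreover have "sum_list (sorted_list_of_multiset I) = sum_mset I"
    by (metis mset_sorted_list_of_multiset sum_mset_sum_list)
  ultimately show ?thesis
    by (simp add: vertex_op_monomial_def vertex_op_foldr del: of_nat_sum_mset One_nat_def)
qed

section \<open>Wick's theorem for graded traces\<close>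

abbreviation weight_basis :: "nat \<Rightarrow> nat multiset set" where
  "weight_basis n \<equiv> {J. J \<in> monomials \<and> sum_mset J = n}"

lemma size_le_sum_mset:
  assumes "0 \<notin># J" shows "size J \<le> sum_mset (J :: nat multiset)"
  using assms
proof (induction J)
  case (add y J)
  then have "y \<ge> 1" by (cases y) auto
  then show ?case using add by auto
qed simp

lemma finite_weight_basis [simp]: "finite (weight_basis n)"
proof (rule finite_subset)
  show "weight_basis n \<subseteq> mset ` {xs. set xs \<subseteq> {..n} \<and> length xs \<le> n}"
  proof
    fix J assume J: "J \<in> weight_basis n"
    obtain xs where xs: "J = mset xs" by (metis ex_mset)
    have "x \<le> n" if "x \<in># J" for x using that J by (auto dest!: multi_member_split)
    then have "set xs \<subseteq> {..n}" using xs by auto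
    moreover have "length xs \<le> n"
      using J size_le_sum_mset[of J] by (auto simp: monomials_def xs)
    ultimately show "J \<in> mset ` {xs. set xs \<subseteq> {..n} \<and> length xs
        \<le> n}" using xs by blast
  qed
qed (simp add: finite_lists_length_le)

lemma bij_betw_add_mset:
  assumes "k > 0" "k \<le> n"
  shows "bij_betw (add_mset k) (weight_basis (n - k)) {J \<in> weight_basis n. k \<in># J}"
proof (rule bij_betwI[of _ _ _ "\<lambda>J. J - {#k#}"])
  show "add_mset k \<in> weight_basis (n - k) \<rightarrow> {J \<in> weight_basis n. k \<in># J}"
    using assms by (auto simp: monomials_def)
  show "(\<lambda>J. J - {#k#}) \<in> {J \<in> weight_basis n. k \<in># J} \<rightarrow>
      weight_basis (n - k)"
    using assms by (auto simp: monomials_def dest!: multi_member_split)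
qed auto

text \<open>Both cyclicity statements below move a trace from weight \<open>n\<close> to weight
  \<open>n - k\<close> by removing one part \<open>k\<close>; this is the reindexing they
  share.\<close>

lemma sum_weight_basis_shift:
  assumes "k > 0" and f: "\<And>J. k \<notin># J \<Longrightarrow> f J = 0"
  shows "(\<Sum>J\<in>weight_basis n. f J) = (if k
      \<le> n then \<Sum>L\<in>weight_basis (n - k). f (add_mset k L) else 0)"
proof -
  have "(\<Sum>J\<in>weight_basis n. f J) = (\<Sum>J\<in>{J \<in> weight_basis n. k \<in># J}. f J)"
    by (rule sum.mono_neutral_right) (use f in auto)
  also have "\<dots> = (if k \<le> n then \<Sum>L\<in>weight_basis (n - k). f (add_mset k L) else 0)"
  proof (cases "k \<le> n")
    case True
    then show ?thesis
      using sum.reindex_bij_betw[OF bij_betw_add_mset[OF assms(1) True], of f] by simp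
  next
    case False
    then have "{J \<in> weight_basis n. k \<in># J} = {}" by (auto dest!: multi_member_split)
    then have "(\<Sum>J\<in>{J \<in> weight_basis n. k \<in># J}. f J) = 0" by (simp only: sum.empty)
    then show ?thesis using False by simp
  qed
  finally show ?thesis .
qed

lemma h_mode_neg_single:
  "k > 0 \<Longrightarrow> h_mode (- int k) (Poly_Mapping.single J 1)
      = Poly_Mapping.single (add_mset k J) 1"
  by (simp add: h_mode_def mult_single)

lemma h_mode_pos_single:
  "k > 0 \<Longrightarrow> h_mode (int k) (Poly_Mapping.single J 1)
    = heis_scale (of_nat (k * count J k)) (Poly_Mapping.single (J - {#k#}) 1)"
  by (cases "k \<in># J")
   (auto intro!: poly_mapping_eqI simp: lookup_h_mode_pos lookup_single when_def not_in_iff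
      algebra_simps dest!: multi_member_split)

definition trace_series :: "(heis_vec \<Rightarrow> heis_vec) \<Rightarrow> Q2 fps" where
  "trace_series T = Abs_fps (\<lambda>n. graded_trace n T)"

lemma trace_series_add: "trace_series (\<lambda>v. T v + U v) = trace_series T + trace_series U"
  by (rule fps_ext) (simp add: trace_series_def graded_trace_def lookup_add sum.distrib)

lemma trace_series_scale: "trace_series (\<lambda>v. heis_scale c (T v)) = fps_const c * trace_series T"
  by (rule fps_ext) (simp add: trace_series_def graded_trace_def sum_distrib_left)

lemma trace_series_diff: "trace_series (\<lambda>v. T v - U v) = trace_series T - trace_series U"
  by (rule fps_ext) (simp add: trace_series_def graded_trace_def lookup_minus sum_subtractf)

lemma trace_series_sum: "trace_series (\<lambda>v. \<Sum>j\<in>A. T j v)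
    = (\<Sum>j\<in>A. trace_series (T j))"
  by (rule fps_ext)
    (simp add: trace_series_def graded_trace_def lookup_sum fps_sum_nth sum.swap[of _ A])

text \<open>This is tr(AB) = tr(BA) in a graded setting: A changes the weight by \<open>k\<close>,
  so the two traces live in weights differing by \<open>k\<close>, whence the power of q.\<close>

lemma trace_creation_cyclic:
  assumes "k > 0"
  shows "trace_series (\<lambda>v. h_mode (- int k) (T v))
      = fps_X ^ k * trace_series (\<lambda>v. T (h_mode (- int k) v))"
proof (rule fps_ext)
  fix n
  show "fps_nth (trace_series (\<lambda>v. h_mode (- int k) (T v))) n
    = fps_nth (fps_X ^ k * trace_series (\<lambda>v. T (h_mode (- int k) v))) n"
    using assms sum_weight_basis_shift[OF assms,
        of "\<lambda>J. coeff_at (h_mode (- int k) (T (Poly_Mapping.single J 1))) J" n]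
    by (simp add: trace_series_def graded_trace_def fps_X_power_mult_nth lookup_h_mode_neg
        h_mode_neg_single)
qed

lemma trace_annihilation_cyclic:
  assumes "k > 0" "heis_linear T"
  shows "trace_series (\<lambda>v. T (h_mode (int k) v))
      = fps_X ^ k * trace_series (\<lambda>v. h_mode (int k) (T v))"
proof (rule fps_ext)
  fix n
  show "fps_nth (trace_series (\<lambda>v. T (h_mode (int k) v))) n
    = fps_nth (fps_X ^ k * trace_series (\<lambda>v. h_mode (int k) (T v))) n"
    using assms sum_weight_basis_shift[OF assms(1),
        of "\<lambda>J. of_nat k * of_nat (count J k) * coeff_at (T (Poly_Mapping.single (J - {#k#})
            1)) J" n]
    by (simp add: trace_series_def graded_trace_def fps_X_power_mult_nth lookup_h_mode_pos
        h_mode_pos_single heis_linear_scale[OF assms(2)] not_in_iff algebra_simps)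
qed

text \<open>For positive \<open>k\<close> this is the expansion of q^k / (1 - q^k).\<close>

definition dvd_series :: "nat \<Rightarrow> Q2 fps" where
  "dvd_series k = Abs_fps (\<lambda>N. if N > 0 \<and> k dvd N then 1 else 0)"

lemma dvd_series_solve:
  assumes "k > 0" "f = fps_X ^ k * (f + g)"
  shows "f = dvd_series k * g"
proof -
  have t: "(1 - fps_X ^ k) * dvd_series k = fps_X ^ k"
  proof (rule fps_ext)
    fix n
    have "k dvd n \<longleftrightarrow> k dvd (n - k)" if "k \<le> n" using that
        by (simp add: dvd_minus_self)
    moreover have "\<not> k dvd n" if "0 < n" "n < k" using that by (simp add: nat_dvd_not_less)
    ultimately show "fps_nth ((1 - fps_X ^ k) * dvd_series k) n = fps_nth (fps_X ^ k) n"
      using assms(1) by (auto simp: left_diff_distrib fps_X_power_mult_nth dvd_series_def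
          fps_X_power_nth)
  qed
  have "fps_nth (1 - fps_X ^ k :: Q2 fps) 0 = 1" using assms(1) by simp
  then have nz: "1 - fps_X ^ k \<noteq> (0 :: Q2 fps)" by (metis fps_zero_nth zero_neq_one)
  have "(1 - fps_X ^ k) * f = fps_X ^ k * g"
    using assms(2) by (simp add: algebra_simps)
  also have "\<dots> = (1 - fps_X ^ k) * (dvd_series k * g)"
    by (simp add: t flip: mult.assoc)
  finally show ?thesis using nz by simp
qed

text \<open>Moving \<open>h(-k)\<close> around the trace of \<open>X q\<^sup>L\<close> gives
    \<open>tr (h(-k) X) = q\<^sup>k tr (X h(-k))\<close>; since the
  commutator \<open>[X, h(-k)]\<close> has one factor less, the trace is computed recursively with the
  factor \<open>q\<^sup>k / (1 - q\<^sup>k)\<close>.\<close>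

lemma trace_creation:
  assumes "k > 0"
  shows "trace_series (\<lambda>v. h_mode (- int k) (wick_op cs (int k) v))
    = dvd_series k * (\<Sum>j<length cs. fps_const (of_nat k * (cs ! j) (int k)) * trace_series
        (wick_op (del_nth j cs) 0))"
proof (rule dvd_series_solve[OF assms])
  show "trace_series (\<lambda>v. h_mode (- int k) (wick_op cs (int k) v))
    = fps_X ^ k * (trace_series (\<lambda>v. h_mode (- int k) (wick_op cs (int k) v)) +
       (\<Sum>j<length cs. fps_const (of_nat k * (cs ! j) (int k)) * trace_series (wick_op (del_nth
           j cs) 0)))"
    using wick_op_h_mode[of "- int k" cs "int k"] assms
    by (subst trace_creation_cyclic)
      (simp_all add: trace_series_diff trace_series_sum trace_series_scale sum_negf flip: fps_const_neg)
qed

lemma trace_annihilation: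
  assumes "k > 0"
  shows "trace_series (\<lambda>v. wick_op cs (- int k) (h_mode (int k) v))
    = dvd_series k * (\<Sum>j<length cs. fps_const (of_nat k * (cs ! j) (- int k)) * trace_series
        (wick_op (del_nth j cs) 0))"
proof (rule dvd_series_solve[OF assms])
  have "trace_series (\<lambda>v. h_mode (int k) (wick_op cs (- int k) v)) =
    trace_series (\<lambda>v. wick_op cs (- int k) (h_mode (int k) v)
        + (\<Sum>j<length cs. heis_scale (of_nat k * (cs ! j) (- int k)) (wick_op (del_nth j cs) 0 v)))"
    using wick_op_h_mode[of "int k" cs "- int k"] assms by simp
  then show "trace_series (\<lambda>v. wick_op cs (- int k) (h_mode (int k) v))
    = fps_X ^ k * (trace_series (\<lambda>v. wick_op cs (- int k) (h_mode (int k) v)) +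
       (\<Sum>j<length cs. fps_const (of_nat k * (cs ! j) (- int k)) * trace_series (wick_op
           (del_nth j cs) 0)))"
    using assms
    by (subst trace_annihilation_cyclic)
      (simp_all add: trace_series_add trace_series_sum trace_series_scale)
qed

text \<open>The two-point function, that is the sum over k > 0 of k (c(-k) d(k) + c(k) d(-k)) q^k /
  (1 - q^k), written by coefficients to avoid an infinite sum of series.\<close>

definition covariance :: "(int \<Rightarrow> Q2) \<Rightarrow> (int \<Rightarrow> Q2) \<Rightarrow>
    Q2 fps" where
  "covariance c d = Abs_fps (\<lambda>N. if N = 0 then 0 else
     \<Sum>k | k dvd N. of_nat k * (c (- int k) * d (int k) + c (int k) * d (- int k)))"

lemma covariance_truncated:
  assumes "N \<le> n"
  shows "fps_nth (covariance c d) N = fps_nth (\<Sum>k=1..n. dvd_series k *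
     fps_const (of_nat k * (c (- int k) * d (int k) + c (int k) * d (- int k)))) N"
proof (cases "N = 0")
  case False
  have "{k. k dvd N} \<subseteq> {1..n}"
  proof
    fix k assume "k \<in> {k. k dvd N}"
    then have "k dvd N" by simp
    then have "0 < k" "k \<le> N" using False dvd_pos_nat[of N k] dvd_imp_le[of k N] by auto
    then show "k \<in> {1..n}" using assms by auto
  qed
  then have "(\<Sum>k | k dvd N. of_nat k * (c (- int k) * d (int k) + c (int k) * d (- int k)))
    = (\<Sum>k\<in>{1..n}. if k dvd N then of_nat k * (c (- int k) * d (int k)
        + c (int k) * d (- int k)) else 0)"
    by (intro sum.mono_neutral_cong_left) auto
  also have "\<dots> = fps_nth (\<Sum>k=1..n. dvd_series k *
     fps_const (of_nat k * (c (- int k) * d (int k) + c (int k) * d (- int k)))) N"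
    using False by (subst fps_sum_nth) (auto simp: dvd_series_def intro!: sum.cong)
  finally show ?thesis using False by (simp add: covariance_def)
qed (simp add: covariance_def fps_sum_nth dvd_series_def)

lemma fps_mult_nth_cong:
  "(\<And>i. i \<le> n \<Longrightarrow> fps_nth f i = fps_nth g i)
      \<Longrightarrow> fps_nth (f * h) n = fps_nth (g * h) n"
  by (simp add: fps_mult_nth)

lemma sum_int_symmetric:
  fixes f :: "int \<Rightarrow> 'a :: comm_monoid_add"
  shows "(\<Sum>i=- int n..int n. f i) = f 0 + (\<Sum>k=1..n. f (- int k) + f (int k))"
proof (induction n)
  case (Suc n)
  have "{- int (Suc n)..int (Suc n)} = insert (- int (Suc n)) (insert (int (Suc n)) {- int n..int n})"
    by auto
  then have "(\<Sum>i=- int (Suc n)..int (Suc n). f i)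
      = f (- int (Suc n)) + (f (int (Suc n)) + (\<Sum>i=- int n..int n. f i))"
    by (simp only:) (subst sum.insert; simp)+
  then show ?case by (simp add: Suc ac_simps)
qed simp

text \<open>Wick's theorem in recursive form: the first factor is contracted with each other factor.
  Its negative modes are treated by \<open>trace_creation\<close>, its positive ones by
  \<open>trace_annihilation\<close>, and the mode 0 vanishes.\<close>

lemma trace_series_wick_op:
  "trace_series (wick_op (c # cs) 0)
    = (\<Sum>j<length cs. covariance c (cs ! j) * trace_series (wick_op (del_nth j cs) 0))"
proof (rule fps_ext)
  fix n
  define G where "G = (\<lambda>j. trace_series (wick_op (del_nth j cs) 0))"
  define g where "g = (\<lambda>k (v::heis_vec). heis_scale (c (- int k)) (h_mode (- int k) (wick_op
      cs (int k) v))
       + heis_scale (c (int k)) (wick_op cs (- int k) (h_mode (int k) v)))"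
  have "wick_op (c # cs) 0 (Poly_Mapping.single J 1) = (\<Sum>k=1..n. g k (Poly_Mapping.single J 1))"
    if "sum_mset J = n" for J
  proof -
    \<comment> \<open>On weight \<open>n\<close> only modes between \<open>- n\<close> and
      \<open>n\<close> act, so each coefficient of the trace needs a finite sum whose length depends
      on \<open>n\<close>.\<close>
    have "weight_le (int n) (Poly_Mapping.single J 1)"
      using that by (simp add: weight_le_def lookup_single when_def del: of_nat_sum_mset)
    from wick_op_Cons[OF this, of "int n" 0 c cs]
    show ?thesis by (simp add: sum_int_symmetric g_def heis_linear_0)
  qed
  then have "fps_nth (trace_series (wick_op (c # cs) 0)) n
      = fps_nth (trace_series (\<lambda>v. \<Sum>k=1..n. g k v)) n"
    by (simp add: trace_series_def graded_trace_def)
  also have "trace_series (\<lambda>v. \<Sum>k=1..n. g k v)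
     = (\<Sum>k=1..n. \<Sum>j<length cs. dvd_series k * fps_const (of_nat k *
          (c (- int k) * (cs ! j) (int k) + c (int k) * (cs ! j) (- int k))) * G j)"
    unfolding trace_series_sum
  proof (rule sum.cong[OF refl])
    fix k assume "k \<in> {1..n}"
    then have k: "k > 0" by simp
    have "trace_series (g k) =
        fps_const (c (- int k)) * (dvd_series k * (\<Sum>j<length cs. fps_const (of_nat k * (cs ! j)
            (int k)) * G j))
      + fps_const (c (int k)) * (dvd_series k * (\<Sum>j<length cs. fps_const (of_nat k * (cs ! j)
          (- int k)) * G j))"
      unfolding g_def trace_series_add trace_series_scale trace_creation[OF k] trace_annihilation[OF
          k] G_def ..
    also have "\<dots> = (\<Sum>j<length cs. dvd_series k * fps_const (of_nat k *
          (c (- int k) * (cs ! j) (int k) + c (int k) * (cs ! j) (- int k))) * G j)"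
      unfolding sum_distrib_left sum.distrib[symmetric]
      by (rule sum.cong[OF refl])
        (simp add: algebra_simps flip: fps_const_mult fps_const_add)
    finally show "trace_series (g k) = \<dots>" .
  qed
  also have "fps_nth \<dots> n
      = (\<Sum>j<length cs. fps_nth ((\<Sum>k=1..n. dvd_series k * fps_const (of_nat k *
          (c (- int k) * (cs ! j) (int k) + c (int k) * (cs ! j) (- int k)))) * G j) n)"
    by (subst sum.swap) (simp add: fps_sum_nth sum_distrib_right)
  also have "\<dots> = (\<Sum>j<length cs. fps_nth (covariance c (cs ! j) * G j) n)"
    by (intro sum.cong refl fps_mult_nth_cong covariance_truncated[symmetric])
  finally show "fps_nth (trace_series (wick_op (c # cs) 0)) n
    = fps_nth (\<Sum>j<length cs. covariance c (cs ! j) * trace_series (wick_op (del_nth j cs) 0)) n"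
    by (simp add: fps_sum_nth G_def)
qed

section \<open>Partitions and the Euler product\<close>

definition bounded_parts :: "nat \<Rightarrow> nat \<Rightarrow> nat multiset set" where
  "bounded_parts m n = {J. set_mset J \<subseteq> {1..m} \<and> sum_mset J = n}"

lemma finite_bounded_parts [simp]: "finite (bounded_parts m n)"
  by (rule finite_subset[OF _ finite_weight_basis[of n]]) (auto simp: bounded_parts_def monomials_def)

text \<open>A partition either avoids the part \<open>m\<close> or arises by adding one
  \<open>m\<close> to a smaller partition.\<close>

lemma card_bounded_parts:
  assumes "m > 0"
  shows "card (bounded_parts m n) = card (bounded_parts (m - 1) n)
     + (if m \<le> n then card (bounded_parts m (n - m)) else 0)"
proof -
  have "bounded_parts m n = bounded_parts (m - 1) n \<union> {J \<in> bounded_parts m n. m \<in># J}"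
  proof -
    have "{1..m - 1} = {1..m} - {m}" using assms by auto
    then show ?thesis by (auto simp: bounded_parts_def)
  qed
  moreover have "bounded_parts (m - 1) n \<inter> {J \<in> bounded_parts m n. m \<in># J} = {}"
    using assms by (auto simp: bounded_parts_def)
  ultimately have "card (bounded_parts m n)
      = card (bounded_parts (m - 1) n) + card {J \<in> bounded_parts m n. m \<in># J}"
    by (metis card_Un_disjoint finite_bounded_parts finite_Un)
  moreover have "card {J \<in> bounded_parts m n. m \<in># J} = (if m
      \<le> n then card (bounded_parts m (n - m)) else 0)"
  proof (cases "m \<le> n")
    case True
    have "bij_betw (add_mset m) (bounded_parts m (n - m)) {J \<in> bounded_parts m n. m \<in># J}"
    proof (rule bij_betwI[of _ _ _ "\<lambda>J. J - {#m#}"])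
      show "add_mset m \<in> bounded_parts m (n - m) \<rightarrow> {J \<in> bounded_parts m n. m
          \<in># J}"
        using assms True by (auto simp: bounded_parts_def)
      show "(\<lambda>J. J - {#m#}) \<in> {J \<in> bounded_parts m n. m \<in># J} \<rightarrow>
          bounded_parts m (n - m)"
        using assms True by (auto simp: bounded_parts_def dest!: multi_member_split)
    qed auto
    then show ?thesis using True bij_betw_same_card by fastforce
  next
    case False
    then have "{J \<in> bounded_parts m n. m \<in># J} = {}"
      by (auto simp: bounded_parts_def dest!: multi_member_split)
    then show ?thesis using False by simp
  qed
  ultimately show ?thesis by simp
qed

lemma bounded_parts_series:
  "(\<Prod>k=1..m. 1 - fps_X ^ k) * Abs_fps (\<lambda>n. of_nat (card (bounded_parts m n)))
      = (1 :: Q2 fps)"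
proof (induction m)
  case 0
  have "bounded_parts 0 n = (if n = 0 then {{#}} else {})" for n
    by (auto simp: bounded_parts_def)
  then show ?case by (intro fps_ext) simp
next
  case (Suc m)
  have "(1 - fps_X ^ Suc m) * Abs_fps (\<lambda>n. of_nat (card (bounded_parts (Suc m) n)))
      = (Abs_fps (\<lambda>n. of_nat (card (bounded_parts m n))) :: Q2 fps)"
    by (rule fps_ext)
      (use card_bounded_parts[of "Suc m"] in \<open>auto simp: left_diff_distrib
          fps_X_power_mult_nth simp del: power_Suc\<close>)
  then show ?case using Suc by (simp add: mult.assoc mult.left_commute)
qed

lemma euler_product_mult_nth:
  "fps_nth (euler_product * f) n = fps_nth ((\<Prod>k=1..n. 1 - fps_X ^ k) * f) n"
proof (rule fps_mult_nth_cong)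
  fix i assume "i \<le> n"
  then have "fps_nth (\<Prod>k=1..n. 1 - fps_X ^ k :: Q2 fps) i
      = fps_nth (\<Prod>k=1..i. 1 - fps_X ^ k) i"
  proof (induction n rule: dec_induct)
    case (step n)
    then show ?case
      by (simp add: right_diff_distrib mult.commute[of _ "fps_X ^ _"] fps_X_power_mult_nth
         del: power_Suc)
  qed simp
  then show "fps_nth euler_product i = fps_nth (\<Prod>k=1..n. 1 - fps_X ^ k) i"
    by (simp add: euler_product_def)
qed

text \<open>The dimension of weight \<open>n\<close> is the number of partitions of
  \<open>n\<close>. This normalizes the character of the vacuum to 1 and starts the Wick
  recursion.\<close>

lemma euler_product_trace_id: "euler_product * trace_series (\<lambda>v. v) = 1"
proof (rule fps_ext)
  fix n
  have "weight_basis i = bounded_parts n i" if "i \<le> n" for i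
  proof -
    have "x \<le> n" if "x \<in># J" "sum_mset J = i" for x J
      using that \<open>i \<le> n\<close> by (auto dest!: multi_member_split)
    moreover have "x > 0" if "x \<in># J" "0 \<notin># J" for x and J :: "nat multiset"
      using that by (metis gr0I)
    ultimately show ?thesis
      by (auto simp: bounded_parts_def monomials_def Suc_le_eq)
  qed
  then have "fps_nth (trace_series (\<lambda>v. v)) i
      = fps_nth (Abs_fps (\<lambda>i. of_nat (card (bounded_parts n i)))) i"
    if "i \<le> n" for i
    using that by (simp add: trace_series_def graded_trace_def)
  then have "fps_nth ((\<Prod>k=1..n. 1 - fps_X ^ k) * trace_series (\<lambda>v. v)) n
     = fps_nth ((\<Prod>k=1..n. 1 - fps_X ^ k) * Abs_fps (\<lambda>i. of_nat (card (bounded_parts n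
         i)))) n"
    unfolding mult.commute[of "\<Prod>k=1..n. 1 - fps_X ^ k"] by (rule fps_mult_nth_cong)
  then show "fps_nth (euler_product * trace_series (\<lambda>v. v)) n = fps_nth 1 n"
    by (simp add: euler_product_mult_nth bounded_parts_series del: One_nat_def fps_one_nth)
qed

section \<open>Wick recursion for characters of monomials\<close>

definition mono_char :: "nat multiset \<Rightarrow> Q2 fps" where
  "mono_char I = euler_product * trace_series (vertex_op_monomial I (int (sum_mset I) - 1))"

lemma F_S_expand: "F_S v = (\<Sum>I\<in>Poly_Mapping.keys v. fps_const (coeff_at v I) * mono_char I)"
proof -
  have "F_S v = euler_product * trace_series (zero_mode v)"
    by (simp add: F_S_def trace_series_def)
  also have "trace_series (zero_mode v) = (\<Sum>I\<in>Poly_Mapping.keys v. fps_const (coeff_at v I) *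
      trace_series (vertex_op_monomial I (int (sum_mset I) - 1)))"
    unfolding zero_mode_def trace_series_sum trace_series_scale ..
  finally show ?thesis
    by (simp add: mono_char_def sum_distrib_left mult_ac)
qed

lemma F_S_superset:
  assumes "finite A" "Poly_Mapping.keys v \<subseteq> A"
  shows "F_S v = (\<Sum>I\<in>A. fps_const (coeff_at v I) * mono_char I)"
  unfolding F_S_expand using assms by (intro sum.mono_neutral_left) (auto simp: in_keys_iff)

lemma F_S_add: "F_S (v + w) = F_S v + F_S w"
proof -
  let ?A = "Poly_Mapping.keys v \<union> Poly_Mapping.keys w"
  have "Poly_Mapping.keys (v + w) \<subseteq> ?A" by (rule Poly_Mapping.keys_add)
  then show ?thesis
    using F_S_superset[of ?A v] F_S_superset[of ?A w] F_S_superset[of ?A "v + w"]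
    by (simp add: lookup_add sum.distrib ring_distribs flip: fps_const_add)
qed

lemma F_S_0 [simp]: "F_S 0 = 0"
  by (simp add: F_S_expand)

lemma F_S_scale: "F_S (heis_scale c v) = fps_const c * F_S v"
proof -
  have "Poly_Mapping.keys (heis_scale c v) \<subseteq> Poly_Mapping.keys v" by (auto simp: in_keys_iff)
  then show ?thesis
    using F_S_superset[of "Poly_Mapping.keys v" "heis_scale c v"] F_S_superset[of "Poly_Mapping.keys
        v" v]
    by (simp add: sum_distrib_left mult.assoc flip: fps_const_mult)
qed

lemma F_S_sum: "F_S (sum f A) = (\<Sum>x\<in>A. F_S (f x))"
  by (induction A rule: infinite_finite_induct) (auto simp: F_S_add)

lemma F_S_single: "F_S (Poly_Mapping.single I c) = fps_const c * mono_char I"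
  by (simp add: F_S_expand)

definition mode_cov :: "nat \<Rightarrow> nat \<Rightarrow> Q2 fps" where
  "mode_cov m n = covariance (mode_coeff m) (mode_coeff n)"

lemma mode_cov_commute: "mode_cov m n = mode_cov n m"
  unfolding mode_cov_def covariance_def by (rule fps_ext) (simp add: algebra_simps)

lemma mono_char_list:
  assumes "0 \<notin># I"
  shows "mono_char I = euler_product * trace_series (wick_op (map mode_coeff
      (sorted_list_of_multiset I)) 0)"
proof -
  have "vertex_op_monomial I (int (sum_mset I) - 1)
      = wick_op (map mode_coeff (sorted_list_of_multiset I)) 0"
    by (rule ext, rule vertex_op_monomial_eq) (simp add: monomials_def assms)
  then show ?thesis unfolding mono_char_def by (simp only:)
qed

lemma mono_char_empty [simp]: "mono_char {#} = 1"
proof -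
  have "wick_op [] 0 = (\<lambda>v. v)" by (rule ext) simp
  then show ?thesis using euler_product_trace_id by (simp add: mono_char_list)
qed

lemma del_nth_facts:
  assumes "j < length xs"
  shows "mset (del_nth j xs) = mset xs - {#xs ! j#}" and "sorted xs
      \<Longrightarrow> sorted (del_nth j xs)"
    and "map f (del_nth j xs) = del_nth j (map f xs)"
proof -
  have xs: "xs = take j xs @ xs ! j # drop (Suc j) xs"
    using assms by (rule id_take_nth_drop)
  have "mset xs = add_mset (xs ! j) (mset (del_nth j xs))"
    by (subst xs) (simp add: del_nth_def del: append_take_drop_id)
  then show "mset (del_nth j xs) = mset xs - {#xs ! j#}" by simp
  show "sorted (del_nth j xs)" if "sorted xs"
  proof -
    have "sorted (take j xs @ xs ! j # drop (Suc j) xs)" using that xs by simp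
    then show ?thesis unfolding del_nth_def sorted_append by auto
  qed
  show "map f (del_nth j xs) = del_nth j (map f xs)"
    by (simp add: del_nth_def take_map drop_map)
qed

text \<open>The least part is the head of the sorted list, to which the trace recursion applies.
  Deleting a further entry leaves a sorted list, so the remaining trace is again the character of a
  monomial.\<close>

lemma mono_char_Min:
  assumes "0 \<notin># I" "n \<in># I" "\<And>m. m \<in># I \<Longrightarrow> n \<le> m"
  shows "mono_char I = (\<Sum>b\<in>#I - {#n#}. mode_cov n b * mono_char (I - {#n#} - {#b#}))"
proof -
  define ns where "ns = sorted_list_of_multiset (I - {#n#})"
  have ns: "mset ns = I - {#n#}" "sorted ns" by (simp_all add: ns_def)
  have "sorted_list_of_multiset I = n # ns"
  proof -
    have "sorted_list_of_multiset I = insort n ns"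
      unfolding ns_def by (metis assms(2) insert_DiffM sorted_list_of_multiset_insert)
    also have "\<dots> = n # ns"
      by (rule insort_is_Cons) (use assms in \<open>auto simp: ns_def dest: in_diffD\<close>)
    finally show ?thesis .
  qed
  then have "mono_char I = euler_product * trace_series (wick_op (mode_coeff n # map mode_coeff ns) 0)"
    using assms by (simp add: mono_char_list)
  also have "\<dots> = (\<Sum>j<length ns. mode_cov n (ns ! j) *
      (euler_product * trace_series (wick_op (map mode_coeff (del_nth j ns)) 0)))"
    by (subst trace_series_wick_op) (simp add: sum_distrib_left mode_cov_def del_nth_facts mult_ac)
  also have "\<dots> = (\<Sum>j<length ns. mode_cov n (ns ! j) * mono_char (I - {#n#} - {#ns ! j#}))"
  proof (intro sum.cong refl arg_cong2[of _ _ _ _ "(*)"])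
    fix j assume "j \<in> {..<length ns}"
    then have j: "mset (del_nth j ns) = I - {#n#} - {#ns ! j#}" "sorted (del_nth j ns)"
      using ns by (auto simp: del_nth_facts)
    have "sorted_list_of_multiset (I - {#n#} - {#ns ! j#}) = del_nth j ns"
      using j by (metis sorted_list_of_multiset_mset sorted_sort_id)
    moreover have "0 \<notin># I - {#n#} - {#ns ! j#}" using assms by (meson in_diffD)
    ultimately show "euler_product * trace_series (wick_op (map mode_coeff (del_nth j ns)) 0)
       = mono_char (I - {#n#} - {#ns ! j#})" by (simp add: mono_char_list)
  qed
  also have "\<dots> = (\<Sum>b\<leftarrow>ns. mode_cov n b * mono_char (I - {#n#} - {#b#}))"
    by (simp add: sum_list_sum_nth atLeast0LessThan)
  also have "\<dots> = (\<Sum>b\<in>#I - {#n#}. mode_cov n b * mono_char (I - {#n#} - {#b#}))"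
    using sum_mset_sum_list[of "map (\<lambda>b. mode_cov n b * mono_char (I - {#n#} - {#b#})) ns"]
        ns(1)
    by simp
  finally show ?thesis .
qed

text \<open>Both sides run over ordered pairs of distinct occurrences in \<open>M\<close>.\<close>

lemma sum_mset_remove1_swap:
  fixes f :: "'a \<Rightarrow> 'a \<Rightarrow> 'b :: comm_monoid_add"
  shows "(\<Sum>b\<in>#M. \<Sum>d\<in>#M - {#b#}. f b d)
      = (\<Sum>d\<in>#M. \<Sum>b\<in>#M - {#d#}. f b d)"
proof (induction M)
  case (add x M)
  have "(\<Sum>b\<in>#M. \<Sum>d\<in>#add_mset x M - {#b#}. f b d) = (\<Sum>b\<in>#M. f b x)
      + (\<Sum>b\<in>#M. \<Sum>d\<in>#M - {#b#}. f b d)" for f :: "'a \<Rightarrow> 'a \<Rightarrow> 'b"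
    unfolding sum_mset.distrib[symmetric]
    by (intro arg_cong[of _ _ sum_mset] image_mset_cong) (auto dest!: multi_member_split)
  from this[of f] this[of "\<lambda>b d. f d b"] add show ?case
    by (simp add: ac_simps)
qed simp

text \<open>The vertex operator of a monomial takes its factors in increasing order, so the
    recursion is first
  available for the least part only; the general case follows by expanding twice.\<close>

lemma mono_char_wick:
  assumes "0 \<notin># I" "n \<in># I"
  shows "mono_char I = (\<Sum>b\<in>#I - {#n#}. mode_cov n b * mono_char (I - {#n#} - {#b#}))"
  using assms
proof (induction "size I" arbitrary: I n rule: less_induct)
  case (less I n)
  define m where "m = Min (set_mset I)"
  have m: "m \<in># I" "\<And>x. x \<in># I \<Longrightarrow> m \<le> x"
  proof -
    have "set_mset I \<noteq> {}" using less.prems by blast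
    then show "m \<in># I" unfolding m_def by (rule Min_in[OF finite_set_mset])
    show "m \<le> x" if "x \<in># I" for x using that by (simp add: m_def)
  qed
  show ?case
  proof (cases "n = m")
    case True
    then show ?thesis using mono_char_Min[OF less.prems(1) m] by simp
  next
    case False
    define M where "M = I - {#m#} - {#n#}"
    have I: "I = add_mset m (add_mset n M)"
      using less.prems m False unfolding M_def
      by (metis add_mset_remove_trivial diff_right_commute insert_DiffM insert_noteq_member)
    have M0: "0 \<notin># M" and mn0: "m \<noteq> 0" "n \<noteq> 0" using less.prems I by auto
    have mM: "m \<le> x" if "x \<in># add_mset n M" for x using m I that by auto
    have sub: "0 \<notin># M - {#b#}" for b using M0 by (meson in_diffD)
    \<comment> \<open>This multiset has two parts fewer than \<open>I\<close>, so the induction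
      hypothesis may contract \<open>n\<close>; in the next claim \<open>m\<close> is still least
      and is contracted directly.\<close>
    have 1: "mono_char (add_mset n (M - {#b#}))
        = (\<Sum>d\<in>#M - {#b#}. mode_cov n d * mono_char (M - {#b#} - {#d#}))"
      if "b \<in># M" for b
      using less.hyps[of "add_mset n (M - {#b#})" n] sub mn0 that I
      by (simp add: size_Suc_Diff1)
    have 2: "mono_char (add_mset m (M - {#d#}))
        = (\<Sum>b\<in>#M - {#d#}. mode_cov m b * mono_char (M - {#d#} - {#b#}))"
      if "d \<in># M" for d
      using mono_char_Min[of "add_mset m (M - {#d#})" m] sub mn0 mM by (auto dest: in_diffD)
    have "mono_char I = (\<Sum>b\<in>#add_mset n M. mode_cov m b * mono_char (add_mset n M - {#b#}))"
      using mono_char_Min[OF less.prems(1) m] I by simp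
    also have "\<dots> = mode_cov m n * mono_char M
        + (\<Sum>b\<in>#M. mode_cov m b * mono_char (add_mset n (M - {#b#})))"
      by (simp, intro arg_cong[of _ _ sum_mset] image_mset_cong) (auto dest!: multi_member_split)
    also have "(\<Sum>b\<in>#M. mode_cov m b * mono_char (add_mset n (M - {#b#})))
        = (\<Sum>b\<in>#M. \<Sum>d\<in>#M - {#b#}. mode_cov m b * mode_cov n d * mono_char (M -
            {#b#} - {#d#}))"
      by (intro arg_cong[of _ _ sum_mset] image_mset_cong)
        (simp add: 1 sum_mset_distrib_left mult.assoc)
    also have "\<dots> = (\<Sum>d\<in>#M. \<Sum>b\<in>#M - {#d#}. mode_cov m b * mode_cov n d *
        mono_char (M - {#b#} - {#d#}))"
      by (rule sum_mset_remove1_swap)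
    also have "\<dots> = (\<Sum>d\<in>#M. mode_cov n d * mono_char (add_mset m (M - {#d#})))"
      by (intro arg_cong[of _ _ sum_mset] image_mset_cong)
        (simp add: 2 sum_mset_distrib_left mult_ac add_mset_commute)
    also have "mode_cov m n * mono_char M + \<dots>
        = (\<Sum>b\<in>#add_mset m M. mode_cov n b * mono_char (add_mset m M - {#b#}))"
      by (simp add: mode_cov_commute[of m n], intro arg_cong[of _ _ sum_mset] image_mset_cong)
        (auto dest!: multi_member_split)
    finally show ?thesis using I by (simp add: add_mset_commute)
  qed
qed

section \<open>Integrality and moments of the character map\<close>

lemma qabs_0 [simp]: "qabs 0 = 0"
  by (simp add: qabs_eq_0)

lemma qabs_of_int_le: "qabs (of_int z) \<le> 1"
proof -
  have "qabs (of_int z) = abs2 (of_int z)" using qabs_of_rat[of "of_int z"] by simp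
  also have "\<dots> \<le> 1"
  proof (cases "z = 0")
    case False
    then have "abs2 (of_int z) = 2 powi (0 - int (multiplicity 2 z))"
      using abs2_Fract[of z 1] by (simp add: of_int_rat)
    also have "\<dots> \<le> 1"
      using power_int_increasing[of "0 - int (multiplicity 2 z)" 0 "2::real"] by simp
    finally show ?thesis .
  qed simp
  finally show ?thesis .
qed

lemma qabs_of_nat_le: "qabs (of_nat n) \<le> 1"
  using qabs_of_int_le[of "int n"] by simp

lemma qabs_1 [simp]: "qabs 1 = 1"
  using qabs_of_rat[of 1] by simp

lemma qabs_2: "qabs 2 = 1 / 2"
proof -
  have "qabs 2 = abs2 2" using qabs_of_rat[of 2] by simp
  also have "\<dots> = 1 / 2"
    using abs2_Fract[of 2 1] by (simp add: power_int_minus flip: of_int_rat)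
  finally show ?thesis .
qed

lemma qabs_odd:
  assumes "odd z" shows "qabs (of_int z) = 1"
proof -
  have "qabs (of_int z) = abs2 (of_int z)" using qabs_of_rat[of "of_int z"] by simp
  also have "\<dots> = 1"
    using abs2_Fract[of z 1] assms by (auto simp: of_int_rat not_dvd_imp_multiplicity_0)
  finally show ?thesis .
qed

lemma qabs_power: "qabs (x ^ n) = qabs x ^ n"
  by (induction n) (auto simp: qabs_mult)

lemma qabs_inverse: "qabs (inverse x) = inverse (qabs x)"
proof (cases "x = 0")
  case False
  then have "qabs x * qabs (inverse x) = 1" by (simp flip: qabs_mult)
  then show ?thesis by (rule inverse_unique[symmetric])
qed auto

lemma qabs_divide: "qabs (x / y) = qabs x / qabs y"
  by (simp add: divide_inverse qabs_mult qabs_inverse)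

lemma qabs_sum_le:
  "e \<ge> 0 \<Longrightarrow> (\<And>x. x \<in> A \<Longrightarrow> qabs (f x) \<le> e)
      \<Longrightarrow> qabs (sum f A) \<le> e"
proof (induction A rule: infinite_finite_induct)
  case (insert x A)
  then show ?case using qabs_add_le_max[of "f x" "sum f A"] by fastforce
qed auto

section \<open>Sup-norm bounds for series and states\<close>

definition fps_le :: "real \<Rightarrow> Q2 fps \<Rightarrow> bool" where
  "fps_le e f \<longleftrightarrow> (\<forall>n. qabs (fps_nth f n) \<le> e)"

lemma fps_leD: "fps_le e f \<Longrightarrow> qabs (fps_nth f n) \<le> e"
  by (simp add: fps_le_def)

lemma fps_le_mono: "fps_le e f \<Longrightarrow> e \<le> e' \<Longrightarrow> fps_le e' f"
  unfolding fps_le_def using order_trans by blast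

lemma fps_le_0 [simp]: "e \<ge> 0 \<Longrightarrow> fps_le e 0"
  by (simp add: fps_le_def)

lemma fps_le_nonneg: "fps_le e f \<Longrightarrow> e \<ge> 0"
  unfolding fps_le_def using qabs_nonneg order_trans by blast

lemma fps_le_add: "fps_le e f \<Longrightarrow> fps_le e g \<Longrightarrow> fps_le e (f + g)"
  unfolding fps_le_def using qabs_add_le_max by (metis fps_add_nth max.bounded_iff order_trans max_def)

lemma fps_le_uminus: "fps_le e f \<Longrightarrow> fps_le e (- f)"
  by (simp add: fps_le_def qabs_minus)

lemma fps_le_diff: "fps_le e f \<Longrightarrow> fps_le e g \<Longrightarrow> fps_le e (f - g)"
  using fps_le_add[OF _ fps_le_uminus, of e f g] by simp

lemma fps_le_sum: "e \<ge> 0 \<Longrightarrow> (\<And>x. x \<in> A \<Longrightarrow> fps_le e (f x))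
    \<Longrightarrow> fps_le e (sum f A)"
  by (induction A rule: infinite_finite_induct) (auto simp: fps_le_add)

lemma fps_le_mult:
  assumes "fps_le a f" "fps_le b g" shows "fps_le (a * b) (f * g)"
  unfolding fps_le_def fps_mult_nth
  using assms fps_le_nonneg[OF assms(1)] fps_le_nonneg[OF assms(2)]
  by (auto intro!: qabs_sum_le mult_mono simp: qabs_mult fps_le_def qabs_nonneg)

lemma fps_le_mult1: "fps_le 1 f \<Longrightarrow> fps_le e g \<Longrightarrow> fps_le e (f * g)"
  using fps_le_mult[of 1 f e g] by simp

lemma fps_le_const: "qabs c \<le> e \<Longrightarrow> fps_le e (fps_const c)"
  using qabs_nonneg[of c] by (auto simp: fps_le_def)

lemma fps_le_1 [simp]: "fps_le 1 1"
  using fps_le_const[of 1 1] by simp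

lemma fps_le_power: "fps_le 1 f \<Longrightarrow> fps_le 1 (f ^ n)"
  by (induction n) (auto intro: fps_le_mult1)

definition heis_le :: "real \<Rightarrow> heis_vec \<Rightarrow> bool" where
  "heis_le e v \<longleftrightarrow> (\<forall>I. qabs (coeff_at v I) \<le> e)"

lemma heis_le_add: "heis_le e v \<Longrightarrow> heis_le e w \<Longrightarrow> heis_le e (v + w)"
  unfolding heis_le_def lookup_add
  using qabs_add_le_max by (metis max.bounded_iff order_trans max_def)

lemma heis_le_scale: "heis_le e v \<Longrightarrow> qabs c \<le> 1
    \<Longrightarrow> heis_le e (heis_scale c v)"
  unfolding heis_le_def using mult_mono[of "qabs c" 1 _ e]
  by (auto simp: qabs_mult qabs_nonneg)

lemma heis_le_mult:
  assumes "heis_le 1 v" "heis_le 1 w" shows "heis_le 1 (v * w)"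
proof -
  have "v * w = (\<Sum>I\<in>Poly_Mapping.keys v. Poly_Mapping.single I (coeff_at v I) * w)"
    by (subst heis_expand[of v]) (simp add: sum_distrib_right)
  moreover have "qabs (coeff_at v I * coeff_at w J) \<le> 1" for I J
    using assms mult_mono[of "qabs (coeff_at v I)" 1 "qabs (coeff_at w J)" 1]
    by (simp add: heis_le_def qabs_mult qabs_nonneg)
  ultimately show ?thesis
    by (auto simp: heis_le_def lookup_sum lookup_single_mult intro!: qabs_sum_le)
qed

lemma heis_le_single: "qabs c \<le> 1 \<Longrightarrow> heis_le 1 (Poly_Mapping.single I c)"
  by (simp add: heis_le_def lookup_single when_def)

lemma heis_le_power: "heis_le 1 v \<Longrightarrow> heis_le 1 (v ^ n)"
  by (induction n) (auto intro: heis_le_mult heis_le_single simp flip: single_one)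

text \<open>Binomial polynomials are integer valued; a negative argument is reduced to a natural
  number by upper negation.\<close>

lemma gbinomial_of_int: "\<exists>z. (of_int x gchoose k :: Q2) = of_int z"
proof (cases "x \<ge> 0")
  case True
  then have "(of_int x gchoose k :: Q2) = of_int (int (nat x choose k))"
    using binomial_gbinomial[of "nat x" k, where 'a = Q2] by simp
  then show ?thesis ..
next
  case False
  define y where "y = nat (- x + int k - 1)"
  have y: "- of_int x + of_nat k - 1 = (of_nat y :: Q2)"
    using False unfolding y_def
    by (subst of_int_of_nat_eq[symmetric], subst nat_0_le) (auto simp: of_int_diff)
  have "(of_int x gchoose k :: Q2) = (- 1) ^ k * (- of_int x + of_nat k - 1 gchoose k)"
    using gbinomial_minus[of "- of_int x :: Q2" k] by simp
  also have "\<dots> = of_int ((- 1) ^ k * int (y choose k))"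
    unfolding y by (simp add: binomial_gbinomial)
  finally show ?thesis ..
qed

lemma qabs_mode_coeff: "qabs (mode_coeff n k) \<le> 1"
proof -
  obtain z where "(of_int (- k - 1) gchoose (n - 1) :: Q2) = of_int z" using gbinomial_of_int by blast
  then show ?thesis unfolding mode_coeff_def by (simp only: qabs_of_int_le)
qed

lemma fps_le_covariance:
  assumes "\<And>k. qabs (c k) \<le> 1" "\<And>k. qabs (d k) \<le> 1"
  shows "fps_le 1 (covariance c d)"
proof -
  have m: "qabs (x * y) \<le> 1" if "qabs x \<le> 1" "qabs y \<le> 1" for x y
    using mult_mono[OF that] by (simp add: qabs_mult qabs_nonneg)
  have a: "qabs (x + y) \<le> 1" if "qabs x \<le> 1" "qabs y \<le> 1" for x y
    using that qabs_add_le_max[of x y] by simp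
  show ?thesis
    unfolding fps_le_def covariance_def
    by (auto intro!: qabs_sum_le m a assms qabs_of_nat_le)
qed

text \<open>Covariances of integral mode functions are integral, and the recursion uses sums and
  products only. Consequently \<open>F_S\<close> does not increase the norm, which is what makes its
  extension to the completion well defined.\<close>

lemma fps_le_mono_char:
  assumes "0 \<notin># I" shows "fps_le 1 (mono_char I)"
  using assms
proof (induction "size I" arbitrary: I rule: less_induct)
  case less
  show ?case
  proof (cases "I = {#}")
    case False
    then obtain n where n: "n \<in># I" by blast
    \<comment> \<open>The index multiset is allowed to grow while the characters still refer to the
      fixed \<open>I\<close>; otherwise the summands would change during this induction.\<close>
    have "fps_le 1 (\<Sum>b\<in>#M. mode_cov n b * mono_char (I - {#n#} - {#b#}))"
        if "M \<subseteq># I - {#n#}" for M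
      using that
    proof (induction M)
      case (add b M)
      have "size (I - {#n#} - {#b#}) < size I"
        using n by (metis diff_le_self insert_DiffM le_imp_less_Suc size_Diff_submset size_add_mset
            size_mset_mono diff_subset_eq_self)
      then have "fps_le 1 (mono_char (I - {#n#} - {#b#}))"
        using less by (meson in_diffD)
      moreover have "M \<subseteq># I - {#n#}" using add.prems
        by (meson mset_subset_eq_insertD subset_mset.less_imp_le)
      ultimately show ?case using add.IH
        by (auto intro!: fps_le_add fps_le_mult1 fps_le_covariance qabs_mode_coeff simp: mode_cov_def)
    qed simp
    then show ?thesis using mono_char_wick[OF less.prems n] by simp
  qed simp
qed

lemma fps_le_F_S:
  assumes "v \<in> heis" "heis_le e v" shows "fps_le e (F_S v)"
  unfolding F_S_expand
proof (rule fps_le_sum)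
  show "e \<ge> 0" using assms(2) qabs_nonneg order_trans unfolding heis_le_def by blast
next
  fix I assume "I \<in> Poly_Mapping.keys v"
  then have "0 \<notin># I" using assms by (auto simp: heis_def monomials_def)
  then show "fps_le e (fps_const (coeff_at v I) * mono_char I)"
    using fps_le_mult1[OF fps_le_mono_char[of I] fps_le_const[of "coeff_at v I" e]] assms
    by (simp add: heis_le_def mult.commute)
qed

section \<open>Gaussian integration by parts and moments of linear states\<close>

lemma heis_deriv_add: "heis_deriv n (v + w) = heis_deriv n v + heis_deriv n w"
  by (rule poly_mapping_eqI) (simp add: lookup_heis_deriv lookup_add ring_distribs)

lemma heis_deriv_0 [simp]: "heis_deriv n 0 = 0"
  by (simp add: heis_deriv_def)

lemma heis_deriv_sum: "heis_deriv n (sum f A) = (\<Sum>x\<in>A. heis_deriv n (f x))"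
  by (induction A rule: infinite_finite_induct) (auto simp: heis_deriv_add)

lemma heis_deriv_single:
  "heis_deriv n (Poly_Mapping.single I c) = Poly_Mapping.single (I - {#n#}) (of_nat (count I n) * c)"
  by (simp add: heis_deriv_def)

lemma heis_deriv_mult: "heis_deriv n (v * w) = heis_deriv n v * w + v * heis_deriv n w"
proof -
  have single: "heis_deriv n (Poly_Mapping.single I a * Poly_Mapping.single J b)
    = heis_deriv n (Poly_Mapping.single I a) * Poly_Mapping.single J b
      + Poly_Mapping.single I a * heis_deriv n (Poly_Mapping.single J b)" for I J a b
    by (cases "n \<in># I"; cases "n \<in># J")
      (auto simp: mult_single heis_deriv_single not_in_iff algebra_simps dest!: multi_member_split
        simp flip: single_add)
  let ?S = "\<lambda>v I. Poly_Mapping.single I (coeff_at v I)"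
  have "heis_deriv n ((\<Sum>I\<in>A. ?S v I) * (\<Sum>J\<in>B. ?S w J))
    = heis_deriv n (\<Sum>I\<in>A. ?S v I) * (\<Sum>J\<in>B. ?S w J)
        + (\<Sum>I\<in>A. ?S v I) * heis_deriv n (\<Sum>J\<in>B. ?S w J)"
    for A B
    by (simp add: sum_product heis_deriv_sum single sum.distrib)
  from this[of "Poly_Mapping.keys v" "Poly_Mapping.keys w"] show ?thesis
    by (simp flip: heis_expand)
qed

lemma heis_deriv_power: "heis_deriv n (v ^ k) = of_nat k * v ^ (k - 1) * heis_deriv n v"
proof (induction k)
  case 0
  show ?case using heis_deriv_single[of n "{#}" 1] by (simp flip: single_one)
next
  case (Suc k)
  then show ?case by (cases k) (simp_all add: heis_deriv_mult algebra_simps)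
qed

text \<open>Fixing the set of variables lets the contraction sums run over one set \<open>B\<close>
  for all monomials at once.\<close>

definition heis_on :: "nat set \<Rightarrow> heis_vec set" where
  "heis_on B = {v. \<forall>I\<in>Poly_Mapping.keys v. set_mset I \<subseteq> B}"

lemma heis_on_heis: "0 \<notin> B \<Longrightarrow> heis_on B \<subseteq> heis"
  by (auto simp: heis_on_def heis_def monomials_def)

lemma heis_on_mult:
  assumes "v \<in> heis_on B" "w \<in> heis_on B" shows "v * w \<in> heis_on B"
proof -
  have "set_mset I \<subseteq> B" if I: "I \<in> Poly_Mapping.keys (v * w)" for I
  proof -
    obtain J K where "I = J + K" "J \<in> Poly_Mapping.keys v" "K \<in> Poly_Mapping.keys w"
      using I keys_mult[of v w] by blast
    then show ?thesis using assms by (auto simp: heis_on_def)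
  qed
  then show ?thesis by (simp add: heis_on_def)
qed

lemma heis_on_power: "v \<in> heis_on B \<Longrightarrow> v ^ n \<in> heis_on B"
proof (induction n)
  case 0
  show ?case by (simp add: heis_on_def flip: single_one)
qed (auto intro: heis_on_mult)

lemma sum_mset_count: "(\<Sum>b\<in>#M. f b) = (\<Sum>b\<in>set_mset M. of_nat (count M b) * f b)"
  for f :: "'a \<Rightarrow> 'b :: comm_semiring_1"
proof (induction M)
  case (add x M)
  have "(\<Sum>b\<in>set_mset (add_mset x M). of_nat (count (add_mset x M) b) * f b)
      = (\<Sum>b\<in>insert x (set_mset M). (if b = x then f b else 0) + of_nat (count M b) * f b)"
    by (rule sum.cong) (auto simp: algebra_simps)
  also have "\<dots> = f x + (\<Sum>b\<in>insert x (set_mset M). of_nat (count M b) * f b)"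
    by (simp only: sum.distrib) simp
  also have "(\<Sum>b\<in>insert x (set_mset M). of_nat (count M b) * f b)
      = (\<Sum>b\<in>set_mset M. of_nat (count M b) * f b)"
    by (rule sum.mono_neutral_right) (auto simp: not_in_iff)
  finally show ?case using add by simp
qed simp

text \<open>Gaussian integration by parts: the derivative in \<open>b\<close> removes one
  \<open>b\<close> and counts, by its multiplicity, the occurrences with which \<open>n\<close> can
  be contracted.\<close>

lemma F_S_wick:
  assumes B: "finite B" "0 \<notin> B" and n: "n \<in> B" and w: "w \<in> heis_on B"
  shows "F_S (Poly_Mapping.single {#n#} 1 * w) = (\<Sum>b\<in>B. mode_cov n b * F_S (heis_deriv b w))"
proof -
  have single: "F_S (Poly_Mapping.single {#n#} 1 * Poly_Mapping.single I c)
      = (\<Sum>b\<in>B. mode_cov n b * F_S (heis_deriv b (Poly_Mapping.single I c)))"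
          if I: "set_mset I \<subseteq> B" for I c
  proof -
    have "n \<noteq> 0" using B n by metis
    then have "0 \<notin># add_mset n I" using B I by auto
    then have "mono_char (add_mset n I) = (\<Sum>b\<in>#I. mode_cov n b * mono_char (I - {#b#}))"
      using mono_char_wick[of "add_mset n I" n] by simp
    also have "\<dots> = (\<Sum>b\<in>set_mset I. of_nat (count I b) * (mode_cov n b * mono_char (I
        - {#b#})))"
      by (rule sum_mset_count)
    also have "\<dots> = (\<Sum>b\<in>B. of_nat (count I b) * (mode_cov n b * mono_char (I - {#b#})))"
      using I B(1) by (intro sum.mono_neutral_left) (auto simp: not_in_iff)
    finally show ?thesis
      by (simp add: mult_single F_S_single heis_deriv_single sum_distrib_left fps_of_nat mult_ac
          flip: fps_const_mult)
  qed
  have "F_S (Poly_Mapping.single {#n#} 1 * (\<Sum>I\<in>Poly_Mapping.keys w. Poly_Mapping.single I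
      (coeff_at w I)))
     = (\<Sum>b\<in>B. mode_cov n b * F_S (heis_deriv b (\<Sum>I\<in>Poly_Mapping.keys w.
         Poly_Mapping.single I (coeff_at w I))))"
    using w unfolding sum_distrib_left heis_deriv_sum F_S_sum
    by (subst sum.swap) (auto simp: heis_on_def intro!: sum.cong single)
  then show ?thesis by (simp flip: heis_expand)
qed

text \<open>A state that is linear in the \<open>h(-n)\<close> enters the covariance only through
    the function
  \<open>lin_fun\<close> of the mode index, and
      by Mahler's theorem every continuous function on the 2-adic
  integers arises in this way in the completion. The functions \<open>k\<close> and
      \<open>k\<^sup>2\<close> used below are
  orthogonal because of their parity.\<close>

definition lin_state :: "nat set \<Rightarrow> (nat \<Rightarrow> Q2) \<Rightarrow> heis_vec" where
  "lin_state B \<alpha> = (\<Sum>b\<in>B. Poly_Mapping.single {#b#} (\<alpha> b))"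

definition lin_fun :: "nat set \<Rightarrow> (nat \<Rightarrow> Q2) \<Rightarrow> int \<Rightarrow>
    Q2" where
  "lin_fun B \<alpha> k = (\<Sum>b\<in>B. \<alpha> b * mode_coeff b k)"

lemma covariance_lin_fun:
  "covariance (lin_fun B \<alpha>) (lin_fun B \<beta>)
      = (\<Sum>n\<in>B. \<Sum>b\<in>B. fps_const (\<alpha> n * \<beta> b) * mode_cov n b)"
proof (rule fps_ext)
  fix N
  have "(\<Sum>k | k dvd N. of_nat k * (lin_fun B \<alpha> (- int k) * lin_fun B \<beta> (int k)
            + lin_fun B \<alpha> (int k) * lin_fun B \<beta> (- int k)))
     = (\<Sum>k | k dvd N. \<Sum>n\<in>B. \<Sum>b\<in>B. \<alpha> n * \<beta> b * (of_nat k *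
        (mode_coeff n (- int k) * mode_coeff b (int k)
            + mode_coeff n (int k) * mode_coeff b (- int k))))"
    unfolding lin_fun_def unfolding sum_product unfolding sum.distrib[symmetric] sum_distrib_left
    by (intro sum.cong refl) (simp add: algebra_simps)
  also have "\<dots> = (\<Sum>n\<in>B. \<Sum>b\<in>B. \<alpha> n * \<beta> b * (\<Sum>k | k dvd N.
      of_nat k *
        (mode_coeff n (- int k) * mode_coeff b (int k)
            + mode_coeff n (int k) * mode_coeff b (- int k))))"
    unfolding sum_distrib_left
    by (rule trans[OF sum.swap], rule sum.cong[OF refl], rule sum.swap)
  finally show "fps_nth (covariance (lin_fun B \<alpha>) (lin_fun B \<beta>)) N
    = fps_nth (\<Sum>n\<in>B. \<Sum>b\<in>B. fps_const (\<alpha> n * \<beta> b) * mode_cov n b) N"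
    by (simp add: covariance_def mode_cov_def fps_sum_nth)
qed

lemma lin_state_heis_on: "finite B \<Longrightarrow> lin_state B \<alpha> \<in> heis_on B"
  using keys_sum[of "\<lambda>b. Poly_Mapping.single {#b#} (\<alpha> b)" B]
  by (fastforce simp: lin_state_def heis_on_def split: if_splits)

lemma heis_deriv_lin_state:
  assumes "finite B" "b \<in> B"
  shows "heis_deriv b (lin_state B \<alpha>) = Poly_Mapping.single {#} (\<alpha> b)"
proof -
  have "heis_deriv b (lin_state B \<alpha>) = (\<Sum>x\<in>B. if x
      = b then Poly_Mapping.single {#} (\<alpha> b) else 0)"
    unfolding lin_state_def heis_deriv_sum by (rule sum.cong) (auto simp: heis_deriv_single)
  then show ?thesis using assms by simp
qed

lemma heis_scale_of_nat_mult: "heis_scale (of_nat k * c) v = of_nat k * (Poly_Mapping.single {#} c * v)"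
proof -
  have "of_nat k = (Poly_Mapping.single {#} (of_nat k) :: heis_vec)"
    by (simp only: single_of_nat)
  then show ?thesis
    by (simp only: heis_scale_def mult.assoc[symmetric] mult_single add_0_left)
qed

text \<open>One factor \<open>x\<close> is contracted with each of the other \<open>i\<close> copies
  of \<open>x\<close> and the \<open>j\<close> copies of \<open>y\<close>. When an exponent is 0 its
  truncated predecessor is harmless, since it comes with the coefficient 0.\<close>

lemma F_S_lin_state_mult:
  fixes \<alpha> \<beta> :: "nat \<Rightarrow> Q2"
  assumes B: "finite B" "0 \<notin> B"
  defines "x \<equiv> lin_state B \<alpha>" and "y \<equiv> lin_state B \<beta>"
  shows "F_S (x ^ Suc i * y ^ j)
    = of_nat i * covariance (lin_fun B \<alpha>) (lin_fun B \<alpha>) * F_S (x ^ (i - 1) * y ^ j)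
    + of_nat j * covariance (lin_fun B \<alpha>) (lin_fun B \<beta>) * F_S (x ^ i * y ^ (j - 1))"
proof -
  define w where "w = x ^ i * y ^ j"
  have w: "w \<in> heis_on B"
    using B by (auto simp: w_def x_def y_def intro!: heis_on_mult heis_on_power lin_state_heis_on)
  have dw: "heis_deriv b w = heis_scale (of_nat i * \<alpha> b) (x ^ (i - 1) * y ^ j)
      + heis_scale (of_nat j * \<beta> b) (x ^ i * y ^ (j - 1))" if "b \<in> B" for b
  proof -
    have "heis_deriv b x = Poly_Mapping.single {#} (\<alpha> b)" "heis_deriv b y
        = Poly_Mapping.single {#} (\<beta> b)"
      using B that by (simp_all add: x_def y_def heis_deriv_lin_state)
    then show ?thesis
      unfolding w_def heis_deriv_mult heis_deriv_power heis_scale_of_nat_mult by (simp only: mult_ac)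
  qed
  have "x ^ Suc i * y ^ j = (\<Sum>n\<in>B. heis_scale (\<alpha> n) (Poly_Mapping.single {#n#} 1 * w))"
  proof -
    have "Poly_Mapping.single {#n#} (\<alpha> n)
        = Poly_Mapping.single {#} (\<alpha> n) * Poly_Mapping.single {#n#} 1" for n
      by (simp add: mult_single)
    then have "x = (\<Sum>n\<in>B. Poly_Mapping.single {#} (\<alpha> n) * Poly_Mapping.single {#n#} 1)"
      by (simp only: x_def lin_state_def)
    moreover have "x ^ Suc i * y ^ j = x * w" by (simp add: w_def mult.assoc)
    ultimately show ?thesis
      by (simp only: heis_scale_def sum_distrib_right mult.assoc)
  qed
  then have "F_S (x ^ Suc i * y ^ j)
      = (\<Sum>n\<in>B. \<Sum>b\<in>B. fps_const (\<alpha> n) * mode_cov n b * F_S (heis_deriv b w))"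
    using B w by (simp add: F_S_sum F_S_scale F_S_wick sum_distrib_left mult.assoc)
  also have "\<dots> = (\<Sum>n\<in>B. \<Sum>b\<in>B.
        of_nat i * (fps_const (\<alpha> n * \<alpha> b) * mode_cov n b) * F_S (x ^ (i - 1) * y ^ j)
      + of_nat j * (fps_const (\<alpha> n * \<beta> b) * mode_cov n b) * F_S (x ^ i * y ^ (j - 1)))"
    by (intro sum.cong refl)
      (simp add: dw F_S_add F_S_scale algebra_simps fps_of_nat flip: fps_const_mult)
  also have "\<dots> = of_nat i * covariance (lin_fun B \<alpha>) (lin_fun B \<alpha>) * F_S (x ^ (i
      - 1) * y ^ j)
    + of_nat j * covariance (lin_fun B \<alpha>) (lin_fun B \<beta>) * F_S (x ^ i * y ^ (j - 1))"
    by (simp add: covariance_lin_fun sum.distrib sum_distrib_left sum_distrib_right)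
  finally show ?thesis .
qed

text \<open>The double factorial (2a-1)!!, the number of perfect matchings of 2a points.\<close>

definition odd_prod :: "nat \<Rightarrow> int" where
  "odd_prod a = (\<Prod>i<a. 2 * int i + 1)"

lemma odd_odd_prod: "odd (odd_prod a)"
  by (induction a) (auto simp: odd_prod_def)

lemma F_S_one: "F_S 1 = 1"
  using F_S_single[of "{#}" 1] by (simp flip: single_one)

text \<open>Raising an even exponent \<open>2 * a\<close> by 2 adds one contraction, with
  \<open>2 * a + 1\<close> possible partners; mixed contractions vanish by orthogonality.\<close>

lemma F_S_moments:
  assumes B: "finite B" "0 \<notin> B"
    and orth: "covariance (lin_fun B \<alpha>) (lin_fun B \<beta>) = 0"
  shows "F_S (lin_state B \<alpha> ^ (2 * a) * lin_state B \<beta> ^ (2 * b))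
    = of_int (odd_prod a * odd_prod b) * covariance (lin_fun B \<alpha>) (lin_fun B \<alpha>) ^ a
        * covariance (lin_fun B \<beta>) (lin_fun B \<beta>) ^ b"
proof (induction a)
  case 0
  show ?case
  proof (induction b)
    case (Suc b)
    then show ?case
      using F_S_lin_state_mult[OF B, of \<beta> "2 * b + 1" \<alpha> 0]
      by (simp add: odd_prod_def algebra_simps)
  qed (simp add: odd_prod_def F_S_one)
next
  case (Suc a)
  then show ?case
    using F_S_lin_state_mult[OF B, of \<alpha> "2 * a + 1" \<beta> "2 * b"] orth
    by (simp add: odd_prod_def algebra_simps)
qed

section \<open>Liouville's identity\<close>

definition quads :: "nat \<Rightarrow> (nat \<times> nat \<times> nat \<times> nat) set" where
  "quads n = {(a, b, x, y). 0 < a \<and> 0 < b \<and> 0 < x \<and> 0 < y \<and> a * x + b * y = n}"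

lemma finite_quads [simp]: "finite (quads n)"
proof (rule finite_subset)
  show "quads n \<subseteq> {..n} \<times> {..n} \<times> {..n} \<times> {..n}"
  proof
    fix z assume "z \<in> quads n"
    then obtain a b x y where z: "z = (a, b, x, y)" "0 < a" "0 < b" "0 < x" "0 < y" "a * x + b * y = n"
      by (auto simp: quads_def)
    have "a \<le> a * x" "x \<le> a * x" "b \<le> b * y" "y \<le> b * y" using z by simp_all
    then have "a \<le> n" "x \<le> n" "b \<le> n" "y \<le> n" using z(6) by linarith+
    then show "z \<in> {..n} \<times> {..n} \<times> {..n} \<times> {..n}" using z by simp
  qed
qed simp

definition quad_sum :: "nat \<Rightarrow> (nat \<Rightarrow> nat \<Rightarrow> nat \<Rightarrow> nat
    \<Rightarrow> bool) \<Rightarrow> (nat \<Rightarrow> nat \<Rightarrow> 'a) \<Rightarrow> 'a ::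
        comm_ring_1" where
  "quad_sum n P g = (\<Sum>(a, b, x, y) \<in> {(a, b, x, y) \<in> quads n. P a b x y}. g a b)"

lemma quad_sum_swap: "quad_sum n P g = quad_sum n (\<lambda>a b x y. P b a y x) (\<lambda>a b. g b a)"
  unfolding quad_sum_def
  by (rule sum.reindex_bij_witness[where i = "\<lambda>(a, b, x, y). (b, a, y, x)" and j
      = "\<lambda>(a, b, x, y). (b, a, y, x)"])
    (auto simp: quads_def add.commute)

text \<open>The substitution preserves the constraint because (a + b) x + b (y - x) = a x + b
  y.\<close>

lemma quad_sum_shear:
  "quad_sum n (\<lambda>a b x y. b < a) g = quad_sum n (\<lambda>a b x y. x < y) (\<lambda>a b. g (a
      + b) b)"
  unfolding quad_sum_def
proof (rule sum.reindex_bij_witness[where i = "\<lambda>(a, b, x, y). (a + b, b, x, y - x)"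
        and j = "\<lambda>(a, b, x, y). (a - b, b, x, x + y)"])
  fix z assume "z \<in> {(a, b, x, y) \<in> quads n. b < a}"
  then obtain a b x y where z: "z = (a, b, x, y)" "(a, b, x, y) \<in> quads n" "b < a" by auto
  obtain c where c: "a = b + c" "c > 0" using z(3) less_imp_add_positive by blast
  show "(case z of (a, b, x, y) \<Rightarrow> (a - b, b, x, x
      + y)) \<in> {(a, b, x, y) \<in> quads n. x < y}"
    using z(2) c unfolding z(1) by (simp add: quads_def algebra_simps)
qed (auto simp: quads_def algebra_simps diff_mult_distrib2 elim!: less_imp_add_positive)

lemma quad_sum_if:
  "quad_sum n P g = (\<Sum>(a, b, x, y) \<in> quads n. if P a b x y then g a b else 0)"
  unfolding quad_sum_def by (rule sum.mono_neutral_cong_left) (auto split: if_splits)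

lemma quad_sum_trichotomy:
  fixes u v :: "nat \<Rightarrow> nat \<Rightarrow> nat \<Rightarrow> nat \<Rightarrow> nat"
  shows "quad_sum n (\<lambda>a b x y. True) g = quad_sum n (\<lambda>a b x y. u a b x y < v a b x y) g
    + quad_sum n (\<lambda>a b x y. v a b x y < u a b x y) g
        + quad_sum n (\<lambda>a b x y. u a b x y = v a b x y) g"
  unfolding quad_sum_if sum.distrib[symmetric] by (rule sum.cong) auto

lemma quad_sum_cong:
  "(\<And>a b x y. (a, b, x, y) \<in> quads n \<Longrightarrow> P a b x y \<Longrightarrow> g a b
      = h a b) \<Longrightarrow> quad_sum n P g = quad_sum n P h"
  unfolding quad_sum_def by (rule sum.cong) auto

text \<open>On this diagonal n = d (x + y), which leaves n/d - 1 choices of x. The next lemma treats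
  the other diagonal, where n = (a + b) x.\<close>

lemma quad_sum_eq_ab:
  assumes "n > 0"
  shows "quad_sum n (\<lambda>a b x y. a = b) g = (\<Sum>d | d dvd n. (of_nat (n div d) - 1) * g d d)"
proof -
  have "quad_sum n (\<lambda>a b x y. a = b) g
      = (\<Sum>(d, x) \<in> Sigma {d. d dvd n} (\<lambda>d. {1..<n div d}). g d d)"
    unfolding quad_sum_def
  proof (rule sum.reindex_bij_witness[where i = "\<lambda>(d, x). (d, d, x, n div d - x)" and j
      = "\<lambda>(a, b, x, y). (a, x)"])
    fix z assume z: "z \<in> {(a, b, x, y) \<in> quads n. a = b}"
    then obtain a x y where z': "z = (a, a, x, y)" "a > 0" "x > 0" "y > 0" "n = a * (x + y)"
      by (auto simp: quads_def algebra_simps)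
    then have d: "n div a = x + y" by simp
    show "(case case z of (a, b, x, y) \<Rightarrow> (a, x) of (d, x) \<Rightarrow> (d, d, x, n div
        d - x)) = z"
      using z' d by simp
    show "(case z of (a, b, x, y) \<Rightarrow> (a, x)) \<in> Sigma {d. d dvd n} (\<lambda>d. {1..<n
        div d})"
      using z' d by simp
    show "(case case z of (a, b, x, y) \<Rightarrow> (a, x) of (d, x) \<Rightarrow> g d d)
        = (case z of (a, b, x, y) \<Rightarrow> g a b)"
      using z' by simp
  next
    fix z assume z: "z \<in> Sigma {d. d dvd n} (\<lambda>d. {1..<n div d})"
    then obtain d x where z': "z = (d, x)" "d dvd n" "0 < x" "x < n div d" by auto
    have "d > 0" using z' assms by (auto intro: dvd_pos_nat)
    moreover have "d * x + d * (n div d - x) = n"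
      using z' by (simp flip: distrib_left)
    ultimately show "(case z of (d, x) \<Rightarrow> (d, d, x, n div d - x)) \<in> {(a, b, x, y)
        \<in> quads n. a = b}"
      using z' by (simp add: quads_def)
    show "(case case z of (d, x) \<Rightarrow> (d, d, x, n div d - x) of (a, b, x, y) \<Rightarrow>
        (a, x)) = z"
      using z' by simp
  qed
  also have "\<dots> = (\<Sum>d | d dvd n. \<Sum>x=1..<n div d. g d d)"
    using assms by (subst sum.Sigma) auto
  also have "\<dots> = (\<Sum>d | d dvd n. (of_nat (n div d) - 1) * g d d)"
  proof (rule sum.cong[OF refl])
    fix d assume "d \<in> {d. d dvd n}"
    then have "n div d \<ge> 1" using assms
        by (auto simp: Suc_le_eq div_greater_zero_iff dvd_imp_le intro: dvd_pos_nat)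
    then show "(\<Sum>x=1..<n div d. g d d) = (of_nat (n div d) - 1) * g d d"
      by (simp add: of_nat_diff)
  qed
  finally show ?thesis .
qed

lemma quad_sum_eq_xy:
  assumes "n > 0"
  shows "quad_sum n (\<lambda>a b x y. x = y) g = (\<Sum>e | e dvd n. \<Sum>a=1..<e. g a (e - a))"
proof -
  have "quad_sum n (\<lambda>a b x y. x = y) g
      = (\<Sum>(e, a) \<in> Sigma {e. e dvd n} (\<lambda>e. {1..<e}). g a (e - a))"
    unfolding quad_sum_def
  proof (rule sum.reindex_bij_witness[where i
      = "\<lambda>(e, a). (a, e - a, n div e, n div e)" and j = "\<lambda>(a, b, x, y). (a + b, a)"])
    fix z assume z: "z \<in> {(a, b, x, y) \<in> quads n. x = y}"
    then obtain a b x where z': "z = (a, b, x, x)" "a > 0" "b > 0" "x > 0" "n = (a + b) * x"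
      by (auto simp: quads_def algebra_simps)
    then have d: "n div (a + b) = x" by simp
    show "(case case z of (a, b, x, y) \<Rightarrow> (a
        + b, a) of (e, a) \<Rightarrow> (a, e - a, n div e, n div e)) = z"
      using z' d by simp
    show "(case z of (a, b, x, y) \<Rightarrow> (a
        + b, a)) \<in> Sigma {e. e dvd n} (\<lambda>e. {1..<e})"
      using z' d by simp
    show "(case case z of (a, b, x, y) \<Rightarrow> (a + b, a) of (e, a) \<Rightarrow> g a (e - a))
        = (case z of (a, b, x, y) \<Rightarrow> g a b)"
      using z' by simp
  next
    fix z assume z: "z \<in> Sigma {e. e dvd n} (\<lambda>e. {1..<e})"
    then obtain e a where z': "z = (e, a)" "e dvd n" "0 < a" "a < e" by auto
    have "n div e > 0" using z' assms by (simp add: div_greater_zero_iff dvd_imp_le)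
    moreover have "a * (n div e) + (e - a) * (n div e) = n"
      using z' by (simp flip: distrib_right)
    ultimately show "(case z of (e, a) \<Rightarrow> (a, e - a, n div e, n div e)) \<in> {(a, b, x,
        y) \<in> quads n. x = y}"
      using z' by (simp add: quads_def)
    show "(case case z of (e, a) \<Rightarrow> (a, e - a, n div e, n div e) of (a, b, x, y)
        \<Rightarrow> (a + b, a)) = z"
      using z' by simp
  qed
  also have "\<dots> = (\<Sum>e | e dvd n. \<Sum>a=1..<e. g a (e - a))"
    using assms by (subst sum.Sigma) auto
  finally show ?thesis .
qed

text \<open>Both sides are compared by means of the bijection \<open>(a, b, x, y) \<mapsto> (a
    + b, b, x, y - x)\<close> from
  the quadruples with \<open>x < y\<close> to those with \<open>b < a\<close>.\<close>

lemma liouville_identity: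
  fixes F :: "int \<Rightarrow> 'a :: comm_ring_1"
  assumes even: "\<And>z. F (- z) = F z" and n: "n > 0"
  shows "(\<Sum>(a, b, x, y) \<in> quads n. F (int a - int b) - F (int a + int b))
    = (\<Sum>d | d dvd n. (of_nat (n div d) - 1) * (F 0 + 2 * F (int d)))
      - (\<Sum>e | e dvd n. (of_nat e - 1) * F (int e) + 2 * (\<Sum>a=1..<e. F (int a)))"
proof -
  let ?A = "\<lambda>a b x y :: nat. b < a" and ?A' = "\<lambda>a b x y :: nat. a < b" and ?X
      = "\<lambda>a b x y :: nat. x < y"
    and ?X' = "\<lambda>a b x y :: nat. y < x"
  let ?f = "\<lambda>a b :: nat. F (int a)"
  have sym: "F (int b - int a) = F (int a - int b)" for a b using even[of "int a - int b"] by simp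
  have a: "quad_sum n ?X (\<lambda>a b. F (int a + int b)) = quad_sum n ?A ?f"
    by (subst quad_sum_shear) simp
  have b: "quad_sum n ?A (\<lambda>a b. F (int a - int b)) = quad_sum n ?X ?f"
    by (subst quad_sum_shear) simp
  have c: "quad_sum n ?X' (\<lambda>a b. F (int a + int b)) = quad_sum n ?A ?f"
    by (subst quad_sum_swap) (simp add: a[symmetric] add.commute)
  have d: "quad_sum n ?A' (\<lambda>a b. F (int a - int b)) = quad_sum n ?X ?f"
    by (subst quad_sum_swap) (simp add: b[symmetric] sym)
  \<comment> \<open>The shear leaves \<open>b\<close> fixed, so after exchanging the two pairs it
    matches the sums of F(a) over these two regions.\<close>
  have e: "quad_sum n ?X' ?f = quad_sum n ?A' ?f"
    by (subst quad_sum_swap, subst (2) quad_sum_swap, subst quad_sum_shear) simp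
  have f: "quad_sum n (\<lambda>a b x y. a = b) (\<lambda>a b. F (int a - int b))
      = quad_sum n (\<lambda>a b x y. a = b) (\<lambda>a b. F 0)"
    by (rule quad_sum_cong) simp
  have eq1: "(\<Sum>(a, b, x, y) \<in> quads n. F (int a - int b) - F (int a + int b))
      = quad_sum n (\<lambda>a b x y. True) (\<lambda>a b. F (int a - int b)) - quad_sum n
          (\<lambda>a b x y. True) (\<lambda>a b. F (int a + int b))"
    by (simp add: quad_sum_def case_prod_unfold sum_subtractf)
  have eq2: "quad_sum n (\<lambda>a b x y. True) (\<lambda>a b. F (int a - int b))
      = 2 * quad_sum n ?X ?f + quad_sum n (\<lambda>a b x y. a = b) (\<lambda>a b. F 0)"
    by (subst quad_sum_trichotomy[where u = "\<lambda>a b x y. b" and v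
        = "\<lambda>a b x y. a"]) (simp add: b d f[symmetric] eq_commute)
  have eq3: "quad_sum n (\<lambda>a b x y. True) (\<lambda>a b. F (int a + int b))
      = 2 * quad_sum n ?A ?f + quad_sum n (\<lambda>a b x y. x = y) (\<lambda>a b. F (int a + int b))"
    by (subst quad_sum_trichotomy[where u = "\<lambda>a b x y. x" and v
        = "\<lambda>a b x y. y"]) (simp add: a c)
  have 1: "(\<Sum>(a, b, x, y) \<in> quads n. F (int a - int b) - F (int a + int b))
     = 2 * (quad_sum n ?X ?f - quad_sum n ?A ?f) + quad_sum n (\<lambda>a b x y. a
         = b) (\<lambda>a b. F 0)
       - quad_sum n (\<lambda>a b x y. x = y) (\<lambda>a b. F (int a + int b))"
    unfolding eq1 eq2 eq3 by (simp add: algebra_simps)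
  \<comment> \<open>The same total is split by comparing x with y and by comparing a with b; the
    parts identified in \<open>e\<close> cancel, leaving only diagonals.\<close>
  have 2: "quad_sum n ?X ?f - quad_sum n ?A ?f
      = quad_sum n (\<lambda>a b x y. a = b) ?f - quad_sum n (\<lambda>a b x y. x = y) ?f"
    using quad_sum_trichotomy[where u = "\<lambda>a b x y. x" and v = "\<lambda>a b x y. y", of n ?f]
      quad_sum_trichotomy[where u = "\<lambda>a b x y. a" and v = "\<lambda>a b x y. b", of n ?f]
    by (simp add: e algebra_simps)
  have 3: "(\<Sum>a=1..<e. F (int a + int (e - a))) = (of_nat e - 1) * F (int e)" if "e dvd n" for e
  proof -
    have "e \<ge> 1" using that n by (auto simp: Suc_le_eq intro: dvd_pos_nat)
    moreover have "(\<Sum>a=1..<e. F (int a + int (e - a))) = (\<Sum>a=1..<e. F (int e))"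
      by (rule sum.cong) (auto simp flip: of_nat_add)
    ultimately show ?thesis by (simp add: of_nat_diff)
  qed
  then have 4: "(\<Sum>e | e dvd n. \<Sum>a=1..<e. F (int a + int (e - a)))
      = (\<Sum>e | e dvd n. (of_nat e - 1) * F (int e))"
    by (intro sum.cong refl) blast
  show ?thesis
    unfolding 1 2 quad_sum_eq_ab[OF n] quad_sum_eq_xy[OF n] 4 distrib_left sum.distrib
        sum_distrib_left[symmetric]
    by (simp add: algebra_simps sum.distrib sum_subtractf sum_distrib_left)
qed

section \<open>Divisor series and Liouville's identity for even powers\<close>

definition divisor_series :: "(nat \<Rightarrow> 'a) \<Rightarrow> 'a :: comm_ring_1 fps" where
  "divisor_series g = Abs_fps (\<lambda>n. if n = 0 then 0 else \<Sum>d | d dvd n. g d)"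

lemma divisor_series_nth: "n > 0 \<Longrightarrow> fps_nth (divisor_series g) n
    = (\<Sum>d | d dvd n. g d)" and divisor_series_nth_0 [simp]: "fps_nth (divisor_series g) 0 = 0"
  by (simp_all add: divisor_series_def)

text \<open>In a product of total degree n the degrees are i = a x and n - i = b y with divisors a
  and b, which is precisely a quadruple.\<close>

lemma divisor_series_mult_nth: "fps_nth (divisor_series f * divisor_series g) n
    = (\<Sum>(a, b, x, y) \<in> quads n. f a * g b)"
proof -
  have "fps_nth (divisor_series f * divisor_series g) n
      = (\<Sum>i\<in>{1..<n}. fps_nth (divisor_series f) i * fps_nth (divisor_series g) (n - i))"
    unfolding fps_mult_nth by (rule sum.mono_neutral_right) (auto simp: Suc_le_eq not_less)
  also have "\<dots> = (\<Sum>i\<in>{1..<n}. \<Sum>(a, b) \<in> {a. a dvd i} \<times> {b. b dvd n -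
      i}. f a * g b)"
    by (rule sum.cong) (auto simp: divisor_series_nth sum_product sum.cartesian_product)
  also have "\<dots> = (\<Sum>(i, a, b) \<in> Sigma {1..<n} (\<lambda>i. {a. a dvd i} \<times> {b. b
      dvd n - i}). f a * g b)"
    by (subst sum.Sigma) (auto simp: case_prod_unfold)
  also have "\<dots> = (\<Sum>(a, b, x, y) \<in> quads n. f a * g b)"
  proof (rule sum.reindex_bij_witness[where j
      = "\<lambda>(i, a, b). (a, b, i div a, (n - i) div b)" and i
          = "\<lambda>(a, b, x, y). (a * x, a, b)"])
    fix z assume "z \<in> Sigma {1..<n} (\<lambda>i. {a. a dvd i} \<times> {b. b dvd n - i})"
    then obtain i a b where z: "z = (i, a, b)" "0 < i" "i < n" "a dvd i" "b dvd n - i" by auto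
    then have "a > 0" "b > 0" using dvd_pos_nat[of i a] dvd_pos_nat[of "n - i" b] by auto
    moreover have "i div a > 0" "(n - i) div b > 0"
      using z calculation by (simp_all add: div_greater_zero_iff dvd_imp_le)
    ultimately show "(case z of (i, a, b) \<Rightarrow> (a, b, i div a, (n - i) div b)) \<in> quads n"
      using z by (simp add: quads_def)
    show "(case case z of (i, a, b) \<Rightarrow> (a, b, i div a, (n - i) div b) of (a, b, x, y)
        \<Rightarrow> (a * x, a, b)) = z"
      using z by simp
    show "(case case z of (i, a, b) \<Rightarrow> (a, b, i div a, (n - i) div b) of (a, b, x, y)
        \<Rightarrow> f a * g b)
        = (case z of (i, a, b) \<Rightarrow> f a * g b)"
      using z by simp
  next
    fix z assume "z \<in> quads n"
    then obtain a b x y where z: "z = (a, b, x, y)" "0 < a" "0 < b" "0 < x" "0 < y" "n = a * x + b * y"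
      by (auto simp: quads_def)
    then show "(case case z of (a, b, x, y) \<Rightarrow> (a * x, a, b) of (i, a, b) \<Rightarrow>
        (a, b, i div a, (n - i) div b)) = z"
      by simp
    show "(case z of (a, b, x, y) \<Rightarrow> (a * x, a, b)) \<in> Sigma {1..<n} (\<lambda>i. {a.
        a dvd i} \<times> {b. b dvd n - i})"
      using z by simp
  qed
  finally show ?thesis .
qed

definition qderiv :: "'a :: comm_ring_1 fps \<Rightarrow> 'a fps" where
  "qderiv f = fps_X * fps_deriv f"

lemma qderiv_nth: "fps_nth (qderiv f) n = of_nat n * fps_nth f n"
  by (cases n) (simp_all add: qderiv_def)

text \<open>Used with the signs 1 and -1; the alternating version singles out even divisors and so
  brings in series in q^2.\<close>

definition sgn_pow :: "'a \<Rightarrow> nat \<Rightarrow> nat \<Rightarrow> 'a :: comm_ring_1" where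
  "sgn_pow \<epsilon> k d = \<epsilon> ^ d * of_nat d ^ k"

text \<open>Apply the identity to an even power times a sign raised to the absolute value; a - b and
  a + b have equal parity, so the sign factors out. The factor \<open>n div d\<close> absorbs one
  power of d and becomes \<open>n\<close>, which later gives a derivative. The function
  \<open>h\<close> is a parameter so that the difference of powers can be supplied in expanded
  form.\<close>

lemma liouville_power:
  fixes \<epsilon> :: "'a :: comm_ring_1"
  assumes \<epsilon>: "\<epsilon> * \<epsilon> = 1" and k: "k > 0"
    and h: "\<And>a b. h a b = (of_int (int a - int b) ^ (2 * k) - of_int (int a
        + int b) ^ (2 * k) :: 'a)"
  shows "n > 0 \<Longrightarrow> (\<Sum>(a, b, x, y) \<in> quads n. \<epsilon> ^ (a + b) * h a b)
    = 2 * of_nat n * (\<Sum>d | d dvd n. sgn_pow \<epsilon> (2 * k - 1) d) - (\<Sum>d | d dvd n.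
        sgn_pow \<epsilon> (2 * k) d)
      - (\<Sum>d | d dvd n. sgn_pow \<epsilon> (2 * k
          + 1) d) - 2 * (\<Sum>d | d dvd n. \<Sum>a=1..<d. sgn_pow \<epsilon> (2 * k) a)"
proof -
  assume n: "n > 0"
  define F :: "int \<Rightarrow> 'a" where "F z
      = \<epsilon> ^ nat \<bar>z\<bar> * of_int z ^ (2 * k)" for z
  have F: "F (int d) = sgn_pow \<epsilon> (2 * k) d" for d by (simp add: F_def sgn_pow_def)
  have F0: "F 0 = 0" using k by (simp add: F_def power_0_left)
  have Fm: "F (- z) = F z" for z by (simp add: F_def)
  have pow: "\<epsilon> ^ (2 * m) = 1" for m using \<epsilon> by (simp add: power_mult power2_eq_square)
  have "\<epsilon> ^ nat \<bar>int a - int b\<bar> = \<epsilon> ^ (a + b)" for a b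
  proof (cases "a \<ge> b")
    case True
    then have "a + b = nat \<bar>int a - int b\<bar> + 2 * b" by auto
    then show ?thesis by (simp only: power_add pow mult_1_right)
  next
    case False
    then have "a + b = nat \<bar>int a - int b\<bar> + 2 * a" by auto
    then show ?thesis by (simp only: power_add pow mult_1_right)
  qed
  moreover have "nat \<bar>int a + int b\<bar> = a + b" for a b by simp
  ultimately have "F (int a - int b) - F (int a + int b) = \<epsilon> ^ (a + b) * h a b" for a b
    unfolding F_def h by (simp only: right_diff_distrib)
  then have 1: "(\<Sum>(a, b, x, y) \<in> quads n. \<epsilon> ^ (a + b) * h a b)
    = (\<Sum>d | d dvd n. (of_nat (n div d) - 1) * (2 * sgn_pow \<epsilon> (2 * k) d))
      - (\<Sum>e | e dvd n. (of_nat e - 1) * sgn_pow \<epsilon> (2 * k) e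
          + 2 * (\<Sum>a=1..<e. sgn_pow \<epsilon> (2 * k) a))"
    using liouville_identity[of F n, OF Fm n] by (simp add: F F0)
  have 2: "(\<Sum>d | d dvd n. (of_nat (n div d) - 1) * (2 * sgn_pow \<epsilon> (2 * k) d))
      = (\<Sum>d | d dvd n. 2 * of_nat n * sgn_pow \<epsilon> (2 * k - 1) d - 2 * sgn_pow \<epsilon>
          (2 * k) d)"
  proof (rule sum.cong[OF refl])
    fix d assume "d \<in> {d. d dvd n}"
    then have "of_nat (n div d) * of_nat d = (of_nat n :: 'a)" by (simp flip: of_nat_mult)
    moreover have "sgn_pow \<epsilon> (2 * k) d = of_nat d * sgn_pow \<epsilon> (2 * k - 1) d"
      using k by (cases k) (simp_all add: sgn_pow_def mult_ac)
    ultimately have "of_nat (n div d) * sgn_pow \<epsilon> (2 * k) d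
        = of_nat n * sgn_pow \<epsilon> (2 * k - 1) d"
      by (metis mult.assoc)
    then show "(of_nat (n div d) - 1) * (2 * sgn_pow \<epsilon> (2 * k) d)
        = 2 * of_nat n * sgn_pow \<epsilon> (2 * k - 1) d - 2 * sgn_pow \<epsilon> (2 * k) d"
      by (simp add: algebra_simps)
  qed
  have 3: "(\<Sum>e | e dvd n. (of_nat e - 1) * sgn_pow \<epsilon> (2 * k) e
      + 2 * (\<Sum>a=1..<e. sgn_pow \<epsilon> (2 * k) a))
     = (\<Sum>d | d dvd n. sgn_pow \<epsilon> (2 * k
         + 1) d) - (\<Sum>d | d dvd n. sgn_pow \<epsilon> (2 * k) d)
       + 2 * (\<Sum>d | d dvd n. \<Sum>a=1..<d. sgn_pow \<epsilon> (2 * k) a)"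
    by (simp add: sum.distrib sum_subtractf sum_distrib_left sgn_pow_def algebra_simps)
  show ?thesis
    unfolding 1 2 3 by (simp add: sum_subtractf sum_distrib_left[symmetric] mult.assoc)
qed

definition sigma_series :: "'a \<Rightarrow> nat \<Rightarrow> 'a :: comm_ring_1 fps" where
  "sigma_series \<epsilon> k = divisor_series (sgn_pow \<epsilon> k)"

text \<open>Here (a - b)^2 - (a + b)^2 = - 4 a b separates the variables, so the sum over quadruples
  is a product of divisor series.\<close>

lemma liouville_series_2:
  fixes \<epsilon> :: "'a :: comm_ring_1"
  assumes \<epsilon>: "\<epsilon> * \<epsilon> = 1"
  shows "- 4 * sigma_series \<epsilon> 1 ^ 2
      = 2 * qderiv (sigma_series \<epsilon> 1) - sigma_series \<epsilon> 2 - sigma_series \<epsilon> 3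
     - 2 * divisor_series (\<lambda>d. \<Sum>a=1..<d. sgn_pow \<epsilon> 2 a)"
proof (rule fps_ext)
  fix n
  show "fps_nth (- 4 * sigma_series \<epsilon> 1 ^ 2) n
      = fps_nth (2 * qderiv (sigma_series \<epsilon> 1) - sigma_series \<epsilon> 2 - sigma_series
          \<epsilon> 3
     - 2 * divisor_series (\<lambda>d. \<Sum>a=1..<d. sgn_pow \<epsilon> 2 a)) n"
  proof (cases "n = 0")
    case False
    have "fps_nth (- 4 * sigma_series \<epsilon> 1 ^ 2) n
        = (\<Sum>(a, b, x, y) \<in> quads n. \<epsilon> ^ (a + b) * (- 4 * of_nat a * of_nat b))"
    proof -
      have "fps_nth (- 4 * sigma_series \<epsilon> 1 ^ 2) n
          = - 4 * fps_nth (sigma_series \<epsilon> 1 * sigma_series \<epsilon> 1) n"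
        by (simp add: numeral_fps_const power2_eq_square)
      then show ?thesis
        unfolding sigma_series_def divisor_series_mult_nth sum_distrib_left
        by (simp only:, intro sum.cong refl) (auto simp: sgn_pow_def power_add algebra_simps)
    qed
    also have "\<dots> = 2 * of_nat n * (\<Sum>d | d dvd n. sgn_pow \<epsilon> 1 d) - (\<Sum>d | d
        dvd n. sgn_pow \<epsilon> 2 d)
      - (\<Sum>d | d dvd n. sgn_pow \<epsilon> 3 d) - 2 * (\<Sum>d | d dvd n. \<Sum>a=1..<d. sgn_pow
          \<epsilon> 2 a)"
      using False
      by (subst liouville_power[OF \<epsilon>, where k = 1])
        (simp_all add: algebra_simps numeral_2_eq_2 numeral_3_eq_3)
    finally show ?thesis
      using False by (simp add: sigma_series_def divisor_series_nth qderiv_nth numeral_fps_const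
          mult.assoc)
  qed (simp add: sigma_series_def qderiv_nth numeral_fps_const power2_eq_square)
qed

text \<open>Here (a - b)^4 - (a + b)^4 = - 8 (a b^3 + a^3 b); the two terms give the same product of
  series, hence the factor 16.\<close>

lemma liouville_series_4:
  fixes \<epsilon> :: "'a :: comm_ring_1"
  assumes \<epsilon>: "\<epsilon> * \<epsilon> = 1"
  shows "- 16 * (sigma_series \<epsilon> 1 * sigma_series \<epsilon> 3)
      = 2 * qderiv (sigma_series \<epsilon> 3) - sigma_series \<epsilon> 4 - sigma_series \<epsilon> 5
     - 2 * divisor_series (\<lambda>d. \<Sum>a=1..<d. sgn_pow \<epsilon> 4 a)"
proof (rule fps_ext)
  fix n
  show "fps_nth (- 16 * (sigma_series \<epsilon> 1 * sigma_series \<epsilon> 3)) n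
      = fps_nth (2 * qderiv (sigma_series \<epsilon> 3) - sigma_series \<epsilon> 4 - sigma_series
          \<epsilon> 5
     - 2 * divisor_series (\<lambda>d. \<Sum>a=1..<d. sgn_pow \<epsilon> 4 a)) n"
  proof (cases "n = 0")
    case False
    have "fps_nth (- 16 * (sigma_series \<epsilon> 1 * sigma_series \<epsilon> 3)) n
        = - 8 * fps_nth (sigma_series \<epsilon> 1 * sigma_series \<epsilon> 3) n - 8 * fps_nth
            (sigma_series \<epsilon> 3 * sigma_series \<epsilon> 1) n"
      by (simp add: numeral_fps_const mult.commute[of "sigma_series \<epsilon> 3"])
    also have "\<dots> = (\<Sum>(a, b, x, y) \<in> quads n. \<epsilon> ^ (a
        + b) * (- 8 * (of_nat a * of_nat b ^ 3 + of_nat a ^ 3 * of_nat b)))"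
      unfolding sigma_series_def divisor_series_mult_nth sum_distrib_left sum_subtractf[symmetric]
      by (rule sum.cong) (auto simp: sgn_pow_def power_add algebra_simps)
    also have "\<dots> = 2 * of_nat n * (\<Sum>d | d dvd n. sgn_pow \<epsilon> 3 d) - (\<Sum>d | d
        dvd n. sgn_pow \<epsilon> 4 d)
      - (\<Sum>d | d dvd n. sgn_pow \<epsilon> 5 d) - 2 * (\<Sum>d | d dvd n. \<Sum>a=1..<d. sgn_pow
          \<epsilon> 4 a)"
      using False
      by (subst liouville_power[OF \<epsilon>, where k = 2])
        (simp_all add: algebra_simps power3_eq_cube power4_eq_xxxx)
    finally show ?thesis
      using False by (simp add: sigma_series_def divisor_series_nth qderiv_nth numeral_fps_const
          mult.assoc)
  qed (simp add: sigma_series_def qderiv_nth numeral_fps_const)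
qed

section \<open>Eisenstein series and the modular function of level 2\<close>

lemma fps_nth_compose_square:
  "fps_nth (fps_compose f (fps_X ^ 2)) n = (if even n then fps_nth f (n div 2) else 0)"
  for f :: "'a :: comm_ring_1 fps"
proof -
  have "fps_nth (fps_compose f (fps_X ^ 2)) n = (\<Sum>i=0..n. if n = 2 * i then fps_nth f i else 0)"
    by (simp add: fps_compose_nth fps_X_power_nth flip: power_mult) (rule sum.cong; simp)
  also have "\<dots> = (if even n then fps_nth f (n div 2) else 0)"
  proof (cases "even n")
    case True
    then have "(\<Sum>i=0..n. if n = 2 * i then fps_nth f i else 0) = (\<Sum>i=0..n. if i
        = n div 2 then fps_nth f i else 0)"
      by (intro sum.cong) auto
    then show ?thesis using True by (simp add: sum.delta)
  qed (auto intro!: sum.neutral)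
  finally show ?thesis .
qed

lemma qderiv_compose_square: "qderiv (fps_compose f (fps_X ^ 2))
    = 2 * fps_compose (qderiv f) (fps_X ^ 2)"
  for f :: "'a :: comm_ring_1 fps"
  by (rule fps_ext) (auto simp: qderiv_nth fps_nth_compose_square numeral_fps_const mult.assoc
      elim!: evenE)

lemma qderiv_add: "qderiv (f + g) = qderiv f + qderiv g"
  and qderiv_diff: "qderiv (f - g) = qderiv f - qderiv g"
  and qderiv_mult: "qderiv (f * g) = qderiv f * g + f * qderiv g"
  and qderiv_numeral: "qderiv (numeral k) = 0"
  and qderiv_1: "qderiv 1 = 0"
  by (simp_all add: qderiv_def algebra_simps)

text \<open>The sum of the twisted and untwisted terms is twice the contribution of the even
  divisors d = 2 c, where c runs over the divisors of n/2 and d^k contributes 2^k.\<close>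

lemma sigma_series_minus_one:
  assumes "k > 0"
  shows "(sigma_series (- 1) k :: 'a :: comm_ring_1 fps) = - sigma_series 1 k
      + 2 ^ Suc k * fps_compose (sigma_series 1 k) (fps_X ^ 2)"
proof (rule fps_ext)
  fix n
  show "fps_nth (sigma_series (- 1) k) n = fps_nth ((- sigma_series 1 k
      + 2 ^ Suc k * fps_compose (sigma_series 1 k) (fps_X ^ 2)) :: 'a fps) n"
  proof (cases "n = 0")
    case False
    have fin: "finite {d. d dvd n}" using False by simp
    have "fps_nth (sigma_series (- 1) k) n + fps_nth (sigma_series 1 k) n
        = (\<Sum>d | d dvd n. if even d then 2 * of_nat d ^ k else (0 :: 'a))"
      using False by (simp add: sigma_series_def divisor_series_nth flip: sum.distrib)
        (rule sum.cong, auto simp: sgn_pow_def)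
    also have "\<dots> = (\<Sum>d | d dvd n \<and> even d. 2 * of_nat d ^ k)"
      using sum.inter_filter[OF fin, of "\<lambda>d. 2 * of_nat d ^ k :: 'a" even] by simp
    also have "\<dots> = (if even n then \<Sum>c | c dvd n div 2. 2 * of_nat (2 * c) ^ k else 0)"
    proof (cases "even n")
      case True
      then obtain m where m: "n = 2 * m" by blast
      have "(\<Sum>d | d dvd n \<and> even d. 2 * of_nat d ^ k :: 'a)
          = (\<Sum>c | c dvd m. 2 * of_nat (2 * c) ^ k)"
        by (rule sum.reindex_bij_witness[where i = "\<lambda>c. 2 * c" and j = "\<lambda>d. d div 2"])
          (auto simp: m elim!: evenE)
      then show ?thesis using m by simp
    next
      case False
      then have "{d. d dvd n \<and> even d} = {}" using dvd_trans by blast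
      then show ?thesis using False by (simp only: sum.empty if_False)
    qed
    also have "\<dots> = fps_nth (2 ^ Suc k * fps_compose (sigma_series 1 k) (fps_X ^ 2)) n"
    proof -
      have c: "(2 ^ Suc k :: 'a fps) = fps_const (2 ^ Suc k)"
        by (simp only: numeral_fps_const fps_const_power)
      have "n div 2 > 0" if "even n" using that False by (auto elim!: evenE)
      then show ?thesis
        unfolding c
        by (simp add: fps_nth_compose_square sigma_series_def divisor_series_nth sgn_pow_def
            sum_distrib_left mult.assoc power_mult_distrib)
    qed
    finally show ?thesis by (simp add: algebra_simps)
  qed (simp add: sigma_series_def fps_nth_compose_square)
qed

lemma divisor_series_add: "divisor_series (\<lambda>d. f d + g d) = divisor_series f + divisor_series g"
  and divisor_series_diff: "divisor_series (\<lambda>d. f d - g d)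
      = divisor_series f - divisor_series g"
  and divisor_series_scale: "divisor_series (\<lambda>d. c * f d) = fps_const c * divisor_series f"
  by (rule fps_ext, simp add: divisor_series_def sum.distrib sum_subtractf sum_distrib_left)+

lemma sum_Suc_lessThan_Suc: "(\<Sum>a=1..<Suc d. f a) = (\<Sum>a=1..<d. f a) + (if d
    = 0 then 0 else f d)"
  by (cases d) auto

text \<open>Faulhaber's formula for the inner power sum turns the double sum into divisor series,
  and its quadratic term cancels \<open>sigma_series 1 2\<close>, which belongs to no Eisenstein
  series of level 1.\<close>

lemma sigma1_square: "- 12 * (sigma_series 1 1 :: 'a :: field_char_0 fps) ^ 2
    = 6 * qderiv (sigma_series 1 1) - 5 * sigma_series 1 3 - sigma_series 1 1"
proof -
  have "(6 :: 'a) * (\<Sum>a=1..<d. sgn_pow 1 2 a) = 2 * sgn_pow 1 3 d - 3 * sgn_pow 1 2 d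
      + sgn_pow 1 1 d" for d :: nat
    by (induction d) (auto simp: sgn_pow_def sum_Suc_lessThan_Suc algebra_simps power2_eq_square
        power3_eq_cube)
  then have "divisor_series (\<lambda>d. 6 * (\<Sum>a=1..<d. sgn_pow 1 2 a))
      = (divisor_series (\<lambda>d. 2 * sgn_pow 1 3 d - 3 * sgn_pow 1 2 d + sgn_pow 1 1 d) :: 'a fps)"
    by (simp only:)
  then have h: "6 * divisor_series (\<lambda>d. \<Sum>a=1..<d. sgn_pow 1 2 a)
      = 2 * (sigma_series 1 3 :: 'a fps) - 3 * sigma_series 1 2 + sigma_series 1 1"
    unfolding divisor_series_add divisor_series_diff divisor_series_scale
        by (simp add: sigma_series_def numeral_fps_const)
  have "- 4 * (sigma_series 1 1 :: 'a fps) ^ 2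
      = 2 * qderiv (sigma_series 1 1) - sigma_series 1 2 - sigma_series 1 3 - 2 * divisor_series
          (\<lambda>d. \<Sum>a=1..<d. sgn_pow 1 2 a)"
    by (rule liouville_series_2) simp
  then show ?thesis using h by algebra
qed

lemma sigma1_sigma3: "- 240 * ((sigma_series 1 1 :: 'a :: field_char_0 fps) * sigma_series 1 3)
    = 30 * qderiv (sigma_series 1 3) - 21 * sigma_series 1 5 - 10 * sigma_series 1 3 + sigma_series 1 1"
proof -
  have "(30 :: 'a) * (\<Sum>a=1..<d. sgn_pow 1 4 a) = 6 * sgn_pow 1 5 d - 15 * sgn_pow 1 4 d
      + 10 * sgn_pow 1 3 d - sgn_pow 1 1 d" for d :: nat
    by (induction d) (auto simp: sgn_pow_def sum_Suc_lessThan_Suc algebra_simps power2_eq_square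
        eval_nat_numeral)
  then have "divisor_series (\<lambda>d. 30 * (\<Sum>a=1..<d. sgn_pow 1 4 a))
      = (divisor_series (\<lambda>d. 6 * sgn_pow 1 5 d - 15 * sgn_pow 1 4 d
          + 10 * sgn_pow 1 3 d - sgn_pow 1 1 d) :: 'a fps)"
    by (simp only:)
  then have h: "30 * divisor_series (\<lambda>d. \<Sum>a=1..<d. sgn_pow 1 4 a)
      = 6 * (sigma_series 1 5 :: 'a fps) - 15 * sigma_series 1 4
          + 10 * sigma_series 1 3 - sigma_series 1 1"
    unfolding divisor_series_add divisor_series_diff divisor_series_scale
        by (simp add: sigma_series_def numeral_fps_const)
  have "- 16 * ((sigma_series 1 1 :: 'a fps) * sigma_series 1 3)
      = 2 * qderiv (sigma_series 1 3) - sigma_series 1 4 - sigma_series 1 5 - 2 * divisor_series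
          (\<lambda>d. \<Sum>a=1..<d. sgn_pow 1 4 a)"
    by (rule liouville_series_4) simp
  then show ?thesis using h by algebra
qed

text \<open>The alternating power sums have lower degree than the ordinary ones, but their leading
  term again cancels the series with even exponent.\<close>

lemma twisted_sigma1_square: "- 4 * (sigma_series (- 1) 1 :: 'a :: field_char_0 fps) ^ 2
    = 2 * qderiv (sigma_series (- 1) 1) - sigma_series (- 1) 3 - sigma_series (- 1) 1"
proof -
  have "(2 :: 'a) * (\<Sum>a=1..<d. sgn_pow (- 1) 2 a) = sgn_pow (- 1) 1 d - sgn_pow (- 1) 2 d"
      for d :: nat
    by (induction d) (auto simp: sgn_pow_def sum_Suc_lessThan_Suc algebra_simps power2_eq_square)
  then have "divisor_series (\<lambda>d. 2 * (\<Sum>a=1..<d. sgn_pow (- 1) 2 a))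
      = (divisor_series (\<lambda>d. sgn_pow (- 1) 1 d - sgn_pow (- 1) 2 d) :: 'a fps)"
    by (simp only:)
  then have h: "2 * divisor_series (\<lambda>d. \<Sum>a=1..<d. sgn_pow (- 1) 2 a)
      = (sigma_series (- 1) 1 :: 'a fps) - sigma_series (- 1) 2"
    unfolding divisor_series_diff divisor_series_scale by (simp add: sigma_series_def numeral_fps_const)
  have "- 4 * (sigma_series (- 1) 1 :: 'a fps) ^ 2
      = 2 * qderiv (sigma_series (- 1) 1) - sigma_series (- 1) 2 - sigma_series (- 1) 3 - 2 *
          divisor_series (\<lambda>d. \<Sum>a=1..<d. sgn_pow (- 1) 2 a)"
    by (rule liouville_series_2) simp
  then show ?thesis unfolding h by (simp add: algebra_simps)
qed

lemma twisted_sigma1_sigma3: "- 16 * ((sigma_series (- 1) 1 :: 'a :: field_char_0 fps) *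
    sigma_series (- 1) 3)
        = 2 * qderiv (sigma_series (- 1) 3) - sigma_series (- 1) 5 - 2 * sigma_series (- 1) 3
            + sigma_series (- 1) 1"
proof -
  have "(2 :: 'a) * (\<Sum>a=1..<d. sgn_pow (- 1) 4 a)
      = 2 * sgn_pow (- 1) 3 d - sgn_pow (- 1) 4 d - sgn_pow (- 1) 1 d" for d :: nat
    by (induction d) (auto simp: sgn_pow_def sum_Suc_lessThan_Suc algebra_simps eval_nat_numeral)
  then have "divisor_series (\<lambda>d. 2 * (\<Sum>a=1..<d. sgn_pow (- 1) 4 a))
      = (divisor_series (\<lambda>d. 2 * sgn_pow (- 1) 3 d - sgn_pow (- 1) 4 d - sgn_pow (- 1) 1 d)
          :: 'a fps)"
    by (simp only:)
  then have h: "2 * divisor_series (\<lambda>d. \<Sum>a=1..<d. sgn_pow (- 1) 4 a)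
      = 2 * (sigma_series (- 1) 3 :: 'a fps) - sigma_series (- 1) 4 - sigma_series (- 1) 1"
    unfolding divisor_series_diff divisor_series_scale by (simp add: sigma_series_def numeral_fps_const)
  have "- 16 * ((sigma_series (- 1) 1 :: 'a fps) * sigma_series (- 1) 3)
      = 2 * qderiv (sigma_series (- 1) 3) - sigma_series (- 1) 4 - sigma_series (- 1) 5 - 2 *
          divisor_series (\<lambda>d. \<Sum>a=1..<d. sgn_pow (- 1) 4 a)"
    by (rule liouville_series_4) simp
  then show ?thesis unfolding h by (simp add: algebra_simps)
qed

definition Eis2 :: "Q2 fps" where "Eis2 = 1 - 24 * sigma_series 1 1"

abbreviation V2 :: "Q2 fps \<Rightarrow> Q2 fps" where "V2 f \<equiv> fps_compose f (fps_X ^ 2)"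

text \<open>Cancelling X turns the generating function into the inverse of (e^X - 1)/X; comparing
  coefficients gives the Bernoulli recursion, solved step by step up to index 6.\<close>

lemma bernoulli_values: "bernoulli 4 = - 1 / 30" "bernoulli 6 = 1 / 42"
proof -
  define g :: "rat fps" where "g = Abs_fps (\<lambda>n. 1 / fact (Suc n))"
  have g: "fps_exp 1 - 1 = fps_X * g"
  proof (rule fps_ext)
    fix n show "fps_nth (fps_exp 1 - 1 :: rat fps) n = fps_nth (fps_X * g) n"
      by (cases n) (simp_all add: g_def fps_X_mult_nth algebra_simps)
  qed
  have g0: "fps_nth g 0 \<noteq> 0" by (simp add: g_def)
  define f where "f = fps_X / (fps_exp 1 - 1 :: rat fps)"
  have "f = inverse g"
    unfolding f_def g using g0 fps_divide_unit[OF g0, of 1]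
    by (metis mult.right_neutral fps_X_neq_zero div_mult_mult1 lambda_one)
  then have fg: "f * g = 1" using inverse_mult_eq_1[OF g0] by simp
  have e: "(\<Sum>i=0..n. fps_nth f i / fact (Suc (n - i))) = (if n = 0 then 1 else 0)" for n
    using arg_cong[OF fg, of "\<lambda>h. fps_nth h n"] by (simp add: fps_mult_nth g_def)
  have f0: "fps_nth f 0 = 1" using e[of 0] by simp
  have f1: "fps_nth f 1 = - 1 / 2" using e[of 1] f0 by (simp add: fact_numeral eval_nat_numeral)
  have f2: "fps_nth f 2 = 1 / 12"
    using e[of 2] f0 f1 by (simp add: eval_nat_numeral fact_Suc)
  have f3: "fps_nth f 3 = 0"
    using e[of 3] f0 f1 f2 by (simp add: eval_nat_numeral fact_Suc)
  have f4: "fps_nth f 4 = - 1 / 720"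
    using e[of 4] f0 f1 f2 f3 by (simp add: eval_nat_numeral fact_Suc)
  have f5: "fps_nth f 5 = 0"
    using e[of 5] f0 f1 f2 f3 f4 by (simp add: eval_nat_numeral fact_Suc)
  have f6: "fps_nth f 6 = 1 / 30240"
    using e[of 6] f0 f1 f2 f3 f4 f5 by (simp add: eval_nat_numeral fact_Suc)
  show "bernoulli 4 = - 1 / 30" "bernoulli 6 = 1 / 42"
    using f4 f6 by (simp_all add: bernoulli_def f_def fact_numeral)
qed

lemma Eisenstein_eq:
  assumes "k > 0"
  shows "Eisenstein k = 1 + fps_const (- of_rat (2 * of_nat k / bernoulli k)) * sigma_series 1 (k - 1)"
  by (rule fps_ext) (auto simp: Eisenstein_def sigma_series_def divisor_series_nth sgn_pow_def
      divisor_sigma_def)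

lemma Eisenstein_4: "Eisenstein 4 = 1 + 240 * sigma_series 1 3"
  by (subst Eisenstein_eq) (simp_all add: bernoulli_values of_rat_minus numeral_fps_const)

lemma Eisenstein_6: "Eisenstein 6 = 1 - 504 * sigma_series 1 5"
  by (subst Eisenstein_eq) (simp_all add: bernoulli_values of_rat_minus numeral_fps_const flip:
      fps_const_neg)

section \<open>Ramanujan's differential equations and relations at level 2\<close>

abbreviation (input) P where "P \<equiv> Eis2"
abbreviation (input) Q where "Q \<equiv> Eisenstein 4"
abbreviation (input) R where "R \<equiv> Eisenstein 6"

lemma qderiv_Eis2: "12 * qderiv P = P ^ 2 - Q"
proof -
  have d: "qderiv P = - 24 * qderiv (sigma_series 1 1)"
    by (simp add: Eis2_def qderiv_diff qderiv_mult qderiv_numeral qderiv_1)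
  have "- 12 * sigma_series 1 1 ^ 2
      = 6 * qderiv (sigma_series 1 1) - 5 * sigma_series 1 3 - (sigma_series 1 1 :: Q2 fps)"
    by (rule sigma1_square)
  then show ?thesis unfolding d unfolding Eis2_def Eisenstein_4 by algebra
qed

lemma qderiv_Eis4: "3 * qderiv Q = P * Q - R"
proof -
  have d: "qderiv Q = 240 * qderiv (sigma_series 1 3)"
    by (simp add: Eisenstein_4 qderiv_add qderiv_mult qderiv_numeral qderiv_1)
  have "- 240 * (sigma_series 1 1 * sigma_series 1 3)
      = 30 * qderiv (sigma_series 1 3) - 21 * sigma_series 1 5 - 10 * sigma_series 1 3
          + (sigma_series 1 1 :: Q2 fps)"
    by (rule sigma1_sigma3)
  then show ?thesis unfolding d unfolding Eis2_def Eisenstein_4 Eisenstein_6 by algebra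
qed

lemma V2_ring:
  "V2 (f + g) = V2 f + V2 g" "V2 (f - g) = V2 f - V2 g" "V2 (f * g) = V2 f * V2 g" "V2 (f ^ n)
      = V2 f ^ n"
  "V2 (numeral k) = numeral k" "V2 1 = 1" "V2 (fps_const c) = fps_const c"
  by (simp_all add: fps_compose_add_distrib fps_compose_sub_distrib fps_compose_mult_distrib
      fps_compose_power)

lemma qderiv_V2_Eis2: "6 * qderiv (V2 P) = V2 P ^ 2 - V2 Q"
proof -
  have "12 * V2 (qderiv P) = V2 P ^ 2 - V2 Q"
    using arg_cong[OF qderiv_Eis2, of V2] by (simp add: V2_ring)
  then show ?thesis unfolding qderiv_compose_square by algebra
qed

lemma qderiv_V2_Eis4: "3 * qderiv (V2 Q) = 2 * (V2 P * V2 Q - V2 R)"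
proof -
  have "3 * V2 (qderiv Q) = V2 P * V2 Q - V2 R"
    using arg_cong[OF qderiv_Eis4, of V2] by (simp add: V2_ring)
  then show ?thesis unfolding qderiv_compose_square by algebra
qed

lemma twisted_Eisenstein:
  "4 * V2 P - P = 3 - 24 * sigma_series (- 1) 1" "16 * V2 Q - Q = 15 + 240 * sigma_series (- 1) 3"
  "64 * V2 R - R = 63 - 504 * sigma_series (- 1) 5"
  by (simp_all add: Eis2_def Eisenstein_4 Eisenstein_6 V2_ring sigma_series_minus_one algebra_simps)

text \<open>The quasimodular corrections of E_2(q) and 2 E_2(q^2) cancel, so this is the weight 2
  Eisenstein series on Gamma_0(2).\<close>

definition Eis2_level2 :: "Q2 fps" where "Eis2_level2 = 2 * V2 P - P"

lemma fps_numeral_cancel: "numeral k * f = numeral k * g \<Longrightarrow> f = g" for f g :: "Q2 fps"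
  by simp

text \<open>Liouville's identity for the sign -1 relates a square to a derivative, and Ramanujan's
  equations eliminate the derivative. Multiplying by 24 avoids division.\<close>

lemma level2_weight4: "5 * Eis2_level2 ^ 2 = Q + 4 * V2 Q"
proof -
  have "qderiv (4 * V2 P - P) = - 24 * qderiv (sigma_series (- 1) 1)"
    unfolding twisted_Eisenstein by (simp add: qderiv_diff qderiv_mult qderiv_numeral)
  then have d: "4 * qderiv (V2 P) - qderiv P = - 24 * qderiv (sigma_series (- 1) 1)"
    by (simp add: qderiv_diff qderiv_mult qderiv_numeral)
  have t: "- 4 * sigma_series (- 1) 1 ^ 2
      = 2 * qderiv (sigma_series (- 1) 1) - sigma_series (- 1) 3 - (sigma_series (- 1) 1 :: Q2 fps)"
    by (rule twisted_sigma1_square)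
  have "24 * (5 * Eis2_level2 ^ 2) = 24 * (Q + 4 * V2 Q)"
    using d t twisted_Eisenstein(1,2) qderiv_Eis2 qderiv_V2_Eis2 unfolding Eis2_level2_def by algebra
  then show ?thesis by (rule fps_numeral_cancel)
qed

lemma level2_weight6_twisted: "7 * (Eis2_level2 * (Q - 8 * V2 Q)) = - (R + 48 * V2 R)"
proof -
  have "qderiv (16 * V2 Q - Q) = 240 * qderiv (sigma_series (- 1) 3)"
    unfolding twisted_Eisenstein by (simp add: qderiv_add qderiv_mult qderiv_numeral)
  then have d: "16 * qderiv (V2 Q) - qderiv Q = 240 * qderiv (sigma_series (- 1) 3)"
    by (simp add: qderiv_diff qderiv_mult qderiv_numeral)
  have t: "- 16 * (sigma_series (- 1) 1 * sigma_series (- 1) 3)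
      = 2 * qderiv (sigma_series (- 1) 3) - sigma_series (- 1) 5 - 2 * sigma_series (- 1) 3
          + (sigma_series (- 1) 1 :: Q2 fps)"
    by (rule twisted_sigma1_sigma3)
  have "720 * (7 * (Eis2_level2 * (Q - 8 * V2 Q))) = 720 * (- (R + 48 * V2 R))"
    using d t twisted_Eisenstein qderiv_Eis4 qderiv_V2_Eis4 unfolding Eis2_level2_def by algebra
  then show ?thesis by (rule fps_numeral_cancel)
qed

text \<open>This is the derivative of the identity in weight 4.\<close>

lemma level2_weight6: "3 * (Eis2_level2 * (Q - 4 * V2 Q)) = - (R + 8 * V2 R)"
proof -
  have "qderiv (5 * Eis2_level2 ^ 2) = qderiv (Q + 4 * V2 Q)" by (simp only: level2_weight4)
  then have d: "10 * Eis2_level2 * qderiv Eis2_level2 = qderiv Q + 4 * qderiv (V2 Q)"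
    by (simp add: qderiv_add qderiv_mult qderiv_numeral power2_eq_square algebra_simps)
  have "qderiv Eis2_level2 = 2 * qderiv (V2 P) - qderiv P"
    by (simp add: Eis2_level2_def qderiv_diff qderiv_mult qderiv_numeral)
  then have a: "12 * qderiv Eis2_level2 = Eis2_level2 * (2 * V2 P + P) - 4 * V2 Q + Q"
    using qderiv_Eis2 qderiv_V2_Eis2 unfolding Eis2_level2_def by algebra
  have "12 * (3 * (Eis2_level2 * (Q - 4 * V2 Q))) = 12 * (- (R + 8 * V2 R))"
    using d a level2_weight4 qderiv_Eis4 qderiv_V2_Eis4 Eis2_level2_def by algebra
  then show ?thesis by (rule fps_numeral_cancel)
qed

text \<open>After \<open>V2 Q\<close> is eliminated by the weight 4 relation, the two weight 6
  identities are linear equations with R and \<open>V2 R\<close> as unknowns.\<close>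

lemma Eis6_level2: "R = Eis2_level2 * (4 * Eis2_level2 ^ 2 - 3 * Q)" "8 * V2 R
    = Eis2_level2 * (11 * Eis2_level2 ^ 2 - 3 * Q)"
proof -
  have "20 * R = 20 * (Eis2_level2 * (4 * Eis2_level2 ^ 2 - 3 * Q))"
    using level2_weight6 level2_weight6_twisted level2_weight4 by algebra
  then show "R = Eis2_level2 * (4 * Eis2_level2 ^ 2 - 3 * Q)" by (rule fps_numeral_cancel)
  have "40 * (8 * V2 R) = 40 * (Eis2_level2 * (11 * Eis2_level2 ^ 2 - 3 * Q))"
    using level2_weight6 level2_weight6_twisted level2_weight4 by algebra
  then show "8 * V2 R = Eis2_level2 * (11 * Eis2_level2 ^ 2 - 3 * Q)" by (rule fps_numeral_cancel)
qed

lemma Delta_eq: "1728 * Delta = Q ^ 3 - R ^ 2"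
  by (simp add: Delta_def numeral_fps_const fps_const_mult[symmetric] mult.assoc[symmetric] del:
      fps_const_mult)

text \<open>The two factors vanish at the two cusps of Gamma_0(2). Delta has orders 1 and 2 there,
  while Delta(q^2) has orders 2 and 1, which explains the exponents here and in the next
  lemma.\<close>

lemma Delta_level2: "1728 * Delta = (Q - Eis2_level2 ^ 2) * (Q - 4 * Eis2_level2 ^ 2) ^ 2"
  unfolding Delta_eq using Eis6_level2 by algebra

lemma V2_Delta_level2: "64 * (1728 * V2 Delta) = (Q - Eis2_level2 ^ 2) ^ 2 * (4 * Eis2_level2 ^ 2 - Q)"
proof -
  have "V2 (1728 * Delta) = V2 (Q ^ 3 - R ^ 2)" by (simp only: Delta_eq)
  then have "1728 * V2 Delta = V2 Q ^ 3 - V2 R ^ 2" by (simp add: V2_ring)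
  moreover have "4 * V2 Q = 5 * Eis2_level2 ^ 2 - Q" using level2_weight4 by algebra
  ultimately show ?thesis using Eis6_level2(2) by algebra
qed

lemma Delta_nonzero: "Delta \<noteq> 0"
proof -
  have s: "fps_nth (sigma_series 1 k) 1 = (1 :: Q2)" for k
    by (simp add: sigma_series_def divisor_series_nth sgn_pow_def)
  have s0: "fps_nth (sigma_series 1 k) 0 = (0 :: Q2)" for k
    by (simp add: sigma_series_def)
  have "fps_nth (1728 * Delta) 1 = 1728"
    unfolding Delta_eq Eisenstein_4 Eisenstein_6
    by (simp add: power2_eq_square power3_eq_cube fps_mult_nth_1 s[unfolded One_nat_def] s0
        numeral_fps_const)
  then show ?thesis by auto
qed

text \<open>The quotient of the factorizations is 64 lambda = (Q - A^2) / (4 A^2 - Q) with A =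
  \<open>Eis2_level2\<close>. Multiplying by 5 replaces A^2 by \<open>V2 Q\<close>, the form from
  which integrality is read off.\<close>

lemma lambda_eq: "64 * lambda * (16 * V2 Q - Q) = 4 * (Q - V2 Q)"
proof -
  define D where "D = 4 * Eis2_level2 ^ 2 - Q"
  have D5: "5 * D = 16 * V2 Q - Q" and N5: "5 * (Q - Eis2_level2 ^ 2) = 4 * (Q - V2 Q)"
    using level2_weight4 by (auto simp: D_def algebra_simps)
  \<comment> \<open>So \<open>D\<close> has constant term 3 and is invertible as a power
    series.\<close>
  have "fps_nth (5 * D) 0 = 15"
    unfolding D5 twisted_Eisenstein(2) by (simp add: sigma_series_def numeral_fps_const)
  then have unit: "fps_nth D 0 \<noteq> 0" by (auto simp: numeral_fps_const)
  define x where "x = (Q - Eis2_level2 ^ 2) * inverse D"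
  have x: "x * D = Q - Eis2_level2 ^ 2" using inverse_mult_eq_1[OF unit] by (simp add: x_def mult.assoc)
  have "1728 * (64 * V2 Delta) = 1728 * (x * Delta)"
    using V2_Delta_level2 Delta_level2 x unfolding D_def by algebra
  then have "64 * V2 Delta = x * Delta" by (rule fps_numeral_cancel)
  then have "V2 Delta = (fps_const (1 / 64) * x) * Delta"
  proof -
    have "V2 Delta = fps_const (1 / 64) * (64 * V2 Delta)"
      by (simp add: numeral_fps_const flip: mult.assoc)
    then show ?thesis using \<open>64 * V2 Delta = x * Delta\<close> by (simp add: mult.assoc)
  qed
  then have "lambda = fps_const (1 / 64) * x"
    unfolding lambda_def using Delta_nonzero by simp
  then have "64 * lambda = fps_const 64 * (fps_const (1 / 64) * x)"
    by (simp only: numeral_fps_const)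
  then have "64 * lambda = x" unfolding mult.assoc[symmetric] by simp
  then show ?thesis
    unfolding D5[symmetric] N5[symmetric] by (simp only: mult.left_commute[of x 5 D] x)
qed

text \<open>The hypothesis says y = 64 Delta / E_4^3, since 1728 = 27 * 64. With x = 64 lambda one
  gets (1 + 4 x) D = 3 Q and 27 y Q^3 = x D^3; dividing by D^3 gives the claim.\<close>

lemma lambda_fixed_point:
  assumes "27 * (y * Q ^ 3) = Q ^ 3 - R ^ 2"
  shows "64 * lambda = y * (1 + 4 * (64 * lambda)) ^ 3"
proof -
  define x where "x = 64 * lambda"
  define D where "D = 4 * Eis2_level2 ^ 2 - Q"
  have "5 * D = 15 + 240 * sigma_series (- 1) 3"
    unfolding twisted_Eisenstein(2)[symmetric] using level2_weight4 by (simp add: D_def algebra_simps)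
  then have "fps_nth (5 * D) 0 = 15" by (simp add: sigma_series_def numeral_fps_const)
  then have "D \<noteq> 0" by auto
  have "fps_nth Q 0 = 1" by (simp add: Eisenstein_def)
  then have "Q \<noteq> 0" by auto
  have "5 * (x * D) = 5 * (Q - Eis2_level2 ^ 2)"
    using lambda_eq level2_weight4 unfolding x_def[symmetric] D_def by algebra
  then have xD: "x * D = Q - Eis2_level2 ^ 2" by (rule fps_numeral_cancel)
  have y: "27 * (y * Q ^ 3) = (Q - Eis2_level2 ^ 2) * D ^ 2"
    using Delta_level2 unfolding assms Delta_eq D_def by algebra
  have D3: "(1 + 4 * x) * D = 3 * Q" using xD unfolding D_def by algebra
  have "(y * (1 + 4 * x) ^ 3) * (27 * Q ^ 3 * D ^ 3) = (27 * (y * Q ^ 3)) * ((1 + 4 * x) * D) ^ 3"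
    by (simp add: power_mult_distrib mult_ac)
  also have "\<dots> = x * (27 * Q ^ 3 * D ^ 3)"
    unfolding y D3 xD[symmetric]
        by (simp add: power_mult_distrib power2_eq_square power3_eq_cube mult_ac)
  finally show ?thesis
    using \<open>D \<noteq> 0\<close> \<open>Q \<noteq> 0\<close> unfolding x_def[symmetric] by simp
qed

section \<open>Limits with integral coefficients\<close>

text \<open>The scalars are a parameter because both the polynomials over the field and those over
  the 2-adic integers are needed. Closure under products is then a lemma.\<close>

inductive_set ring_span :: "Q2 set \<Rightarrow> Q2 fps \<Rightarrow> Q2 fps \<Rightarrow> Q2 fps
    set" for K f g where
  monom: "f ^ i * g ^ j \<in> ring_span K f g"
| add: "x \<in> ring_span K f g \<Longrightarrow> y \<in> ring_span K f g \<Longrightarrow> x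
    + y \<in> ring_span K f g"
| scale: "c \<in> K \<Longrightarrow> x \<in> ring_span K f g
    \<Longrightarrow> fps_const c * x \<in> ring_span K f g"

lemma ring_span_mult:
  assumes "x \<in> ring_span K f g" "y \<in> ring_span K f g"
  shows "x * y \<in> ring_span K f g"
  using assms(1)
proof induction
  case (monom i j)
  from assms(2) show ?case
  proof induction
    case (monom k l)
    have "f ^ i * g ^ j * (f ^ k * g ^ l) = f ^ (i + k) * g ^ (j + l)"
      by (simp add: power_add mult_ac)
    then show ?case by (simp only: ring_span.monom)
  next
    case (add x y)
    then show ?case by (simp add: distrib_left ring_span.add)
  next
    case (scale c x)
    then show ?case by (simp add: mult.left_commute ring_span.scale)
  qed
next
  case (add x y)
  then show ?case by (simp add: distrib_right ring_span.add)
next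
  case (scale c x)
  then show ?case by (simp add: mult.assoc ring_span.scale)
qed

lemma ring_span_1: "1 \<in> ring_span K f g"
  using ring_span.monom[of f 0 g 0] by simp

lemma ring_span_gens: "f \<in> ring_span K f g" "g \<in> ring_span K f g"
  using ring_span.monom[of f 1 g 0] ring_span.monom[of f 0 g 1] by simp_all

lemma ring_span_const: "c \<in> K \<Longrightarrow> fps_const c \<in> ring_span K f g"
  using ring_span.scale[OF _ ring_span_1] by fastforce

lemma ring_span_power: "x \<in> ring_span K f g \<Longrightarrow> x ^ n \<in> ring_span K f g"
  by (induction n) (auto intro: ring_span_1 ring_span_mult)

lemma ring_span_sum:
  "0 \<in> K \<Longrightarrow> (\<And>i. i \<in> A \<Longrightarrow> F i \<in> ring_span K f g)
      \<Longrightarrow> sum F A \<in> ring_span K f g"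
  by (induction A rule: infinite_finite_induct) (use ring_span_const[of 0 K f g] in \<open>auto
      intro: ring_span.add\<close>)

lemma E4E6_ring_add:
  assumes "f \<in> E4E6_ring" "g \<in> E4E6_ring" shows "f + g \<in> E4E6_ring"
proof -
  let ?m = "\<lambda>i j. Eisenstein 4 ^ i * Eisenstein 6 ^ j"
  have pad: "(\<Sum>i<N. \<Sum>j<N. fps_const (c i j) * Eisenstein 4 ^ i * Eisenstein 6 ^ j)
      = (\<Sum>i<M. \<Sum>j<M. fps_const (if i < N \<and> j < N then c i j else 0) * ?m i j)"
    if "N \<le> M" for c :: "nat \<Rightarrow> nat \<Rightarrow> Q2" and N M
  proof -
    have "(\<Sum>i<M. \<Sum>j<M. fps_const (if i < N \<and> j < N then c i j else 0) * ?m i j)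
       = (\<Sum>i<N. \<Sum>j<M. fps_const (if i < N \<and> j < N then c i j else 0) * ?m i j)"
      using that by (intro sum.mono_neutral_right) auto
    also have "\<dots> = (\<Sum>i<N. \<Sum>j<N. fps_const (c i j) * ?m i j)"
      using that by (intro sum.cong refl sum.mono_neutral_cong_right) auto
    finally show ?thesis by (simp add: mult.assoc)
  qed
  obtain c N where f: "f
      = (\<Sum>i<N. \<Sum>j<N. fps_const (c i j) * Eisenstein 4 ^ i * Eisenstein 6 ^ j)"
    using assms(1) by (auto simp: E4E6_ring_def)
  obtain d M where g: "g
      = (\<Sum>i<M. \<Sum>j<M. fps_const (d i j) * Eisenstein 4 ^ i * Eisenstein 6 ^ j)"
    using assms(2) by (auto simp: E4E6_ring_def)
  define e where "e = (\<lambda>i j. (if i < N \<and> j < N then c i j else 0) + (if i < M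
      \<and> j < M then d i j else 0))"
  have "f + g = (\<Sum>i<max N M. \<Sum>j<max N M. fps_const (e i j) * Eisenstein 4 ^ i * Eisenstein
      6 ^ j)"
    unfolding f g pad[of N "max N M", OF max.cobounded1] pad[of M "max N M", OF max.cobounded2]
    by (simp add: e_def sum.distrib[symmetric] distrib_right[symmetric] fps_const_add[symmetric]
        mult.assoc
         del: fps_const_add)
  then show ?thesis by (auto simp: E4E6_ring_def)
qed

lemma E4E6_ring_scale:
  assumes "f \<in> E4E6_ring" shows "fps_const c * f \<in> E4E6_ring"
proof -
  obtain d N where "f = (\<Sum>i<N. \<Sum>j<N. fps_const (d i j) * Eisenstein 4 ^ i * Eisenstein 6 ^ j)"
    using assms by (auto simp: E4E6_ring_def)
  then have "fps_const c * f
      = (\<Sum>i<N. \<Sum>j<N. fps_const (c * d i j) * Eisenstein 4 ^ i * Eisenstein 6 ^ j)"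
    by (simp add: sum_distrib_left mult.assoc fps_const_mult[symmetric] del: fps_const_mult)
  then show ?thesis by (auto simp: E4E6_ring_def)
qed

lemma ring_span_E4E6: "ring_span UNIV (Eisenstein 4) (Eisenstein 6) \<subseteq> E4E6_ring"
proof
  fix x assume "x \<in> ring_span UNIV (Eisenstein 4) (Eisenstein 6)"
  then show "x \<in> E4E6_ring"
  proof induction
    case (monom i j)
    define c :: "nat \<Rightarrow> nat \<Rightarrow> Q2" where "c = (\<lambda>k l. if k = i \<and> l
        = j then 1 else 0)"
    let ?N = "Suc (max i j)"
    have "(\<Sum>k<?N. \<Sum>l<?N. fps_const (c k l) * Eisenstein 4 ^ k * Eisenstein 6 ^ l)
        = (\<Sum>k<?N. \<Sum>l<?N. if l = j then (if k
            = i then Eisenstein 4 ^ k * Eisenstein 6 ^ l else 0) else 0)"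
      by (intro sum.cong refl) (auto simp: c_def)
    also have "\<dots> = Eisenstein 4 ^ i * Eisenstein 6 ^ j"
      by (simp only: sum.delta finite_lessThan lessThan_iff) (simp add: less_Suc_eq_le)
    finally have eq: "(\<Sum>k<?N. \<Sum>l<?N. fps_const (c k l) * Eisenstein 4 ^ k * Eisenstein 6 ^ l)
        = Eisenstein 4 ^ i * Eisenstein 6 ^ j" .
    show ?case unfolding E4E6_ring_def
      by (rule CollectI, rule exI[of _ c], rule exI[of _ ?N]) (simp only: eq)
  next
    case (add x y)
    then show ?case by (simp add: E4E6_ring_add)
  next
    case (scale d x)
    then show ?case by (simp add: E4E6_ring_scale)
  qed
qed

text \<open>These are the covariances of the mode functions k and k^2, called p and r in the
  overview. The factors -2 and 2 come from adding the contributions of k and -k.\<close>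

definition gen3 :: "Q2 fps" where "gen3 = - 2 * sigma_series 1 3"
definition gen5 :: "Q2 fps" where "gen5 = 2 * sigma_series 1 5"

abbreviation int_ring :: "Q2 fps set" where "int_ring \<equiv> ring_span {c. qabs c \<le> 1} gen3 gen5"

lemma Eisenstein_gens: "Eisenstein 4 = 1 - 120 * gen3" "Eisenstein 6 = 1 - 252 * gen5"
  by (simp_all add: Eisenstein_4 Eisenstein_6 gen3_def gen5_def)

lemma int_ring_E4E6: "int_ring \<subseteq> E4E6_ring"
proof -
  let ?E = "ring_span UNIV (Eisenstein 4) (Eisenstein 6)"
  have "gen3 = fps_const (- 1 / 120) * Eisenstein 4 + fps_const (1 / 120)"
    "gen5 = fps_const (- 1 / 252) * Eisenstein 6 + fps_const (1 / 252)"
    unfolding Eisenstein_gens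
        by (simp_all add: right_diff_distrib numeral_fps_const flip: mult.assoc fps_const_neg)
  then have gens: "gen3 \<in> ?E" "gen5 \<in> ?E"
    by (metis UNIV_I ring_span.add ring_span.scale ring_span_const ring_span_gens)+
  have "x \<in> ?E" if "x \<in> int_ring" for x
    using that
    by induction (auto intro: ring_span.add ring_span.scale ring_span_mult ring_span_power gens)
  then show ?thesis using ring_span_E4E6 by blast
qed

lemma mode_coeff_123: "mode_coeff 1 k = 1" "mode_coeff 2 k = - of_int k - 1"
  "mode_coeff 3 k = (of_int k + 1) * (of_int k + 2) / 2"
  by (simp_all add: mode_coeff_def gbinomial_prod_rev eval_nat_numeral field_simps)

lemma covariance_power:
  "covariance (\<lambda>k. of_int k ^ i) (\<lambda>k. of_int k ^ j) = ((- 1) ^ i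
      + (- 1) ^ j) * sigma_series 1 (Suc (i + j))"
proof -
  have c: "(((- 1) ^ i + (- 1) ^ j) :: Q2 fps) = fps_const ((- 1) ^ i + (- 1) ^ j)"
    by (simp add: fps_const_power[symmetric] fps_const_add[symmetric] fps_const_neg[symmetric]
          del: fps_const_power fps_const_add fps_const_neg)
  have m: "(- of_nat k) ^ i = (- 1) ^ i * (of_nat k :: Q2) ^ i" for i k
    by (metis mult_minus1 power_mult_distrib)
  show ?thesis
    unfolding c
    by (rule fps_ext)
      (auto simp: covariance_def sigma_series_def divisor_series_def sgn_pow_def sum_distrib_left
          power_add m algebra_simps sum.distrib)
qed

lemma heis_0: "0 \<in> heis"
  by (simp add: heis_def)

lemma heis_add: "v \<in> heis \<Longrightarrow> w \<in> heis \<Longrightarrow> v + w \<in> heis"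
  using keys_add[of v w] by (auto simp: heis_def)

lemma heis_scale_mem: "v \<in> heis \<Longrightarrow> heis_scale c v \<in> heis"
  by (auto simp: heis_def in_keys_iff)

lemma int_ring_lift:
  assumes "z \<in> int_ring"
  shows "\<exists>w\<in>heis. heis_le 1 w \<and> F_S w = z"
proof -
  define B :: "nat set" where "B = {1, 2, 3}"
  \<comment> \<open>The coefficients in \<open>\<alpha>\<close> and \<open>\<beta>\<close> express k
    and k^2 in the binomial basis C_n = binomial(-k-1, n-1): k = - C_1 - C_2 and k^2 = C_1 + 3 C_2 +
    2 C_3. They are integers, so the states have norm at most 1.\<close>
  define \<alpha> :: "nat \<Rightarrow> Q2" where "\<alpha> = (\<lambda>b. if b = 3 then 0 else - 1)"
  define \<beta> :: "nat \<Rightarrow> Q2" where "\<beta> = (\<lambda>b. if b = 1 then 1 else if b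
      = 2 then 3 else 2)"
  have B: "finite B" "0 \<notin> B" by (auto simp: B_def)
  have a: "lin_fun B \<alpha> = (\<lambda>k. of_int k ^ 1)"
    by (rule ext) (simp add: lin_fun_def B_def \<alpha>_def mode_coeff_123 mode_coeff_123[unfolded
        One_nat_def])
  have b: "lin_fun B \<beta> = (\<lambda>k. of_int k ^ 2)"
    by (rule ext) (simp add: lin_fun_def B_def \<beta>_def mode_coeff_123 mode_coeff_123[unfolded
        One_nat_def]
         algebra_simps power2_eq_square)
  have caa: "covariance (lin_fun B \<alpha>) (lin_fun B \<alpha>) = gen3"
    unfolding a covariance_power gen3_def by (simp add: numeral_3_eq_3)
  have cbb: "covariance (lin_fun B \<beta>) (lin_fun B \<beta>) = gen5"
    unfolding b covariance_power gen5_def by simp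
  have cab: "covariance (lin_fun B \<alpha>) (lin_fun B \<beta>) = 0"
    unfolding a b covariance_power by simp
  have le: "heis_le 1 (lin_state B \<alpha>)" "heis_le 1 (lin_state B \<beta>)"
    unfolding lin_state_def B_def \<alpha>_def \<beta>_def
    using qabs_of_nat_le[of 3] qabs_of_nat_le[of 2]
    by (auto intro!: heis_le_add heis_le_single simp: qabs_minus)
  from assms show ?thesis
  proof induction
    case (monom i j)
    \<comment> \<open>An odd integer is a 2-adic unit, so dividing by it keeps the preimage in the
      unit ball.\<close>
    define u where "u = (of_int (odd_prod i * odd_prod j) :: Q2)"
    have u: "qabs u = 1"
      unfolding u_def by (rule qabs_odd) (simp add: odd_odd_prod)
    then have "u \<noteq> 0" by auto
    define x where "x = lin_state B \<alpha> ^ (2 * i) * lin_state B \<beta> ^ (2 * j)"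
    have "x \<in> heis_on B" unfolding x_def using B
      by (intro heis_on_mult heis_on_power lin_state_heis_on)
    then have "x \<in> heis" using heis_on_heis B by blast
    have "F_S x = fps_const u * (gen3 ^ i * gen5 ^ j)"
      unfolding x_def F_S_moments[OF B cab] caa cbb u_def by (simp only: fps_of_int mult.assoc)
    then have "F_S (heis_scale (inverse u) x) = gen3 ^ i * gen5 ^ j"
      using \<open>u \<noteq> 0\<close> by (simp add: F_S_scale flip: mult.assoc)
    moreover have "heis_le 1 (heis_scale (inverse u) x)"
      unfolding x_def by (intro heis_le_scale heis_le_mult heis_le_power le) (simp add: qabs_inverse u)
    ultimately show ?case using heis_scale_mem \<open>x \<in> heis\<close> by blast
  next
    case (add x y)
    then show ?case by (metis heis_le_add F_S_add heis_add)
  next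
    case (scale c x)
    then show ?case by (metis heis_le_scale F_S_scale mem_Collect_eq heis_scale_mem)
  qed
qed

lemma fps_le_sigma_series: "fps_le 1 (sigma_series 1 k)"
  unfolding fps_le_def sigma_series_def divisor_series_def
  by (auto intro!: qabs_sum_le power_le_one qabs_of_nat_le qabs_nonneg simp: sgn_pow_def qabs_power)

lemma fps_le_numeral: "fps_le 1 (numeral k)"
  unfolding numeral_fps_const using qabs_of_nat_le[of "numeral k"] by (intro fps_le_const) simp

lemma fps_le_int_ring: "z \<in> int_ring \<Longrightarrow> fps_le 1 z"
proof (induction rule: ring_span.induct)
  case (monom i j)
  have "fps_le 1 gen3" "fps_le 1 gen5"
    unfolding gen3_def gen5_def
    by (auto intro!: fps_le_mult1 fps_le_uminus fps_le_numeral fps_le_sigma_series simp: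
        mult_minus_left)
  then show ?case by (intro fps_le_mult1 fps_le_power)
next
  case (scale c x)
  then show ?case by (intro fps_le_mult1 fps_le_const) auto
qed (rule fps_le_add)

lemma int_ring_of_int: "of_int z \<in> int_ring"
  using ring_span_const[of "of_int z" "{c. qabs c \<le> 1}" gen3 gen5] qabs_of_int_le
  by (simp add: fps_of_int)

lemma int_ring_numeral: "numeral k \<in> int_ring"
  using int_ring_of_int[of "numeral k"] by simp

lemma int_ring_diff: "x \<in> int_ring \<Longrightarrow> y \<in> int_ring
    \<Longrightarrow> x - y \<in> int_ring"
  using ring_span.add[OF _ ring_span_mult[OF int_ring_of_int[of "- 1"]], of x y] by simp

lemmas int_ring_intros = ring_span.add ring_span_mult ring_span_power int_ring_diff int_ring_numeral
  ring_span_1 ring_span_gens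

lemma two_power_fps: "(2 :: Q2 fps) ^ k = fps_const (2 ^ k)"
  by (simp add: numeral_fps_const)

lemma fps_le_two_power: "fps_le 1 h \<Longrightarrow> fps_le ((1 / 2) ^ k) (2 ^ k * h)"
  using fps_le_mult[OF fps_le_const[of "2 ^ k" "(1 / 2) ^ k"], of 1 h]
  unfolding two_power_fps by (simp only: qabs_power qabs_2 order_refl mult_1_right)

text \<open>Successive differences are controlled in \<open>int_ring\<close> and not merely in the
    sup-norm, because
  the character map is not known to have preimages of controlled norm outside
      \<open>int_ring\<close>.\<close>

definition approx :: "Q2 fps \<Rightarrow> (nat \<Rightarrow> Q2 fps) \<Rightarrow> bool" where
  "approx f g \<longleftrightarrow> (\<forall>k. g k \<in> int_ring)
      \<and> (\<forall>k. \<exists>h\<in>int_ring. g (Suc k) - g k = 2 ^ k * h)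
     \<and> (\<forall>k. fps_le ((1 / 2) ^ k) (f - g k))"

lemma approxD:
  assumes "approx f g"
  shows "g k \<in> int_ring" "\<exists>h\<in>int_ring. g (Suc k) - g k
      = 2 ^ k * h" "fps_le ((1 / 2) ^ k) (f - g k)"
  using assms by (auto simp: approx_def)

lemma approx_fps_le: "approx f g \<Longrightarrow> fps_le 1 f"
  using fps_le_add[OF fps_le_int_ring[OF approxD(1)[of f g 0]]] approxD(3)[of f g 0] by fastforce

lemma approx_const: "z \<in> int_ring \<Longrightarrow> approx z (\<lambda>_. z)"
  by (auto simp: approx_def intro!: bexI[of _ 0] int_ring_of_int[of 0, simplified])

lemma approx_diff:
  assumes "approx f g" "approx f' g'" shows "approx (f - f') (\<lambda>k. g k - g' k)"
  unfolding approx_def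
proof (intro conjI allI)
  fix k
  note A = approxD[OF assms(1), of k] and B = approxD[OF assms(2), of k]
  show "g k - g' k \<in> int_ring" using A B by (intro int_ring_diff)
  obtain h h' where "h \<in> int_ring" "g (Suc k) - g k
      = 2 ^ k * h" "h' \<in> int_ring" "g' (Suc k) - g' k = 2 ^ k * h'"
    using A B by blast
  then have "g (Suc k) - g' (Suc k) - (g k - g' k) = 2 ^ k * (h - h')" "h - h' \<in> int_ring"
    by (auto simp: algebra_simps intro: int_ring_diff)
  then show "\<exists>h\<in>int_ring. g (Suc k) - g' (Suc k) - (g k - g' k) = 2 ^ k * h" by blast
  have "f - f' - (g k - g' k) = (f - g k) - (f' - g' k)" by simp
  then show "fps_le ((1 / 2) ^ k) (f - f' - (g k - g' k))" using A B by (simp only: fps_le_diff)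
qed

lemma approx_mult:
  assumes "approx f g" "approx f' g'" shows "approx (f * f') (\<lambda>k. g k * g' k)"
  unfolding approx_def
proof (intro conjI allI)
  fix k
  note A = approxD[OF assms(1), of k] and B = approxD[OF assms(2), of k]
  show "g k * g' k \<in> int_ring" using A B by (intro ring_span_mult)
  obtain h h' where h: "h \<in> int_ring" "g (Suc k) - g k
      = 2 ^ k * h" "h' \<in> int_ring" "g' (Suc k) - g' k = 2 ^ k * h'"
    using A B by blast
  have "g (Suc k) * g' (Suc k) - g k * g' k = g (Suc k) * (g' (Suc k) - g' k)
      + (g (Suc k) - g k) * g' k"
    by (simp add: algebra_simps)
  also have "\<dots> = 2 ^ k * (g (Suc k) * h' + h * g' k)"
    unfolding h by (simp add: algebra_simps)
  finally have "g (Suc k) * g' (Suc k) - g k * g' k = 2 ^ k * (g (Suc k) * h' + h * g' k)" .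
  moreover have "g (Suc k) * h' + h * g' k \<in> int_ring"
    using h approxD(1)[OF assms(1)] approxD(1)[OF assms(2)] by (intro int_ring_intros)
  ultimately show "\<exists>h\<in>int_ring. g (Suc k) * g' (Suc k) - g k * g' k = 2 ^ k * h" by blast
  have "f * f' - g k * g' k = f * (f' - g' k) + g' k * (f - g k)" by (simp add: algebra_simps)
  then show "fps_le ((1 / 2) ^ k) (f * f' - g k * g' k)"
    using A B approx_fps_le[OF assms(1)] fps_le_int_ring[OF B(1)]
    by (simp only: fps_le_add fps_le_mult1)
qed

lemma approx_power: "approx f g \<Longrightarrow> approx (f ^ n) (\<lambda>k. g k ^ n)"
  by (induction n) (auto intro: approx_mult approx_const ring_span_1)

text \<open>With constant term 1 the recursion for the coefficients of the inverse involves no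
  division.\<close>

lemma fps_le_inverse:
  assumes "fps_le 1 a" "fps_nth a 0 = 1" shows "fps_le 1 (inverse a)"
proof -
  have f: "a * inverse a = 1" using assms inverse_mult_eq_1'[of a] by simp
  have "qabs (fps_nth (inverse a) n) \<le> 1" for n
  proof (induction n rule: less_induct)
    case (less n)
    have "fps_nth (a * inverse a) n = fps_nth (inverse a) n
        + (\<Sum>i=1..n. fps_nth a i * fps_nth (inverse a) (n - i))"
      using assms(2) by (simp add: fps_mult_nth sum.atLeast_Suc_atMost)
    then have "fps_nth (inverse a) n = (if n = 0 then 1 else 0)
        + (\<Sum>i=1..n. - (fps_nth a i * fps_nth (inverse a) (n - i)))"
      unfolding f by (simp add: sum_negf algebra_simps eq_diff_eq)
    moreover have "qabs (\<Sum>i=1..n. - (fps_nth a i * fps_nth (inverse a) (n - i))) \<le> 1"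
    proof (rule qabs_sum_le)
      fix i assume "i \<in> {1..n}"
      then have "qabs (fps_nth (inverse a) (n - i)) \<le> 1" using less by simp
      then show "qabs (- (fps_nth a i * fps_nth (inverse a) (n - i))) \<le> 1"
        using mult_mono[of "qabs (fps_nth a i)" 1 "qabs (fps_nth (inverse a) (n - i))" 1] assms(1)
        by (simp add: qabs_minus qabs_mult qabs_nonneg fps_le_def)
    qed simp
    ultimately show ?case
      using qabs_add_le_max[of "if n
          = 0 then 1 else 0" "\<Sum>i=1..n. - (fps_nth a i * fps_nth (inverse a) (n - i))"]
      by (auto split: if_splits)
  qed
  then show ?thesis by (simp add: fps_le_def)
qed

text \<open>A geometric series in 120 p = 2 (60 p): its k-th term is 2^k times an element of
  \<open>int_ring\<close>.\<close>

lemma approx_inverse_E4: "approx (inverse (Eisenstein 4)) (\<lambda>k. \<Sum>i<k. (120 * gen3) ^ i)"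
  unfolding approx_def
proof (intro conjI allI)
  fix k
  have E0: "fps_nth (Eisenstein 4) 0 = 1" by (simp add: Eisenstein_def)
  show "(\<Sum>i<k. (120 * gen3) ^ i) \<in> int_ring"
    by (rule ring_span_sum) (auto intro: int_ring_intros)
  have "120 * gen3 = 2 * (60 * gen3)" by simp
  then have pow: "(120 * gen3) ^ k = 2 ^ k * (60 * gen3) ^ k" by (simp only: power_mult_distrib)
  show "\<exists>h\<in>int_ring. (\<Sum>i<Suc k. (120 * gen3) ^ i) - (\<Sum>i<k. (120 * gen3) ^ i)
      = 2 ^ k * h"
  proof (rule bexI)
    show "(\<Sum>i<Suc k. (120 * gen3) ^ i) - (\<Sum>i<k. (120 * gen3) ^ i) = 2 ^ k * (60 * gen3) ^ k"
      unfolding pow[symmetric] by simp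
    show "(60 * gen3) ^ k \<in> int_ring" by (intro int_ring_intros)
  qed
  have "Eisenstein 4 * (\<Sum>i<k. (120 * gen3) ^ i) = 1 - (120 * gen3) ^ k"
    unfolding Eisenstein_gens by (rule one_diff_power_eq[symmetric])
  then have "inverse (Eisenstein 4) * (Eisenstein 4 * (\<Sum>i<k. (120 * gen3) ^ i))
      = inverse (Eisenstein 4) * (1 - (120 * gen3) ^ k)" by simp
  then have "inverse (Eisenstein 4) - (\<Sum>i<k. (120 * gen3) ^ i)
      = inverse (Eisenstein 4) * (120 * gen3) ^ k"
    using inverse_mult_eq_1[of "Eisenstein 4"] E0 by (simp add: algebra_simps flip: mult.assoc)
  also have "\<dots> = 2 ^ k * (inverse (Eisenstein 4) * (60 * gen3) ^ k)"
    unfolding pow by (rule mult.left_commute)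
  also have "fps_le ((1 / 2) ^ k) \<dots>"
  proof (intro fps_le_two_power fps_le_mult1 fps_le_inverse E0 fps_le_power)
    have "Eisenstein 4 \<in> int_ring" unfolding Eisenstein_gens by (intro int_ring_intros)
    then show "fps_le 1 (Eisenstein 4)" by (rule fps_le_int_ring)
    show "fps_le 1 60" by (rule fps_le_numeral)
    show "fps_le 1 gen3" by (rule fps_le_int_ring) (rule ring_span_gens)
  qed
  finally show "fps_le ((1 / 2) ^ k) (inverse (Eisenstein 4) - (\<Sum>i<k. (120 * gen3) ^ i))" .
qed

section \<open>Approximation of 64 lambda and of its power series\<close>

definition lambda64 :: "Q2 fps" where "lambda64 = 64 * lambda"

text \<open>Dividing \<open>lambda_eq\<close> by 15 leaves a denominator that is integral with
  constant term 1. Integrality starts the contraction estimate, and the vanishing constant term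
  makes infinite sums of powers meaningful by coefficients.\<close>

lemma lambda64_integral: "fps_le 1 lambda64" and lambda64_nth_0: "fps_nth lambda64 0 = 0"
proof -
  define t :: "Q2 fps" where "t = 1 + 16 * sigma_series (- 1) 3"
  define s :: "Q2 fps" where "s = 64 * (sigma_series 1 3 - V2 (sigma_series 1 3))"
  have "16 * V2 (Eisenstein 4) - Eisenstein 4 = 15 * t"
    unfolding twisted_Eisenstein(2) by (simp add: t_def)
  moreover have "4 * (Eisenstein 4 - V2 (Eisenstein 4)) = 15 * s"
    by (simp add: Eisenstein_4 V2_ring s_def)
  ultimately have "15 * (lambda64 * t) = 15 * s"
    using lambda_eq by (simp only: lambda64_def mult_ac)
  then have lt: "lambda64 * t = s" by (rule fps_numeral_cancel)
  have V: "fps_le 1 (V2 (sigma_series 1 3))"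
    using fps_le_sigma_series[of 3] by (simp add: fps_le_def fps_nth_compose_square)
  have "fps_le 1 (sigma_series (- 1) 3)"
    by (subst sigma_series_minus_one)
      (auto intro!: fps_le_add fps_le_diff fps_le_uminus fps_le_mult1 fps_le_power fps_le_numeral
          fps_le_sigma_series V simp del: power_Suc)
  then have t: "fps_le 1 t" "fps_nth t 0 = 1"
    unfolding t_def by (intro fps_le_add fps_le_mult1 fps_le_numeral fps_le_1) (simp_all add:
        sigma_series_def numeral_fps_const)
  have "lambda64 = s * inverse t"
    using lt inverse_mult_eq_1'[of t] t by (metis mult.assoc mult.right_neutral zero_neq_one)
  moreover have "fps_le 1 s" unfolding s_def
    by (intro fps_le_mult1 fps_le_diff fps_le_numeral fps_le_sigma_series V)
  ultimately show "fps_le 1 lambda64" using fps_le_inverse[OF t] by (metis fps_le_mult1)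
  show "fps_nth lambda64 0 = 0"
    unfolding \<open>lambda64 = s * inverse t\<close>
        by (simp add: s_def sigma_series_def fps_nth_compose_square)
qed

text \<open>The explicit factor 4 is the source of the contraction.\<close>

lemma cube_diff: "(1 + 4 * a) ^ 3 - (1 + 4 * b) ^ 3
    = 4 * (a - b) * ((1 + 4 * a) ^ 2 + (1 + 4 * a) * (1 + 4 * b) + (1 + 4 * b) ^ 2)"
  for a b :: "'a :: comm_ring_1"
  by (simp add: power2_eq_square power3_eq_cube algebra_simps)

lemma approx_lambda64: "\<exists>X. approx lambda64 X"
proof -
  define y where "y = fps_const (1 / 27) * (1 - Eisenstein 6 ^ 2 * inverse (Eisenstein 4) ^ 3)"
  have "fps_nth (Eisenstein 4) 0 = 1" by (simp add: Eisenstein_def)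
  then have inv: "inverse (Eisenstein 4) * Eisenstein 4 = 1" by (intro inverse_mult_eq_1) simp
  have "27 * (y * Eisenstein 4 ^ 3) = (fps_const 27 * fps_const (1 / 27))
      * (Eisenstein 4 ^ 3 - Eisenstein 6 ^ 2 * (inverse (Eisenstein 4) * Eisenstein 4) ^ 3)"
    unfolding y_def numeral_fps_const
        by (simp only: power_mult_distrib) (simp only: algebra_simps mult_1_left)
  also have "\<dots> = Eisenstein 4 ^ 3 - Eisenstein 6 ^ 2" unfolding inv by simp
  finally have "27 * (y * Eisenstein 4 ^ 3) = Eisenstein 4 ^ 3 - Eisenstein 6 ^ 2" .
  then have fix_eq: "lambda64 = y * (1 + 4 * lambda64) ^ 3"
    unfolding lambda64_def by (rule lambda_fixed_point)
  \<comment> \<open>Oddness of 27 keeps the division in y within \<open>int_ring\<close>.\<close>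
  have "qabs (1 / 27) = 1"
    using qabs_inverse[of 27] qabs_odd[of 27] by (simp add: inverse_eq_divide)
  then have "fps_const (1 / 27) \<in> int_ring" by (intro ring_span_const) simp
  moreover have "Eisenstein 6 \<in> int_ring" unfolding Eisenstein_gens by (intro int_ring_intros)
  ultimately obtain Y where Y: "approx y Y"
    unfolding y_def
    using approx_mult[OF approx_const approx_diff[OF approx_const[OF ring_span_1]
        approx_mult[OF approx_power[OF approx_const] approx_power[OF approx_inverse_E4]]]] by blast
  \<comment> \<open>Fixed point iteration with y replaced by \<open>Y (Suc k)\<close>, an
    approximation already as precise as the new iterate has to be.\<close>
  define X where "X = rec_nat 0 (\<lambda>k x. Y (Suc k) * (1 + 4 * x) ^ 3)"
  have X0: "X 0 = 0" and XS: "X (Suc k) = Y (Suc k) * (1 + 4 * X k) ^ 3" for k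
    by (simp_all add: X_def)
  have X: "X k \<in> int_ring" for k
    by (induction k) (auto simp: X0 XS intro!: int_ring_intros approxD(1)[OF Y] int_ring_of_int[of
        0, simplified])
  have "\<exists>h\<in>int_ring. X (Suc k) - X k = 2 ^ k * h" for k
  proof (induction k)
    case 0
    show ?case using X[of 1] by (auto simp: X0)
  next
    case (Suc k)
    then obtain h where h: "h \<in> int_ring" "X (Suc k) - X k = 2 ^ k * h" by blast
    obtain h' where h': "h' \<in> int_ring" "Y (Suc (Suc k)) - Y (Suc k) = 2 ^ Suc k * h'"
      using approxD(2)[OF Y] by blast
    let ?c = "(1 + 4 * X (Suc k)) ^ 2 + (1 + 4 * X (Suc k)) * (1 + 4 * X k) + (1 + 4 * X k) ^ 2"
    have "X (Suc (Suc k)) - X (Suc k) = (Y (Suc (Suc k)) - Y (Suc k)) * (1 + 4 * X (Suc k)) ^ 3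
        + Y (Suc k) * ((1 + 4 * X (Suc k)) ^ 3 - (1 + 4 * X k) ^ 3)"
      by (subst XS, subst (2) XS) (simp only: algebra_simps)
    also have "\<dots> = 2 ^ Suc k * (h' * (1 + 4 * X (Suc k)) ^ 3 + Y (Suc k) * (2 * h * ?c))"
      unfolding h' cube_diff h by (simp add: algebra_simps del: power_Suc) (simp add: algebra_simps)
    finally have eq: "X (Suc (Suc k)) - X (Suc k)
        = 2 ^ Suc k * (h' * (1 + 4 * X (Suc k)) ^ 3 + Y (Suc k) * (2 * h * ?c))" .
    have "h' * (1 + 4 * X (Suc k)) ^ 3 + Y (Suc k) * (2 * h * ?c) \<in> int_ring"
      using h(1) h'(1) X approxD(1)[OF Y] by (intro int_ring_intros)
    then show ?case using eq by blast
  qed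
  moreover have "fps_le ((1 / 2) ^ k) (lambda64 - X k)" for k
  proof (induction k)
    case 0
    show ?case using lambda64_integral by (simp add: X0)
  next
    case (Suc k)
    let ?c = "(1 + 4 * lambda64) ^ 2 + (1 + 4 * lambda64) * (1 + 4 * X k) + (1 + 4 * X k) ^ 2"
    have i: "fps_le 1 (1 + 4 * lambda64)" "fps_le 1 (1 + 4 * X k)" "fps_le 1 (Y (Suc k))"
      using lambda64_integral fps_le_int_ring[OF X] fps_le_int_ring[OF approxD(1)[OF Y]]
      by (auto intro!: fps_le_add fps_le_mult1 fps_le_numeral)
    have "lambda64 - X (Suc k) = y * (1 + 4 * lambda64) ^ 3 - Y (Suc k) * (1 + 4 * X k) ^ 3"
      using fix_eq XS by simp
    also have "\<dots> = (1 + 4 * lambda64) ^ 3 * (y - Y (Suc k)) + Y (Suc k) * ((1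
        + 4 * lambda64) ^ 3 - (1 + 4 * X k) ^ 3)"
      by (simp only: algebra_simps)
    \<comment> \<open>One factor 2 of the 4 raises the precision from 2^k to 2^(k+1); the other
      stays in the integral cofactor.\<close>
    also have "\<dots> = (1 + 4 * lambda64) ^ 3 * (y - Y (Suc k))
        + (Y (Suc k) * (2 * ?c)) * (2 ^ 1 * (lambda64 - X k))"
      unfolding cube_diff by (simp add: algebra_simps)
    finally have eq: "lambda64 - X (Suc k) = \<dots>" .
    have "fps_le (1 / 2) (2 :: Q2 fps)" using fps_le_two_power[of 1 1] by simp
    then have d: "fps_le ((1 / 2) ^ Suc k) (2 ^ 1 * (lambda64 - X k))"
      using fps_le_mult[OF _ Suc] by (simp only: power_Suc power_one_right)
    have c: "fps_le 1 (Y (Suc k) * (2 * ?c))"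
      by (intro fps_le_mult1 fps_le_add fps_le_power fps_le_numeral fps_le_1 lambda64_integral
          fps_le_int_ring[OF X] fps_le_int_ring[OF approxD(1)[OF Y]])
    show ?case
      unfolding eq
      by (rule fps_le_add[OF fps_le_mult1[OF fps_le_power[OF i(1)] approxD(3)[OF Y]] fps_le_mult1[OF
          c d]])
  qed
  ultimately have "approx lambda64 X" using X by (simp add: approx_def)
  then show ?thesis by blast
qed

text \<open>Since \<open>lambda64\<close> has no constant term, its n-th power starts at q^n or
  later, so truncating at n = m gives the exact m-th coefficient.\<close>

definition lambda64_series :: "(nat \<Rightarrow> Q2) \<Rightarrow> Q2 fps" where
  "lambda64_series b = Abs_fps (\<lambda>m. \<Sum>n\<le>m. b n * fps_nth (lambda64 ^ n) m)"

lemma sum_lessThan_add: "(\<Sum>n<N + M. f n) = (\<Sum>n<N. f n) + (\<Sum>n=N..<N + M. f n)"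
  for f :: "nat \<Rightarrow> 'a :: comm_monoid_add"
  by (simp add: sum.atLeastLessThan_concat flip: atLeast0LessThan)

lemma lambda64_series_tail:
  assumes "\<And>n. n \<ge> N \<Longrightarrow> qabs (b n) \<le> e" "e \<ge> 0"
  shows "fps_le e (lambda64_series b - (\<Sum>n<N. fps_const (b n) * lambda64 ^ n))"
  unfolding fps_le_def
proof
  fix m
  have z: "fps_nth (lambda64 ^ n) m = 0" if "m < n" for n
    using that startsby_zero_power_prefix[OF lambda64_nth_0] by blast
  have "(\<Sum>n\<le>m. b n * fps_nth (lambda64 ^ n) m) = (\<Sum>n<N
      + Suc m. b n * fps_nth (lambda64 ^ n) m)"
    by (rule sum.mono_neutral_left) (auto simp: z)
  also have "\<dots> = (\<Sum>n<N. b n * fps_nth (lambda64 ^ n) m) + (\<Sum>n=N..<N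
      + Suc m. b n * fps_nth (lambda64 ^ n) m)"
    by (rule sum_lessThan_add)
  finally have eq: "fps_nth (lambda64_series b - (\<Sum>n<N. fps_const (b n) * lambda64 ^ n)) m
      = (\<Sum>n=N..<N + Suc m. b n * fps_nth (lambda64 ^ n) m)"
    by (simp add: lambda64_series_def fps_sum_nth)
  have le: "qabs (b n * fps_nth (lambda64 ^ n) m) \<le> e" if "N \<le> n" for n
    using mult_mono[OF assms(1)[OF that] fps_leD[OF fps_le_power[OF lambda64_integral], of n m]]
        assms(2)
    by (simp add: qabs_mult qabs_nonneg)
  show "qabs (fps_nth (lambda64_series b - (\<Sum>n<N. fps_const (b n) * lambda64 ^ n)) m) \<le> e"
    unfolding eq by (rule qabs_sum_le[OF assms(2)]) (simp only: atLeastLessThan_iff le)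
qed

lemma small_coeff_multiple: "qabs c \<le> (1 / 2) ^ k \<Longrightarrow> \<exists>d. qabs d \<le> 1
    \<and> c = 2 ^ k * d"
proof (rule exI[of _ "c / 2 ^ k"], intro conjI)
  assume "qabs c \<le> (1 / 2) ^ k"
  then have "qabs c / (1 / 2) ^ k \<le> 1" by (subst pos_divide_le_eq) simp_all
  then show "qabs (c / 2 ^ k) \<le> 1" by (simp only: qabs_divide qabs_power qabs_2)
qed simp

text \<open>Two limits are taken at once: \<open>X k\<close> replaces the series and
  \<open>N k\<close> truncates the sum, chosen so that both errors are divisible by 2^k.\<close>

lemma approx_lambda64_series:
  assumes b1: "\<And>n. qabs (b n)
      \<le> 1" and b0: "(\<lambda>n. qabs (b n)) \<longlonglongrightarrow> 0"
  shows "\<exists>g. approx (lambda64_series b) g"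
proof -
  obtain X where X: "approx lambda64 X" using approx_lambda64 by blast
  have "\<exists>N. \<forall>n\<ge>N. qabs (b n) \<le> (1 / 2) ^ k" for k
    using order_tendstoD(2)[OF b0, of "(1 / 2) ^ k"]
    by (auto simp: eventually_sequentially intro: less_imp_le)
  then obtain N0 where N0: "\<And>k n. n \<ge> N0 k \<Longrightarrow> qabs (b n) \<le> (1 / 2) ^ k"
      by metis
  \<comment> \<open>Cumulative sums make the cut-offs increasing, so each truncation extends the
    previous one.\<close>
  define N where "N k = (\<Sum>i\<le>k. N0 i)" for k
  have N: "qabs (b n) \<le> (1 / 2) ^ k" if "n \<ge> N k" for n k
    using N0[of k n] member_le_sum[of k "{..k}" N0] that by (simp add: N_def)
  have N_Suc: "N (Suc k) = N k + N0 (Suc k)" for k by (simp add: N_def)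
  define g where "g k = (\<Sum>n<N k. fps_const (b n) * X k ^ n)" for k
  have zero: "0 \<in> {c. qabs c \<le> 1}" by simp
  have bc: "fps_const (b n) \<in> int_ring" for n using b1 by (intro ring_span_const) simp
  have "approx (lambda64_series b) g"
    unfolding approx_def
  proof (intro conjI allI)
    fix k
    show "g k \<in> int_ring" unfolding g_def
      by (intro ring_span_sum[OF zero] ring_span_mult ring_span_power approxD(1)[OF X] bc)
    have "\<exists>h\<in>int_ring. X (Suc k) ^ n - X k ^ n = 2 ^ k * h" for n
      using approxD(2)[OF approx_power[OF X]] by blast
    then obtain h where h: "\<And>n. h n \<in> int_ring" "\<And>n. X (Suc k) ^ n - X k ^ n
        = 2 ^ k * h n" by metis
    have "\<exists>d. qabs d \<le> 1 \<and> b n = 2 ^ k * d" if "n \<ge> N k" for n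
      by (rule small_coeff_multiple) (rule N[OF that])
    then obtain d where d: "\<And>n. n \<ge> N k \<Longrightarrow> qabs (d n)
        \<le> 1" "\<And>n. n \<ge> N k \<Longrightarrow> b n = 2 ^ k * d n" by metis
    \<comment> \<open>Below \<open>N k\<close> only the approximation of the powers changes; the new
      terms have coefficients divisible by 2^k. Both parts therefore stay in 2^k times
      \<open>int_ring\<close>.\<close>
    have "g (Suc k) = (\<Sum>n<N k. fps_const (b n) * X (Suc k) ^ n)
        + (\<Sum>n=N k..<N (Suc k). fps_const (b n) * X (Suc k) ^ n)"
      unfolding g_def N_Suc
      by (rule sum_lessThan_add)
    then have "g (Suc k) - g k = (\<Sum>n<N k. fps_const (b n) * (X (Suc k) ^ n - X k ^ n))
        + (\<Sum>n=N k..<N (Suc k). fps_const (b n) * X (Suc k) ^ n)"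
      by (simp add: g_def right_diff_distrib sum_subtractf)
    also have "(\<Sum>n<N k. fps_const (b n) * (X (Suc k) ^ n - X k ^ n))
        = 2 ^ k * (\<Sum>n<N k. fps_const (b n) * h n)"
      by (simp add: h(2) sum_distrib_left mult_ac)
    also have "(\<Sum>n=N k..<N (Suc k). fps_const (b n) * X (Suc k) ^ n)
        = 2 ^ k * (\<Sum>n=N k..<N (Suc k). fps_const (d n) * X (Suc k) ^ n)"
    proof -
      have "fps_const (b n) = 2 ^ k * fps_const (d n)" if "n \<ge> N k" for n
        using d(2)[OF that] by (simp only: two_power_fps fps_const_mult)
      then show ?thesis
        unfolding sum_distrib_left by (intro sum.cong refl) (simp only: mult.assoc atLeastLessThan_iff)
    qed
    finally have eq: "g (Suc k) - g k = 2 ^ k * ((\<Sum>n<N k. fps_const (b n) * h n)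
        + (\<Sum>n=N k..<N (Suc k). fps_const (d n) * X (Suc k) ^ n))" by (simp add: distrib_left)
    have "(\<Sum>n<N k. fps_const (b n) * h n)
        + (\<Sum>n=N k..<N (Suc k). fps_const (d n) * X (Suc k) ^ n) \<in> int_ring"
      by (intro ring_span.add ring_span_sum[OF zero] ring_span_mult ring_span_power approxD(1)[OF X]
          bc h(1)
          ring_span_const) (simp add: d(1))
    then show "\<exists>h\<in>int_ring. g (Suc k) - g k = 2 ^ k * h" using eq by blast
    have "lambda64_series b - g k = (lambda64_series b - (\<Sum>n<N k. fps_const (b n) * lambda64 ^ n))
        + (\<Sum>n<N k. fps_const (b n) * (lambda64 ^ n - X k ^ n))"
      by (simp add: g_def right_diff_distrib sum_subtractf)
    moreover have "fps_le ((1 / 2) ^ k) (lambda64_series b - (\<Sum>n<N k. fps_const (b n) *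
        lambda64 ^ n))"
      by (rule lambda64_series_tail) (auto intro: N)
    moreover have "fps_le ((1 / 2) ^ k) (\<Sum>n<N k. fps_const (b n) * (lambda64 ^ n - X k ^ n))"
      by (intro fps_le_sum fps_le_mult1 fps_le_const b1 approxD(3)[OF approx_power[OF X]]) simp
    ultimately show "fps_le ((1 / 2) ^ k) (lambda64_series b - g k)" by (simp only: fps_le_add)
  qed
  then show ?thesis by blast
qed

section \<open>Preimages under the completed character map\<close>

lemma qlim_iff: "qlim g f \<longleftrightarrow> (\<forall>e>0. \<exists>K. \<forall>k\<ge>K. fps_le
    e (f - g k))"
proof -
  have q: "dist (fps_nth (g k) n) (fps_nth f n) = qabs (fps_nth (f - g k) n)" for k n
    by (subst dist_commute) (simp add: dist_Q2_def)
  show ?thesis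
    unfolding qlim_def uniform_limit_iff eventually_sequentially q fps_le_def
    by (meson UNIV_I field_lbound_gt_zero less_imp_le le_less_trans)
qed

lemma hlim_iff: "hlim s v \<longleftrightarrow> (\<forall>e>0. \<exists>K. \<forall>k\<ge>K.
    \<forall>I. qabs (coeff_at (s k) I - v I) \<le> e)"
  unfolding hlim_def uniform_limit_iff eventually_sequentially dist_Q2_def
  by (meson UNIV_I field_lbound_gt_zero less_imp_le le_less_trans)

lemma qlim_unique: "qlim g f \<Longrightarrow> qlim g f' \<Longrightarrow> f = f'"
  unfolding qlim_def
  by (rule fps_ext) (metis LIMSEQ_unique tendsto_uniform_limitI UNIV_I)

text \<open>One approximating sequence suffices: two sequences with the same limit differ by states
  of small norm, and \<open>F_S\<close> does not increase norms.\<close>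

lemma F_S_hat_eqI:
  assumes s: "range s \<subseteq> heis" "hlim s v" and f: "qlim (\<lambda>k. F_S (s k)) f"
  shows "F_S_hat v = f"
  unfolding F_S_hat_def
proof (rule the_equality)
  show "\<forall>s. range s \<subseteq> heis \<longrightarrow> hlim s v \<longrightarrow> qlim
      (\<lambda>k. F_S (s k)) f"
  proof (intro allI impI)
    fix t assume t: "range t \<subseteq> heis" "hlim t v"
    show "qlim (\<lambda>k. F_S (t k)) f"
      unfolding qlim_iff
    proof (intro allI impI)
      fix e :: real assume e: "e > 0"
      obtain K1 where K1: "\<And>k I. k \<ge> K1 \<Longrightarrow> qabs (coeff_at (s k) I - v I)
          \<le> e"
        using s(2) e unfolding hlim_iff by blast
      obtain K2 where K2: "\<And>k I. k \<ge> K2 \<Longrightarrow> qabs (coeff_at (t k) I - v I)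
          \<le> e"
        using t(2) e unfolding hlim_iff by blast
      obtain K3 where K3: "\<And>k. k \<ge> K3 \<Longrightarrow> fps_le e (f - F_S (s k))"
        using f e unfolding qlim_iff by blast
      have "fps_le e (f - F_S (t k))" if k: "k \<ge> K1 + K2 + K3" for k
      proof -
        define w where "w = s k + heis_scale (- 1) (t k)"
        have "s k \<in> heis" "t k \<in> heis" using s t by auto
        then have "w \<in> heis" unfolding w_def by (intro heis_add heis_scale_mem)
        moreover have "heis_le e w"
          unfolding heis_le_def
        proof
          fix I
          have "coeff_at w I = (coeff_at (s k) I - v I) + - (coeff_at (t k) I - v I)"
            by (simp add: w_def lookup_add)
          then show "qabs (coeff_at w I) \<le> e"
            using qabs_add_le_max[of "coeff_at (s k) I - v I" "- (coeff_at (t k) I - v I)"] K1[of k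
                I] K2[of k I] k
            by (simp only: qabs_minus) linarith
        qed
        ultimately have "fps_le e (F_S w)" by (rule fps_le_F_S)
        moreover have "f - F_S (t k) = (f - F_S (s k)) + F_S w"
          by (simp add: w_def F_S_add F_S_scale flip: fps_const_neg)
        ultimately show ?thesis using K3[of k] k by (simp only: fps_le_add)
      qed
      then show "\<exists>K. \<forall>k\<ge>K. fps_le e (f - F_S (t k))" by blast
    qed
  qed
  then show "f' = f" if "\<forall>s. range s \<subseteq> heis \<longrightarrow> hlim s v
      \<longrightarrow> qlim (\<lambda>k. F_S (s k)) f'" for f'
    using that s qlim_unique by blast
qed

lemma power_half_le: "e > 0 \<Longrightarrow> \<exists>K. \<forall>k\<ge>K. C * (1 / 2) ^ k
    \<le> (e :: real)"
proof -
  assume e: "e > 0"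
  have "(\<lambda>k. C * (1 / 2 :: real) ^ k) \<longlonglongrightarrow> 0"
    using tendsto_mult_right_zero[OF LIMSEQ_realpow_zero[of "1 / 2 :: real"]] by simp
  then show ?thesis
    using order_tendstoD(2)[of _ 0 sequentially e] e
        by (force simp: eventually_sequentially intro: less_imp_le)
qed

text \<open>Lift the quotients of the successive differences by 2^k to states of norm at most 1 and
  sum them with these powers of 2 restored; the sum converges. The scalar \<open>c\<close> allows
  for a bounded denominator.\<close>

lemma approx_image:
  assumes "approx f0 g" and f: "f = fps_const c * f0"
  shows "f \<in> M2" "\<exists>v\<in>S1. F_S_hat v = f"
proof -
  have fg: "fps_le (qabs c * (1 / 2) ^ k) (f - fps_const c * g k)" for k
    using fps_le_mult[OF fps_le_const[of c "qabs c"] approxD(3)[OF assms(1), of k]]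
    by (simp add: f right_diff_distrib)
  have lim: "qlim (\<lambda>k. fps_const c * g k) f"
    unfolding qlim_iff using power_half_le[of _ "qabs c"] fg fps_le_mono by meson
  have "range (\<lambda>k. fps_const c * g k) \<subseteq> E4E6_ring"
    using approxD(1)[OF assms(1)] int_ring_E4E6 E4E6_ring_scale by blast
  then show "f \<in> M2" using lim by (auto simp: M2_def)
  have "\<exists>w\<in>heis. heis_le 1 w \<and> g (Suc k) - g k = 2 ^ k * F_S w" for k
    using approxD(2)[OF assms(1), of k] int_ring_lift by metis
  then obtain w where w: "\<And>k. w k \<in> heis" "\<And>k. heis_le 1 (w k)" "\<And>k. g (Suc k) -
      g k = 2 ^ k * F_S (w k)"
    by metis
  obtain w0 where w0: "w0 \<in> heis" "F_S w0 = g 0"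
    using int_ring_lift[OF approxD(1)[OF assms(1), of 0]] by blast
  define s where "s k = heis_scale c (w0 + (\<Sum>i<k. heis_scale (2 ^ i) (w i)))" for k
  have s: "range s \<subseteq> heis"
  proof -
    have "(\<Sum>i<k. heis_scale (2 ^ i) (w i)) \<in> heis" for k
      by (induction k) (simp_all add: heis_0 heis_add heis_scale_mem w)
    then show ?thesis unfolding s_def using w0 by (auto intro: heis_add heis_scale_mem)
  qed
  have "F_S (s k) = fps_const c * g k" for k
  proof -
    have "F_S (w0 + (\<Sum>i<k. heis_scale (2 ^ i) (w i))) = g k"
    proof (induction k)
      case (Suc k)
      show ?case using Suc w(3)[of k, unfolded two_power_fps]
          by (simp add: F_S_add F_S_scale algebra_simps)
    qed (simp add: w0)
    then show ?thesis by (simp add: s_def F_S_scale)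
  qed
  then have F: "qlim (\<lambda>k. F_S (s k)) f" using lim by simp
  have diff: "qabs (coeff_at (s m) I - coeff_at (s n) I) \<le> qabs c * (1 / 2) ^ K" if "K
      \<le> n" "n \<le> m" for m n K I
  proof -
    have "(\<Sum>i<m. heis_scale (2 ^ i) (w i)) = (\<Sum>i<n. heis_scale (2 ^ i) (w i))
        + (\<Sum>i=n..<m. heis_scale (2 ^ i) (w i))"
      using sum.atLeastLessThan_concat[of 0 n m "\<lambda>i. heis_scale (2 ^ i) (w i)"] that
      by (simp add: atLeast0LessThan)
    then have "coeff_at (s m) I - coeff_at (s n) I = c * (\<Sum>i=n..<m. 2 ^ i * coeff_at (w i) I)"
      by (simp add: s_def lookup_add lookup_sum algebra_simps)
    moreover have "qabs (\<Sum>i=n..<m. 2 ^ i * coeff_at (w i) I) \<le> (1 / 2) ^ K"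
    proof (rule qabs_sum_le)
      fix i assume "i \<in> {n..<m}"
      then have "(1 / 2 :: real) ^ i \<le> (1 / 2) ^ K" using that by (intro power_decreasing) auto
      then show "qabs (2 ^ i * coeff_at (w i) I) \<le> (1 / 2) ^ K"
        using mult_mono[of "(1 / 2) ^ i" "(1 / 2) ^ K" "qabs (coeff_at (w i) I)" 1] w(2)[of i]
        by (simp add: qabs_mult qabs_power qabs_2 heis_le_def qabs_nonneg)
    qed simp
    ultimately show ?thesis by (simp add: qabs_mult mult_left_mono qabs_nonneg)
  qed
  have "uniformly_Cauchy_on UNIV (\<lambda>k. coeff_at (s k))"
    unfolding uniformly_Cauchy_on_def
  proof (intro allI impI)
    fix e :: real assume "e > 0"
    then obtain K where K: "qabs c * (1 / 2) ^ K
        \<le> e / 2" using power_half_le[of "e / 2" "qabs c"] by auto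
    have "dist (coeff_at (s m) I) (coeff_at (s n) I) < e" if "K \<le> m" "K \<le> n" for m n I
      using diff[of K n m I] diff[of K m n I] that K \<open>e > 0\<close> dist_commute[of "coeff_at
          (s m) I"]
      by (cases "n \<le> m") (auto simp: dist_Q2_def)
    then show "\<exists>M. \<forall>x\<in>UNIV. \<forall>m\<ge>M. \<forall>n\<ge>M. dist (coeff_at
        (s m) x) (coeff_at (s n) x) < e" by blast
  qed
  then obtain v where v: "hlim s v"
    using Cauchy_uniformly_convergent unfolding uniformly_convergent_on_def hlim_def by blast
  then have "v \<in> S1" using s by (auto simp: S1_def)
  moreover have "F_S_hat v = f" by (rule F_S_hat_eqI[OF s v F])
  ultimately show "\<exists>v\<in>S1. F_S_hat v = f" by blast
qed

text \<open>Rewriting the series in powers of 64 lambda turns the growth condition into coefficients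
  tending to 0, since 64^n has absolute value 2^(-6n).\<close>

lemma lambda_series_image:
  assumes "(\<lambda>n. qabs (a n) * 2 ^ (6 * n)) \<longlonglongrightarrow> 0"
  shows "\<exists>f\<in>M2. qlim (\<lambda>N. \<Sum>n<N. fps_const (a n) * lambda ^ n) f
      \<and> (\<exists>v\<in>S1. F_S_hat v = f)"
proof -
  define b where "b n = a n / 64 ^ n" for n
  have q64: "qabs (64 ^ n) = (1 / 2) ^ (6 * n)" for n
    using qabs_power[of 2 "6 * n"] by (simp add: qabs_2 power_mult)
  have qb: "qabs (b n) = qabs (a n) * 2 ^ (6 * n)" for n
    unfolding b_def qabs_divide q64 by (simp add: power_one_over)
  have b0: "(\<lambda>n. qabs (b n)) \<longlonglongrightarrow> 0" using assms by (simp add: qb)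
  obtain C where C: "\<And>n. qabs (b n) \<le> C"
    using convergent_imp_Bseq[of "\<lambda>n. qabs (b n)"] b0
        by (auto simp: convergent_def Bseq_def qabs_nonneg)
  \<comment> \<open>Null sequences are bounded but perhaps not by 1; multiplying by 2^K makes the
    coefficients integral, and the scalar in \<open>approx_image\<close> undoes this.\<close>
  obtain K where K: "C * (1 / 2) ^ K \<le> 1" using power_half_le[of 1 C] by auto
  define b' where "b' n = 2 ^ K * b n" for n
  have qb': "qabs (b' n) = (1 / 2) ^ K * qabs (b n)" for n
    by (simp add: b'_def qabs_mult qabs_power qabs_2)
  have "qabs (b' n) \<le> 1" for n
  proof -
    have "qabs (b' n) \<le> (1 / 2) ^ K * C" unfolding qb' by (intro mult_left_mono C) simp
    also have "\<dots> \<le> 1" using K by (simp only: mult.commute)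
    finally show ?thesis .
  qed
  moreover have b'0: "(\<lambda>n. qabs (b' n)) \<longlonglongrightarrow> 0"
    unfolding qb' using tendsto_mult_right_zero[OF b0] by simp
  ultimately obtain g where g: "approx (lambda64_series b') g" using approx_lambda64_series by blast
  define f where "f = fps_const (1 / 2 ^ K) * lambda64_series b'"
  have "qlim (\<lambda>N. \<Sum>n<N. fps_const (a n) * lambda ^ n) f"
    unfolding qlim_iff
  proof (intro allI impI)
    fix e :: real assume e: "e > 0"
    then obtain M where M: "\<And>n. n \<ge> M \<Longrightarrow> qabs (b' n) \<le> e / 2 ^ K"
      using order_tendstoD(2)[OF b'0, of "e / 2 ^ K"]
          by (force simp: eventually_sequentially intro: less_imp_le)
    have "fps_le e (f - (\<Sum>n<N. fps_const (a n) * lambda ^ n))" if "N \<ge> M" for N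
    proof -
      have term_eq: "fps_const (a n) * lambda ^ n
          = fps_const (1 / 2 ^ K) * (fps_const (b' n) * lambda64 ^ n)" for n
      proof -
        have "lambda64 ^ n = fps_const (64 ^ n) * lambda ^ n"
          by (simp add: lambda64_def numeral_fps_const power_mult_distrib)
        then show ?thesis by (simp add: b'_def b_def flip: mult.assoc)
      qed
      have "f - (\<Sum>n<N. fps_const (a n) * lambda ^ n)
          = fps_const (1 / 2 ^ K) * (lambda64_series b' - (\<Sum>n<N. fps_const (b' n) * lambda64 ^ n))"
        unfolding term_eq f_def by (simp add: right_diff_distrib sum_distrib_left)
      moreover have "fps_le (e / 2 ^ K) (lambda64_series b' - (\<Sum>n<N. fps_const (b' n) *
          lambda64 ^ n))"
        by (rule lambda64_series_tail) (use M that e in auto)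
      moreover have "qabs (1 / 2 ^ K) \<le> 2 ^ K"
        by (simp add: qabs_divide qabs_power qabs_2 power_one_over)
      ultimately show ?thesis
        using fps_le_mult[OF fps_le_const[of "1 / 2 ^ K" "2 ^ K"]] by fastforce
    qed
    then show "\<exists>M. \<forall>N\<ge>M. fps_le e (f - (\<Sum>n<N. fps_const (a n) * lambda ^
        n))" by blast
  qed
  then show ?thesis using approx_image[OF g f_def] by blast
qed

theorem theorem1p1:
  shows "(\<forall>a :: nat \<Rightarrow> Q2. (\<lambda>n. qabs (a n) * 2 ^ (6 * n)) \<longlonglongrightarrow> 0 \<longrightarrow>
            (\<exists>f\<in>M2. qlim (\<lambda>N. \<Sum>n<N. fps_const (a n) * lambda ^ n) f \<and>
                    (\<exists>v\<in>S1. F_S_hat v = f)))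
       \<and> M2_dagger \<subseteq> F_S_hat ` S1"
proof (intro conjI allI impI)
  fix a :: "nat \<Rightarrow> Q2" assume "(\<lambda>n. qabs (a n) * 2 ^ (6 * n)) \<longlonglongrightarrow> 0"
  then show "\<exists>f\<in>M2. qlim (\<lambda>N. \<Sum>n<N. fps_const (a n) * lambda ^ n) f \<and> (\<exists>v\<in>S1. F_S_hat v = f)"
    by (rule lambda_series_image)
next
  show "M2_dagger \<subseteq> F_S_hat ` S1"
    \<comment> \<open>An element of \<open>M2_dagger\<close> is given only as some limit of the
      partial sums; uniqueness identifies it with the limit already known to be a character.\<close>
    using lambda_series_image qlim_unique unfolding M2_dagger_def by fastforce
qed

end
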